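(* Let $k\in\mathbb Z_+$, let $\boldsymbol\tau^{(1)},\dots,\boldsymbol\tau^{(k)}$ be i.i.d. copies of the non-delayed renewal process $\boldsymbol\tau$, and set $\Theta_s=\mathbf 1_{\{s\in\boldsymbol\tau^{(1)}\cap\cdots\cap\boldsymbol\tau^{(k)}\}}$, $s\in\mathbb N_0$. Let $P_\alpha$ be a standard Pareto random variable, $\mathbb P(P_\alpha>x)=x^{-\alpha}$ for $x\ge1$, independent of $(\Theta_s)_{s\in\mathbb N_0}$. Then, for each fixed $t\in\mathbb N_0$, the conditional joint law $\mathcal L(X_0/c,X_1/c,\dots,X_t/c\mid X_0>c)$ converges weakly to the joint law $\mathcal L(P_\alpha\Theta_0,\dots,P_\alpha\Theta_t)$ as $c\to\infty$.
   Context: $\mathbb Z_+=\{1,2,\dots\}$, $\mathbb N_0=\{0,1,2,\dots\}$, $\alpha\in(0,\infty)$. Renewal process: $\boldsymbol\tau=\{\tau_0=0,\tau_1,\tau_2,\dots\}$ with $\tau_{i+1}-\tau_i$ i.i.d. $\mathbb Z_+$-valued with distribution function $F$. Assume $\overline F(x)=1-F(x)\sim\mathrm C_Fx^{-\beta}$ as $x\to\infty$ for some $\beta\in(0,1)$ and $\mathrm C_F>0$, and $\sup_{n\in\mathbb Z_+}n\,(F(n)-F(n-1))/\overline F(n)<\infty$. Stationary shift: let $\pi$ be the infinite, $\sigma$-finite measure on $\mathbb N_0$ with $\pi(\{j\})=\overline F(j)$. Let $E=\mathcal P(\mathbb N_0)\setminus\{\emptyset\}$ (power set identified with $\{0,1\}^{\mathbb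 N_0}$ with the cylindrical $\sigma$-field), and let $\mu$ be the $\sigma$-finite infinite measure on $E$ that is the pushforward of $\pi\times\mathrm{Law}(\boldsymbol\tau)$ under $(d,\boldsymbol\tau)\mapsto d+\boldsymbol\tau=\{d,d+\tau_1,d+\tau_2,\dots\}$. It is shift-invariant and $\mu(\{u:t\in u\})=1$ for each $t\in\mathbb N_0$. Model: let $\sum_{i\ge1}\delta_{(\eta_i,\boldsymbol\tau_i^* )}$ be a Poisson point process on $(0,\infty)\times E$ with intensity measure $\alpha x^{-\alpha-1}dx\,d\mu$, and let $\mathcal D_k=\{\boldsymbol i\in\mathbb Z_+^k:i_1,\dots,i_k\text{ all distinct}\}$. The $k$-tuple regenerative model is the stationary process $$X_t=\bigvee_{\boldsymbol i\in\mathcal D_k}\eta_{i_1}\cdots\eta_{i_k}\,\mathbf 1_{\{t\in\boldsymbol\tau_{i_1}^*\}}\cdots\mathbf 1_{\{t\in\boldsymbol\tau_{i_k}^*\}},\qquad t\in\mathbb N_0 .$$ *)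

theory Defs
  imports "HOL-Probability.Probability"
begin

section \<open>Random subsets of the natural numbers\<close>

text \<open>
  The cylindrical sigma-field on the power set of \<open>nat\<close> is pulled back from the product
  sigma-field on \<open>nat \<Rightarrow> bool\<close> along the identification of a set with its characteristic function;
  \<open>E_space\<close> is its trace on the nonempty sets.
\<close>

definition E_space :: "nat set measure" where
  "E_space = restrict_space
     (vimage_algebra UNIV (\<lambda>u t. t \<in> u) (\<Pi>\<^sub>M t\<in>UNIV. count_space (UNIV :: bool set)))
     (UNIV - {{}})"

section \<open>Renewal processes\<close>

text \<open>
  A renewal process is treated as the random set of its renewal times. The law of the i.i.d.
  inter-arrival times is given as a \<open>nat pmf\<close>.
\<close>

definition step_df :: "nat pmf \<Rightarrow> real \<Rightarrow> real" where
  "step_df p = cdf (distr (measure_pmf p) borel real)"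

definition step_tail :: "nat pmf \<Rightarrow> real \<Rightarrow> real" where
  "step_tail p x = 1 - step_df p x"

definition renewal_set :: "(nat \<Rightarrow> nat) \<Rightarrow> nat set" where
  "renewal_set \<xi> = range (\<lambda>n. \<Sum>i<n. \<xi> i)"

definition renewal_law :: "nat pmf \<Rightarrow> nat set measure" where
  "renewal_law p = distr (\<Pi>\<^sub>M i\<in>(UNIV :: nat set). measure_pmf p) E_space renewal_set"

definition delay_measure :: "nat pmf \<Rightarrow> nat measure" where
  "delay_measure p = density (count_space UNIV) (\<lambda>j. ennreal (step_tail p (real j)))"

definition stationary_renewal_measure :: "nat pmf \<Rightarrow> nat set measure" where
  "stationary_renewal_measure p =
     distr (delay_measure p \<Otimes>\<^sub>M renewal_law p) E_space (\<lambda>(d, u). (\<lambda>s. d + s) ` u)"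

section \<open>Poisson point processes\<close>

text \<open>
  A point process is given by an enumeration \<open>Z\<close> of its points (with repetition according to
  multiplicity). The number of points in a set may be infinite, whence the extended type.
  The Poisson weights are written out because \<open>poisson_pmf\<close> is specified for positive rates only,
  whereas sets of intensity 0 have to be covered.
\<close>

definition point_count :: "(nat \<Rightarrow> 'a \<Rightarrow> 'b) \<Rightarrow> 'b set \<Rightarrow> 'a \<Rightarrow> ennreal" where
  "point_count Z A \<omega> = emeasure (count_space UNIV) {i. Z i \<omega> \<in> A}"

definition poisson_point_process :: "'a measure \<Rightarrow> 'b measure \<Rightarrow> (nat \<Rightarrow> 'a \<Rightarrow> 'b) \<Rightarrow> bool" where
  "poisson_point_process M \<nu> Z \<longleftrightarrow>
     prob_space M \<and>
     (\<forall>i. Z i \<in> measurable M \<nu>) \<and>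
     (\<forall>A\<in>sets \<nu>. emeasure \<nu> A < \<infinity> \<longrightarrow>
        (\<forall>n. \<P>(\<omega> in M. point_count Z A \<omega> = of_nat n) =
             measure \<nu> A ^ n / fact n * exp (- measure \<nu> A))) \<and>
     (\<forall>A\<in>sets \<nu>. emeasure \<nu> A = \<infinity> \<longrightarrow> (AE \<omega> in M. point_count Z A \<omega> = \<infinity>)) \<and>
     (\<forall>(n::nat) A. (\<forall>j<n. A j \<in> sets \<nu>) \<and> disjoint_family_on A {..<n} \<longrightarrow>
        prob_space.indep_vars M (\<lambda>_. borel) (\<lambda>j. point_count Z (A j)) {..<n})"

section \<open>The k-tuple regenerative model\<close>

definition regenerative_intensity :: "real \<Rightarrow> nat pmf \<Rightarrow> (real \<times> nat set) measure" where
  "regenerative_intensity \<alpha> p =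
     density (restrict_space lborel {0<..}) (\<lambda>x. ennreal (\<alpha> * x powr (- \<alpha> - 1)))
       \<Otimes>\<^sub>M stationary_renewal_measure p"

definition distinct_tuples :: "nat \<Rightarrow> (nat \<Rightarrow> nat) set" where
  "distinct_tuples k = {i \<in> {..<k} \<rightarrow>\<^sub>E UNIV. inj_on i {..<k}}"

text \<open>
  The supremum is taken in the extended nonnegative reals. In the model it is almost surely finite;
  \<open>enn2real\<close> makes the process real-valued (with value 0 on the exceptional null set).
\<close>

definition tuple_process ::
  "nat \<Rightarrow> (nat \<Rightarrow> 'a \<Rightarrow> real) \<Rightarrow> (nat \<Rightarrow> 'a \<Rightarrow> nat set) \<Rightarrow> nat \<Rightarrow> 'a \<Rightarrow> real" where
  "tuple_process k \<eta> S t \<omega> =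
     enn2real (\<Squnion>i\<in>distinct_tuples k.
       ennreal ((\<Prod>j<k. \<eta> (i j) \<omega>) * (\<Prod>j<k. indicator (S (i j) \<omega>) t)))"

section \<open>Independence of two random variables with different ranges\<close>

text \<open>
  The library's \<open>indep_var\<close> forces both random variables to have values in the same type.
\<close>

definition indep_pair ::
  "'a measure \<Rightarrow> 'b measure \<Rightarrow> ('a \<Rightarrow> 'b) \<Rightarrow> 'c measure \<Rightarrow> ('a \<Rightarrow> 'c) \<Rightarrow> bool" where
  "indep_pair M A Y B Z \<longleftrightarrow>
     Y \<in> measurable M A \<and> Z \<in> measurable M B \<and>
     prob_space.indep_set M {Y -` U \<inter> space M | U. U \<in> sets A} {Z -` V \<inter> space M | V. V \<in> sets B}"

section \<open>Weak convergence\<close>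

text \<open>
  The library's \<open>weak_conv_m\<close> covers only sequences of measures on the real line.
\<close>

definition converges_weakly ::
  "'b topology \<Rightarrow> ('c \<Rightarrow> 'b measure) \<Rightarrow> 'b measure \<Rightarrow> 'c filter \<Rightarrow> bool" where
  "converges_weakly T \<mu> \<nu> F \<longleftrightarrow>
     (\<forall>f :: 'b \<Rightarrow> real. continuous_map T euclideanreal f \<and> bounded (f ` topspace T) \<longrightarrow>
        ((\<lambda>c. \<integral>x. f x \<partial>\<mu> c) \<longlongrightarrow> (\<integral>x. f x \<partial>\<nu>)) F)"

section \<open>Measurability of the maps used above\<close>

text \<open>
  The function \<open>distr\<close> yields a meaningful image measure only along measurable maps.
\<close>

lemma space_E_space: "space E_space = UNIV - {{}}"
  by (simp add: E_space_def space_restrict_space)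

lemma measurable_E_spaceI:
  assumes ne: "\<And>\<omega>. \<omega> \<in> space M \<Longrightarrow> f \<omega> \<noteq> {}"
    and mem: "\<And>t. Measurable.pred M (\<lambda>\<omega>. t \<in> f \<omega>)"
  shows "f \<in> measurable M E_space"
  unfolding E_space_def
proof (rule measurable_restrict_space2)
  show "f \<in> space M \<rightarrow> UNIV - {{}}" using ne by auto
  show "f \<in> measurable M (vimage_algebra UNIV (\<lambda>u t. t \<in> u)
          (\<Pi>\<^sub>M t\<in>UNIV. count_space (UNIV :: bool set)))"
    by (rule measurable_vimage_algebra2) (auto intro!: measurable_PiM_single' mem)
qed

lemma pred_mem_E_space: "Measurable.pred E_space (\<lambda>u. t \<in> u)"
proof -
  have "(\<lambda>u t. t \<in> u) \<in> measurable E_space (\<Pi>\<^sub>M t\<in>UNIV. count_space (UNIV :: bool set))"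
    unfolding E_space_def
    by (intro measurable_restrict_space1 measurable_vimage_algebra1) (simp add: space_PiM)
  from measurable_compose[OF this measurable_component_singleton[of t UNIV]]
  show ?thesis by simp
qed

lemma measurable_renewal_set:
  "renewal_set \<in> measurable (\<Pi>\<^sub>M i\<in>(UNIV :: nat set). measure_pmf p) E_space"
proof (rule measurable_E_spaceI)
  fix t :: nat
  have [measurable]: "(\<lambda>\<xi>. \<xi> i) \<in> measurable (\<Pi>\<^sub>M i\<in>(UNIV :: nat set). measure_pmf p)
      (count_space UNIV)" for i
    using measurable_component_singleton[of i UNIV "\<lambda>_. measure_pmf p"] by simp
  show "Measurable.pred (\<Pi>\<^sub>M i\<in>(UNIV :: nat set). measure_pmf p) (\<lambda>\<xi>. t \<in> renewal_set \<xi>)"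
    unfolding renewal_set_def image_iff by measurable
qed (auto simp: renewal_set_def)

lemma measurable_delayed_set:
  "(\<lambda>(d, u). (\<lambda>s. d + s) ` u) \<in> measurable (delay_measure p \<Otimes>\<^sub>M renewal_law p) E_space"
proof (rule measurable_E_spaceI)
  fix \<omega> :: "nat \<times> nat set"
  assume "\<omega> \<in> space (delay_measure p \<Otimes>\<^sub>M renewal_law p)"
  then show "(case \<omega> of (d, u) \<Rightarrow> (\<lambda>s. d + s) ` u) \<noteq> {}"
    by (auto simp: space_pair_measure renewal_law_def space_E_space)
next
  fix t :: nat
  let ?N = "delay_measure p \<Otimes>\<^sub>M renewal_law p"
  have [measurable]: "Measurable.pred ?N (\<lambda>\<omega>. s \<in> snd \<omega>)" for s
  proof -
    have "snd \<in> measurable ?N E_space"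
      using measurable_snd[of "delay_measure p" "renewal_law p"]
      by (simp add: renewal_law_def cong: measurable_cong_sets)
    from measurable_compose[OF this pred_mem_E_space] show ?thesis .
  qed
  have [measurable]: "fst \<in> measurable ?N (count_space UNIV)"
  proof -
    have "sets (delay_measure p) = sets (count_space UNIV)"
      by (simp add: delay_measure_def)
    then have "measurable ?N (delay_measure p) = measurable ?N (count_space UNIV)"
      by (rule measurable_cong_sets[OF refl])
    with measurable_fst[of "delay_measure p" "renewal_law p"] show ?thesis by blast
  qed
  have "(\<lambda>\<omega>. t \<in> (case \<omega> of (d, u) \<Rightarrow> (\<lambda>s. d + s) ` u)) =
      (\<lambda>\<omega>. \<exists>s. s \<in> snd \<omega> \<and> t = fst \<omega> + s)"
    by (auto simp: fun_eq_iff image_iff)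
  moreover have "Measurable.pred ?N (\<lambda>\<omega>. \<exists>s. s \<in> snd \<omega> \<and> t = fst \<omega> + s)"
    by measurable
  ultimately show "Measurable.pred ?N (\<lambda>\<omega>. t \<in> (case \<omega> of (d, u) \<Rightarrow> (\<lambda>s. d + s) ` u))"
    by simp
qed

end

theory Submission
  imports Defs
begin

text \<open>
  The proof is an exact computation for Poisson points followed by an asymptotic one for products of
  Pareto variables.

  Fix a level \<open>L\<close> and look only at the points with magnitude above \<open>L\<close> whose set meets \<open>{0..t}\<close>. Their
  intensity \<open>q\<close> is finite, at most \<open>(t + 1) * L powr - \<alpha>\<close>, hence small for large \<open>L\<close>. Those whose set
  contains \<open>0\<close> have intensity \<open>L powr - \<alpha>\<close> times the law of \<open>(L * exp V, u)\<close>, where \<open>V\<close> is exponential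
  with rate \<open>\<alpha>\<close> and \<open>u\<close> is an independent renewal set: a delayed renewal set contains \<open>0\<close> only if the delay
  is \<open>0\<close>, and this delay has mass \<open>1\<close> (\<open>emeasure_\<nu>_big_zero\<close>). Given that a region contains \<open>n\<close> points,
  these are \<open>n\<close> independent samples of the normalised intensity, which is expressed here as an identity
  for sums over tuples of distinct indices (\<open>nn_integral_tuple_sum\<close>).

  The event \<open>X 0 > c\<close> asks for \<open>k\<close> distinct points whose sets contain \<open>0\<close> and whose magnitudes have a product
  above \<open>c\<close>. A sum of \<open>k\<close> exponential variables has an Erlang law, so the intensity of such \<open>k\<close>-tuples above
  level \<open>L\<close> is asymptotic to \<open>c powr - \<alpha> * (\<alpha> * ln c) ^ (k - 1) / fact (k - 1)\<close>. This does not depend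
  on \<open>L\<close>, and it has one more logarithm than the same expression with \<open>k - 1\<close> factors. Three consequences
  follow. A tuple with a magnitude below \<open>L\<close> is negligible, because its \<open>j < k\<close> magnitudes above \<open>L\<close> would have
  to reach \<open>c / L ^ (k - j)\<close>. A further point above \<open>L\<close> costs a factor of order \<open>q\<close>. Finally, the \<open>k\<close> points
  may be required to exceed a second, much larger level \<open>L'\<close> without any loss to first order.

  Therefore, up to an error that for large \<open>L\<close> is small compared with its probability, \<open>X 0 > c\<close> is the event \<open>good L L' c\<close>
  that exactly \<open>k\<close> points lie above \<open>L\<close> and that all of them contain \<open>0\<close>, lie above \<open>L'\<close> and have a product
  above \<open>c\<close> (\<open>exceedance_tuple\<close>, \<open>prob_exceedance_le\<close>). On it \<open>X 0\<close> is the product. For \<open>s \<le> t\<close> the value \<open>X s\<close>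
  is the same product if \<open>s\<close> lies in all \<open>k\<close> sets; otherwise every tuple uses a point below \<open>L\<close> in place of one
  above \<open>L'\<close>, and \<open>X s \<le> X 0 * (L / L')\<close> (\<open>good_structure\<close>). So the path divided by \<open>c\<close> is close to \<open>X 0 / c\<close> times the
  indicator of the intersection of \<open>k\<close> independent renewal sets, which are independent of the magnitudes.
  The asymptotics of the tail is regularly varying with index \<open>- \<alpha>\<close>, which turns \<open>X 0 / c\<close> into a Pareto
  variable (\<open>tuple_integral_asymptotics\<close>, \<open>exceedance_functional_asymptotics\<close>).
\<close>

section \<open>Counting injective tuples\<close>

text \<open>
  The entries are chosen one after the other. At step \<open>l\<close> the class \<open>I (f l)\<close> has lost exactly the entries
  at the earlier positions with the same label, because the classes are disjoint.
\<close>

lemma card_inj_tuples_following: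
  fixes I :: "'c \<Rightarrow> nat set" and f :: "nat \<Rightarrow> 'c"
  assumes fin: "\<And>c. c \<in> C \<Longrightarrow> finite (I c)" and disj: "disjoint_family_on I C"
    and f: "\<And>l. l < n \<Longrightarrow> f l \<in> C"
  shows "finite {i \<in> distinct_tuples n. \<forall>l<n. i l \<in> I (f l)} \<and>
    card {i \<in> distinct_tuples n. \<forall>l<n. i l \<in> I (f l)} =
      (\<Prod>l<n. card (I (f l)) - card {l'. l' < l \<and> f l' = f l})"
  using f
proof (induction n)
  case 0
  have "{i \<in> distinct_tuples 0. \<forall>l<0. i l \<in> I (f l)} = {\<lambda>_. undefined}"
    by (auto simp: distinct_tuples_def)
  then show ?case by simp
next
  case (Suc n)
  let ?T = "\<lambda>n. {i \<in> distinct_tuples n. \<forall>l<n. i l \<in> I (f l)}"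
  let ?S = "SIGMA g:?T n. I (f n) - g ` {..<n}"
  have IH: "finite (?T n)"
    "card (?T n) = (\<Prod>l<n. card (I (f l)) - card {l'. l' < l \<and> f l' = f l})"
    using Suc.IH Suc.prems by auto
  have bij: "bij_betw (\<lambda>(g, y). g(n := y)) ?S (?T (Suc n))"
  proof (rule bij_betw_byWitness[where f' = "\<lambda>i. (i(n := undefined), i n)"])
    show "\<forall>a\<in>?S. (\<lambda>i. (i(n := undefined), i n)) (case a of (g, y) \<Rightarrow> g(n := y)) = a"
      by (auto simp: distinct_tuples_def PiE_def extensional_def fun_eq_iff)
    show "\<forall>a'\<in>?T (Suc n). (case (\<lambda>i. (i(n := undefined), i n)) a' of (g, y) \<Rightarrow> g(n := y)) = a'"
      by auto
    show "(\<lambda>(g, y). g(n := y)) ` ?S \<subseteq> ?T (Suc n)"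
    proof (rule image_subsetI)
      fix a assume "a \<in> ?S"
      then obtain g y where a: "a = (g, y)" and g: "g \<in> distinct_tuples n" "\<forall>l<n. g l \<in> I (f l)"
        and y: "y \<in> I (f n)" "y \<notin> g ` {..<n}" by auto
      have "inj_on (g(n := y)) (insert n {..<n})"
        using g y by (auto simp: distinct_tuples_def inj_on_def)
      with g y show "(case a of (g, y) \<Rightarrow> g(n := y)) \<in> ?T (Suc n)"
        by (auto simp: a distinct_tuples_def PiE_def extensional_def lessThan_Suc less_Suc_eq)
    qed
    show "(\<lambda>i. (i(n := undefined), i n)) ` ?T (Suc n) \<subseteq> ?S"
    proof (rule image_subsetI)
      fix i assume i: "i \<in> ?T (Suc n)"
      then have inj: "inj_on i {..<Suc n}" by (auto simp: distinct_tuples_def)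
      then have "inj_on (i(n := undefined)) {..<n}" by (auto simp: inj_on_def)
      moreover have "i l \<noteq> i n" if "l < n" for l
        using inj_onD[OF inj, of l n] that by auto
      then have "i n \<notin> (i(n := undefined)) ` {..<n}" by fastforce
      ultimately show "(i(n := undefined), i n) \<in> ?S"
        using i by (auto simp: distinct_tuples_def PiE_def extensional_def)
    qed
  qed
  have fib: "card (I (f n) - g ` {..<n}) = card (I (f n)) - card {l'. l' < n \<and> f l' = f n}"
    if g: "g \<in> ?T n" for g
  proof -
    have "I (f n) \<inter> g ` {..<n} = g ` {l'. l' < n \<and> f l' = f n}"
    proof safe
      fix l assume "l < n" "g l \<in> I (f n)"
      moreover have "g l \<in> I (f l)" using g \<open>l < n\<close> by auto
      moreover have "f l \<in> C" "f n \<in> C" using Suc.prems \<open>l < n\<close> by auto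
      ultimately have "f l = f n" using disj by (auto simp: disjoint_family_on_def)
      then show "g l \<in> g ` {l'. l' < n \<and> f l' = f n}" using \<open>l < n\<close> by auto
    next
      fix l assume "l < n" "f l = f n"
      then show "g l \<in> I (f n)" using g by (metis (mono_tags, lifting) mem_Collect_eq)
    qed auto
    moreover have "card (g ` {l'. l' < n \<and> f l' = f n}) = card {l'. l' < n \<and> f l' = f n}"
      using g by (intro card_image) (auto simp: distinct_tuples_def inj_on_def)
    ultimately show ?thesis
      using fin[of "f n"] Suc.prems by (subst card_Diff_subset_Int) auto
  qed
  have finS: "finite ?S" using IH fin Suc.prems by (intro finite_SigmaI) auto
  have "card (?T (Suc n)) = card ?S"
    using bij_betw_same_card[OF bij] by simp
  also have "\<dots> = (\<Sum>g\<in>?T n. card (I (f n) - g ` {..<n}))"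
    using IH(1) fin Suc.prems by (intro card_SigmaI) auto
  also have "\<dots> = card (?T n) * (card (I (f n)) - card {l'. l' < n \<and> f l' = f n})"
    using fib by simp
  finally show ?case using IH(2) bij_betw_finite[OF bij] finS by simp
qed

text \<open>
  If each class has as many elements as there are positions with its label, the factors belonging to one
  class run down from the size of the class to one.
\<close>

lemma prod_remaining_eq_fact:
  fixes f :: "nat \<Rightarrow> 'c"
  assumes "finite C" and f: "\<And>l. l < n \<Longrightarrow> f l \<in> C"
  shows "(\<Prod>l<n. card {l'. l' < n \<and> f l' = f l} - card {l'. l' < l \<and> f l' = f l}) =
    (\<Prod>c\<in>C. fact (card {l'. l' < n \<and> f l' = c}))"
proof -
  have ind: "(\<Prod>l\<in>{l \<in> {..<n}. f l = c}. m - card {l'. l' < l \<and> f l' = c}) =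
      (\<Prod>j<card {l'. l' < n \<and> f l' = c}. m - j)" for m c n
  proof (induction n)
    case (Suc n)
    show ?case
    proof (cases "f n = c")
      case True
      have "{l \<in> {..<Suc n}. f l = c} = insert n {l \<in> {..<n}. f l = c}"
        "{l'. l' < Suc n \<and> f l' = c} = insert n {l'. l' < n \<and> f l' = c}"
        using True by (auto simp: less_Suc_eq)
      then show ?thesis using Suc by (simp add: mult.commute)
    next
      case False
      then have "{l \<in> {..<Suc n}. f l = c} = {l \<in> {..<n}. f l = c}"
        "{l'. l' < Suc n \<and> f l' = c} = {l'. l' < n \<and> f l' = c}"
        by (auto simp: less_Suc_eq)
      then show ?thesis using Suc by simp
    qed
  qed simp
  have "(\<Prod>l<n. card {l'. l' < n \<and> f l' = f l} - card {l'. l' < l \<and> f l' = f l}) =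
    (\<Prod>c\<in>C. \<Prod>l\<in>{l \<in> {..<n}. f l = c}. card {l'. l' < n \<and> f l' = f l} - card {l'. l' < l \<and> f l' = f l})"
    using assms by (intro prod.group[symmetric]) auto
  also have "\<dots> = (\<Prod>c\<in>C. \<Prod>l\<in>{l \<in> {..<n}. f l = c}. card {l'. l' < n \<and> f l' = c} - card {l'. l' < l \<and> f l' = c})"
    by (intro prod.cong) auto
  also have "\<dots> = (\<Prod>c\<in>C. fact (card {l'. l' < n \<and> f l' = c}))"
    unfolding ind by (intro prod.cong refl) (simp add: fact_prod_rev lessThan_atLeast0)
  finally show ?thesis .
qed

lemma countable_distinct_tuples: "countable (distinct_tuples n)"
  unfolding distinct_tuples_def
  by (rule countable_subset[OF _ countable_PiE[of "{..<n}" "\<lambda>_. UNIV :: nat set"]]) auto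

text \<open>
  An injective tuple of length \<open>n\<close> in a set with \<open>n\<close> elements enumerates the set. This is how a sum over
  tuples becomes a statement about the set of all points.
\<close>

lemma distinct_tuples_onto:
  assumes "finite I" "card I = n"
  shows "card {i \<in> distinct_tuples n. \<forall>l<n. i l \<in> I} = fact n"
    and "finite {i \<in> distinct_tuples n. \<forall>l<n. i l \<in> I}"
    and "\<And>i. i \<in> distinct_tuples n \<Longrightarrow> \<forall>l<n. i l \<in> I \<Longrightarrow> bij_betw i {..<n} I"
proof -
  have "finite {i \<in> distinct_tuples n. \<forall>l<n. i l \<in> I} \<and>
    card {i \<in> distinct_tuples n. \<forall>l<n. i l \<in> I} = (\<Prod>l<n. card I - card {l'. l' < l})"
    using card_inj_tuples_following[of "{()}" "\<lambda>_. I" n "\<lambda>_. ()"] assms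
    by (auto simp: disjoint_family_on_def)
  then show "card {i \<in> distinct_tuples n. \<forall>l<n. i l \<in> I} = fact n"
     "finite {i \<in> distinct_tuples n. \<forall>l<n. i l \<in> I}"
    using assms by (auto simp: fact_prod_rev lessThan_atLeast0)
  fix i assume i: "i \<in> distinct_tuples n" "\<forall>l<n. i l \<in> I"
  then have "inj_on i {..<n}" "i ` {..<n} \<subseteq> I" by (auto simp: distinct_tuples_def)
  moreover from this have "i ` {..<n} = I"
    using assms by (intro card_subset_eq) (auto simp: card_image)
  ultimately show "bij_betw i {..<n} I" by (simp add: bij_betw_def)
qed

section \<open>Tuples of distinct points of a Poisson process\<close>

lemma point_count_eq_of_nat_iff:
  "point_count Z A \<omega> = of_nat n \<longleftrightarrow> finite {i. Z i \<omega> \<in> A} \<and> card {i. Z i \<omega> \<in> A} = n"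
proof (cases "finite {i. Z i \<omega> \<in> A}")
  case True
  then have "point_count Z A \<omega> = of_nat (card {i. Z i \<omega> \<in> A})"
    unfolding point_count_def by (subst emeasure_count_space_finite) auto
  then show ?thesis using True by (metis of_nat_eq_iff)
next
  case False
  then have "point_count Z A \<omega> = \<infinity>"
    unfolding point_count_def by (subst emeasure_count_space_infinite) auto
  then show ?thesis using False by (metis ennreal_of_nat_neq_top infinity_ennreal_def)
qed

locale poisson_process = prob_space M for M :: "'a measure" +
  fixes \<nu> :: "'b measure" and Z :: "nat \<Rightarrow> 'a \<Rightarrow> 'b"
  assumes poisson: "poisson_point_process M \<nu> Z"
begin

lemma measurable_point [measurable]: "Z i \<in> measurable M \<nu>"
  using poisson by (auto simp: poisson_point_process_def)

lemma pred_tuple_in: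
  fixes n :: nat
  assumes "\<And>l. l < n \<Longrightarrow> A l \<in> sets \<nu>"
  shows "Measurable.pred M (\<lambda>\<omega>. \<forall>l<n. Z (i l) \<omega> \<in> A l)"
proof -
  have "Measurable.pred M (\<lambda>\<omega>. Z (i l) \<omega> \<in> A l)" if "l < n" for l
    using measurable_point assms[OF that] by (rule pred_sets2[rotated])
  then have "Measurable.pred M (\<lambda>\<omega>. \<forall>l\<in>{..<n}. Z (i l) \<omega> \<in> A l)"
    by (intro pred_intros_finite(3)) auto
  then show ?thesis by (simp only: Ball_def lessThan_iff)
qed

lemma indep_point_counts:
  fixes n :: nat
  assumes "\<And>j. j < n \<Longrightarrow> A j \<in> sets \<nu>" "disjoint_family_on A {..<n}"
  shows "indep_vars (\<lambda>_. borel) (\<lambda>j. point_count Z (A j)) {..<n}"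
proof -
  have "\<forall>(n::nat) A. (\<forall>j<n. A j \<in> sets \<nu>) \<and> disjoint_family_on A {..<n} \<longrightarrow>
        indep_vars (\<lambda>_. borel) (\<lambda>j. point_count Z (A j)) {..<n}"
    using poisson unfolding poisson_point_process_def by (elim conjE) assumption
  from this[rule_format, of n A] assms show ?thesis by auto
qed

lemma measurable_point_count:
  assumes "A \<in> sets \<nu>" shows "point_count Z A \<in> borel_measurable M"
proof -
  have "indep_vars (\<lambda>_. borel) (\<lambda>j. point_count Z ((\<lambda>_. A) j)) {..<1::nat}"
    using assms by (intro indep_point_counts) (auto simp: disjoint_family_on_def)
  then show ?thesis by (auto simp: indep_vars_def)
qed

lemma pred_point_count_eq [measurable]:
  assumes "A \<in> sets \<nu>" shows "Measurable.pred M (\<lambda>\<omega>. point_count Z A \<omega> = of_nat n)"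
  using measurable_point_count[OF assms] by measurable

lemma prob_point_count_eq:
  assumes "A \<in> sets \<nu>" "emeasure \<nu> A < \<infinity>"
  shows "prob {\<omega>\<in>space M. point_count Z A \<omega> = of_nat n} =
    measure \<nu> A ^ n / fact n * exp (- measure \<nu> A)"
  using poisson assms by (auto simp: poisson_point_process_def)

lemma AE_finite_point_count:
  assumes "A \<in> sets \<nu>" "emeasure \<nu> A < \<infinity>"
  shows "AE \<omega> in M. \<exists>n. point_count Z A \<omega> = of_nat n"
proof -
  let ?E = "\<lambda>n. {\<omega>\<in>space M. point_count Z A \<omega> = of_nat n}"
  have [measurable]: "A \<in> sets \<nu>" by fact
  have "(\<lambda>n. prob (?E n)) sums prob (\<Union>n. ?E n)"
    by (intro finite_measure_UNION) (auto simp: disjoint_family_on_def)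
  moreover have "(\<lambda>n. measure \<nu> A ^ n / fact n * exp (- measure \<nu> A)) sums
      (exp (measure \<nu> A) * exp (- measure \<nu> A))"
    using exp_converges[of "measure \<nu> A"]
    by (intro sums_mult2) (simp only: divide_inverse real_scaleR_def mult.commute)
  ultimately have "prob (\<Union>n. ?E n) = 1"
    unfolding prob_point_count_eq[OF assms] by (simp add: exp_minus sums_iff)
  then have "AE \<omega> in M. \<omega> \<in> (\<Union>n. ?E n)"
    by (subst (asm) prob_eq_1) auto
  then show ?thesis by (rule AE_mp) (rule AE_I2, blast)
qed

lemma prob_point_counts_eq:
  assumes "finite C" and disj: "disjoint_family_on A C"
    and A: "\<And>c. c \<in> C \<Longrightarrow> A c \<in> sets \<nu>" "\<And>c. c \<in> C \<Longrightarrow> emeasure \<nu> (A c) < \<infinity>"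
  shows "prob {\<omega>\<in>space M. \<forall>c\<in>C. point_count Z (A c) \<omega> = of_nat (m c)} =
    (\<Prod>c\<in>C. measure \<nu> (A c) ^ m c / fact (m c) * exp (- measure \<nu> (A c)))"
proof (cases "C = {}")
  case True then show ?thesis by (simp add: prob_space)
next
  case False
  obtain e where e: "bij_betw e {..<card C} C"
    using ex_bij_betw_nat_finite[OF \<open>finite C\<close>] by (auto simp: lessThan_atLeast0)
  have eC: "e j \<in> C" if "j < card C" for j using e that by (auto simp: bij_betw_def)
  have ne: "{..<card C} \<noteq> {}" using False \<open>finite C\<close> by (simp add: lessThan_empty_iff)
  have "indep_vars (\<lambda>_. borel) (\<lambda>j. point_count Z ((\<lambda>j. A (e j)) j)) {..<card C}"
  proof -
    have "disjoint_family_on (\<lambda>j. A (e j)) {..<card C}"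
      unfolding disjoint_family_on_def
    proof (intro ballI impI)
      fix j j' assume "j \<in> {..<card C}" "j' \<in> {..<card C}" "j \<noteq> j'"
      moreover from this have "e j \<noteq> e j'" using e by (auto simp: bij_betw_def inj_on_def)
      ultimately show "A (e j) \<inter> A (e j') = {}"
        using disj eC by (auto simp: disjoint_family_on_def)
    qed
    then show ?thesis using A eC by (intro indep_point_counts) auto
  qed
  from indep_varsD_finite[OF this ne, of "\<lambda>j. {of_nat (m (e j))}"]
  have "prob (\<Inter>j\<in>{..<card C}. point_count Z (A (e j)) -` {of_nat (m (e j))} \<inter> space M) =
     (\<Prod>j\<in>{..<card C}. prob (point_count Z (A (e j)) -` {of_nat (m (e j))} \<inter> space M))"
    by simp
  also have "(\<Inter>j\<in>{..<card C}. point_count Z (A (e j)) -` {of_nat (m (e j))} \<inter> space M) =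
      {\<omega>\<in>space M. \<forall>c\<in>C. point_count Z (A c) \<omega> = of_nat (m c)}"
  proof -
    have "C = e ` {..<card C}" using e by (auto simp: bij_betw_def)
    then have "(\<forall>c\<in>C. Q c) \<longleftrightarrow> (\<forall>j\<in>{..<card C}. Q (e j))" for Q by (metis (no_types, lifting) image_eqI imageE)
    then show ?thesis using ne by auto
  qed
  also have "(\<Prod>j\<in>{..<card C}. prob (point_count Z (A (e j)) -` {of_nat (m (e j))} \<inter> space M)) =
      (\<Prod>j\<in>{..<card C}. measure \<nu> (A (e j)) ^ m (e j) / fact (m (e j)) * exp (- measure \<nu> (A (e j))))"
  proof (intro prod.cong refl)
    fix j assume "j \<in> {..<card C}"
    moreover have "point_count Z (A (e j)) -` {of_nat (m (e j))} \<inter> space M =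
      {\<omega>\<in>space M. point_count Z (A (e j)) \<omega> = of_nat (m (e j))}" by auto
    ultimately show "prob (point_count Z (A (e j)) -` {of_nat (m (e j))} \<inter> space M) =
      measure \<nu> (A (e j)) ^ m (e j) / fact (m (e j)) * exp (- measure \<nu> (A (e j)))"
      using prob_point_count_eq A eC by simp
  qed
  also have "\<dots> = (\<Prod>c\<in>C. measure \<nu> (A c) ^ m c / fact (m c) * exp (- measure \<nu> (A c)))"
    by (rule prod.reindex_bij_betw[OF e])
  finally show ?thesis .
qed

text \<open>
  The case of a rectangle, from which the law of the points given their number is derived. The sides need
  not be disjoint, so \<open>B\<close> is cut into the atoms \<open>C c\<close> on which exactly the sides \<open>A l\<close> with \<open>l \<in> c\<close> hold. The
  counts of the atoms are independent Poisson variables. Assign to each position \<open>l\<close> an atom \<open>f l\<close> inside \<open>A l\<close>.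
  If \<open>B\<close> contains exactly \<open>n\<close> points, a tuple that follows \<open>f\<close> exists only if each atom contains as many points as
  \<open>f\<close> has positions for it, and then the number of such tuples is a product of factorials, which cancels
  against the denominators of the Poisson weights.
\<close>

lemma nn_integral_count_tuples_rectangle:
  assumes B: "B \<in> sets \<nu>" "emeasure \<nu> B < \<infinity>"
    and A: "\<And>l. l < n \<Longrightarrow> A l \<in> sets \<nu>" "\<And>l. l < n \<Longrightarrow> A l \<subseteq> B"
  shows "(\<integral>\<^sup>+\<omega>. indicator {\<omega>. point_count Z B \<omega> = of_nat n} \<omega> *
      emeasure (count_space UNIV) {i\<in>distinct_tuples n. \<forall>l<n. Z (i l) \<omega> \<in> A l} \<partial>M) =
    ennreal (exp (- measure \<nu> B) * (\<Prod>l<n. measure \<nu> (A l)))"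
proof -
  define P where "P = Pow {..<n}"
  define C where "C c = {z\<in>B. {l\<in>{..<n}. z \<in> A l} = c}" for c
  define \<Phi> where "\<Phi> = Pi\<^sub>E {..<n} (\<lambda>l. {c\<in>P. l \<in> c})"
  define N where "N f c = card {l. l < n \<and> f l = c}" for f :: "nat \<Rightarrow> nat set" and c
  define E where "E f = {\<omega>\<in>space M. \<forall>c\<in>P. point_count Z (C c) \<omega> = of_nat (N f c)}" for f
  have finP: "finite P" and fin\<Phi>: "finite \<Phi>"
    by (auto simp: P_def \<Phi>_def intro!: finite_PiE)
  have Csets: "C c \<in> sets \<nu>" if "c \<in> P" for c
  proof -
    have "C c = B \<inter> (\<Inter>l\<in>{..<n}. if l \<in> c then B \<inter> A l else B - A l)"
      using that by (auto simp: C_def P_def split: if_splits)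
    moreover have "(if l \<in> c then B \<inter> A l else B - A l) \<in> sets \<nu>" if "l < n" for l
      using A B that by auto
    ultimately show ?thesis
      using B(1) by (cases "n = 0") (auto simp add: lessThan_empty_iff simp del: if_image_distrib intro!: sets.Int sets.finite_INT)
  qed
  have Cdisj: "disjoint_family_on C P" by (auto simp: disjoint_family_on_def C_def)
  have Cfin: "emeasure \<nu> (C c) < \<infinity>" for c
  proof -
    have "C c \<subseteq> B" by (auto simp: C_def)
    from emeasure_mono[OF this B(1)] B(2) show ?thesis by (rule le_less_trans)
  qed
  have BC: "B = (\<Union>c\<in>P. C c)" by (auto simp: C_def P_def)
  have AC: "A l = (\<Union>c\<in>{c\<in>P. l \<in> c}. C c)" if "l < n" for l
    using that A(2)[OF that] by (auto simp: C_def P_def)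
  have \<Phi>P: "f l \<in> P" "l \<in> f l" if "f \<in> \<Phi>" "l < n" for f l using that by (auto simp: \<Phi>_def)
  have sumN: "(\<Sum>c\<in>P. N f c) = n" if f: "f \<in> \<Phi>" for f
  proof -
    have "(\<Sum>c\<in>P. N f c) = card (\<Union>c\<in>P. {l. l < n \<and> f l = c})"
      unfolding N_def using finP by (subst card_UN_disjoint) auto
    also have "(\<Union>c\<in>P. {l. l < n \<and> f l = c}) = {..<n}" using \<Phi>P[OF f] by auto
    finally show ?thesis by simp
  qed
  \<comment> \<open>Pathwise decomposition of the number of tuples according to the atoms of their entries.\<close>
  have path: "indicator {\<omega>. point_count Z B \<omega> = of_nat n} \<omega> *
      emeasure (count_space UNIV) {i\<in>distinct_tuples n. \<forall>l<n. Z (i l) \<omega> \<in> A l} =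
    (\<Sum>f\<in>\<Phi>. of_nat (\<Prod>c\<in>P. fact (N f c)) *
      indicator (E f) \<omega>)"
    if \<omega>: "\<omega> \<in> space M" for \<omega>
  proof -
    define I where "I c = {i. Z i \<omega> \<in> C c}" for c
    have UI: "{i. Z i \<omega> \<in> B} = (\<Union>c\<in>P. I c)" using BC by (auto simp: I_def)
    have Idisj: "disjoint_family_on I P" using Cdisj by (auto simp: disjoint_family_on_def I_def)
    show ?thesis
    proof (cases "point_count Z B \<omega> = of_nat n")
      case False
      have "\<not> (\<forall>c\<in>P. point_count Z (C c) \<omega> = of_nat (N f c))" if f: "f \<in> \<Phi>" for f
      proof
        assume *: "\<forall>c\<in>P. point_count Z (C c) \<omega> = of_nat (N f c)"
        then have fin: "finite (I c)" "card (I c) = N f c" if "c \<in> P" for c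
          using that by (auto simp: point_count_eq_of_nat_iff I_def)
        then have "card (\<Union>c\<in>P. I c) = n"
          using Idisj finP sumN[OF f] by (subst card_UN_disjoint) (auto simp: disjoint_family_on_def)
        then have "point_count Z B \<omega> = of_nat n"
          unfolding point_count_eq_of_nat_iff UI using finP fin by auto
        with False show False by simp
      qed
      then have "(\<Sum>f\<in>\<Phi>. of_nat (\<Prod>c\<in>P. fact (N f c)) *
        indicator (E f) \<omega>) = (0::ennreal)"
        by (intro sum.neutral) (simp add: E_def indicator_def)
      then show ?thesis using False by simp
    next
      case True
      then have Ifin: "finite {i. Z i \<omega> \<in> B}" "card {i. Z i \<omega> \<in> B} = n"
        by (auto simp: point_count_eq_of_nat_iff)
      have finI: "finite (I c)" if "c \<in> P" for c
        using Ifin(1) that unfolding UI using finP by auto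
      define T where "T f = {i\<in>distinct_tuples n. \<forall>l<n. i l \<in> I (f l)}" for f
      have TU: "{i\<in>distinct_tuples n. \<forall>l<n. Z (i l) \<omega> \<in> A l} = (\<Union>f\<in>\<Phi>. T f)"
      proof (intro set_eqI iffI)
        fix i assume i: "i \<in> {i\<in>distinct_tuples n. \<forall>l<n. Z (i l) \<omega> \<in> A l}"
        define f where "f = (\<lambda>l\<in>{..<n}. {l'\<in>{..<n}. Z (i l) \<omega> \<in> A l'})"
        have "f \<in> \<Phi>" using i by (auto simp: f_def \<Phi>_def P_def)
        moreover have "i \<in> T f" using i A(2) by (auto simp: T_def f_def I_def C_def)
        ultimately show "i \<in> (\<Union>f\<in>\<Phi>. T f)" by auto
      next
        fix i assume "i \<in> (\<Union>f\<in>\<Phi>. T f)"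
        then obtain f where f: "f \<in> \<Phi>" "i \<in> T f" by auto
        have "Z (i l) \<omega> \<in> A l" if "l < n" for l
          unfolding AC[OF that] using \<Phi>P[OF f(1) that] f(2) that by (auto simp: T_def I_def)
        then show "i \<in> {i\<in>distinct_tuples n. \<forall>l<n. Z (i l) \<omega> \<in> A l}"
          using f(2) by (auto simp: T_def)
      qed
      have Tfin: "finite (T f)" if "f \<in> \<Phi>" for f
        using card_inj_tuples_following[of P I n f] finI Idisj \<Phi>P[OF that] by (auto simp: T_def)
      have Tdisj: "T f \<inter> T g = {}" if fg: "f \<in> \<Phi>" "g \<in> \<Phi>" "f \<noteq> g" for f g
      proof -
        obtain l where l: "l < n" "f l \<noteq> g l"
          using fg PiE_ext[of f "{..<n}" _ g] unfolding \<Phi>_def by blast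
        then have "I (f l) \<inter> I (g l) = {}"
          using Idisj \<Phi>P(1)[OF fg(1)] \<Phi>P(1)[OF fg(2)] by (auto simp: disjoint_family_on_def)
        then show ?thesis using l by (auto simp: T_def)
      qed
      have cardT: "card (T f) = (if \<forall>c\<in>P. point_count Z (C c) \<omega> = of_nat (N f c)
          then \<Prod>c\<in>P. fact (N f c) else 0)" if f: "f \<in> \<Phi>" for f
      proof (cases "\<forall>c\<in>P. point_count Z (C c) \<omega> = of_nat (N f c)")
        case True
        then have cI: "card (I c) = N f c" if "c \<in> P" for c
          using that by (auto simp: point_count_eq_of_nat_iff I_def)
        have "card (T f) = (\<Prod>l<n. card (I (f l)) - card {l'. l' < l \<and> f l' = f l})"
          using card_inj_tuples_following[of P I n f] finI Idisj \<Phi>P[OF f] by (auto simp: T_def)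
        also have "\<dots> = (\<Prod>l<n. card {l'. l' < n \<and> f l' = f l} - card {l'. l' < l \<and> f l' = f l})"
          using cI \<Phi>P[OF f] by (intro prod.cong) (auto simp: N_def)
        also have "\<dots> = (\<Prod>c\<in>P. fact (N f c))"
          using finP \<Phi>P[OF f] unfolding N_def by (intro prod_remaining_eq_fact) auto
        finally show ?thesis using True by simp
      next
        case False
        have "T f = {}"
        proof (rule ccontr)
          assume "T f \<noteq> {}"
          then obtain i where i: "i \<in> distinct_tuples n" "\<forall>l<n. i l \<in> I (f l)" by (auto simp: T_def)
          have le: "N f c \<le> card (I c)" if "c \<in> P" for c
            unfolding N_def
          proof (rule card_inj_on_le[of i])
            show "inj_on i {l. l < n \<and> f l = c}"
              using i(1) by (auto simp: distinct_tuples_def inj_on_def)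
          qed (use i finI that in auto)
          have "(\<Sum>c\<in>P. N f c) = (\<Sum>c\<in>P. card (I c))"
            unfolding sumN[OF f] Ifin(2)[symmetric] UI
            using finI Idisj finP by (subst card_UN_disjoint) (auto simp: disjoint_family_on_def)
          then have "N f c = card (I c)" if "c \<in> P" for c
            using sum_mono_inv[of "N f" P "\<lambda>c. card (I c)" c] le that finP by auto
          then have "\<forall>c\<in>P. point_count Z (C c) \<omega> = of_nat (N f c)"
            unfolding point_count_eq_of_nat_iff using finI by (auto simp: I_def)
          with False show False by simp
        qed
        with False show ?thesis by auto
      qed
      have "emeasure (count_space UNIV) (\<Union>f\<in>\<Phi>. T f) = of_nat (card (\<Union>f\<in>\<Phi>. T f))"
        using fin\<Phi> Tfin by (intro emeasure_count_space_finite) auto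
      also have "card (\<Union>f\<in>\<Phi>. T f) = (\<Sum>f\<in>\<Phi>. card (T f))"
        using fin\<Phi> Tfin Tdisj by (intro card_UN_disjoint) auto
      also have "of_nat \<dots> = (\<Sum>f\<in>\<Phi>. of_nat (\<Prod>c\<in>P. fact (N f c)) *
        (indicator (E f) \<omega> :: ennreal))"
        unfolding of_nat_sum using \<omega> by (intro sum.cong refl) (auto simp: cardT E_def indicator_def)
      finally show ?thesis unfolding TU using True by simp
    qed
  qed
  have Emeas: "E f \<in> events" for f
    unfolding E_def using Csets finP by (intro sets.sets_Collect_finite_All) (auto intro!: predE pred_point_count_eq)
  have mB: "measure \<nu> B = (\<Sum>c\<in>P. measure \<nu> (C c))"
    unfolding BC using finP Csets Cdisj Cfin by (intro measure_finite_Union) (auto simp: less_top)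
  have mA: "measure \<nu> (A l) = (\<Sum>c\<in>{c\<in>P. l \<in> c}. measure \<nu> (C c))" if "l < n" for l
    unfolding AC[OF that] using finP Csets Cdisj Cfin
    by (intro measure_finite_Union) (auto simp: less_top disjoint_family_on_def)
  have each: "of_nat (\<Prod>c\<in>P. fact (N f c)) *
      emeasure M (E f) =
      ennreal (exp (- measure \<nu> B) * (\<Prod>l<n. measure \<nu> (C (f l))))" if f: "f \<in> \<Phi>" for f
  proof -
    have "of_nat (\<Prod>c\<in>P. fact (N f c)) *
      emeasure M (E f) =
      ennreal (real (\<Prod>c\<in>P. fact (N f c)) * (\<Prod>c\<in>P. measure \<nu> (C c) ^ N f c / fact (N f c) * exp (- measure \<nu> (C c))))"
      unfolding emeasure_eq_measure E_def
      by (subst prob_point_counts_eq[OF finP Cdisj Csets Cfin])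
         (simp_all only: ennreal_of_nat_eq_real_of_nat ennreal_mult' of_nat_0_le_iff)
    also have "real (\<Prod>c\<in>P. fact (N f c)) * (\<Prod>c\<in>P. measure \<nu> (C c) ^ N f c / fact (N f c) * exp (- measure \<nu> (C c)))
       = (\<Prod>c\<in>P. measure \<nu> (C c) ^ N f c) * (\<Prod>c\<in>P. exp (- measure \<nu> (C c)))"
    proof -
      have "(\<Prod>c\<in>P. fact (N f c)) \<noteq> (0::real)" using finP by simp
      then show ?thesis by (simp add: prod.distrib prod_dividef)
    qed
    also have "(\<Prod>c\<in>P. exp (- measure \<nu> (C c))) = exp (- measure \<nu> B)"
      unfolding mB by (simp add: exp_sum[OF finP, symmetric] sum_negf)
    also have "(\<Prod>c\<in>P. measure \<nu> (C c) ^ N f c) = (\<Prod>c\<in>P. \<Prod>l\<in>{l\<in>{..<n}. f l = c}. measure \<nu> (C (f l)))"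
      by (intro prod.cong refl) (simp add: N_def)
    also have "\<dots> = (\<Prod>l<n. measure \<nu> (C (f l)))"
      using finP \<Phi>P[OF f] by (intro prod.group) auto
    finally show ?thesis by (simp add: mult.commute)
  qed
  have "(\<integral>\<^sup>+\<omega>. indicator {\<omega>. point_count Z B \<omega> = of_nat n} \<omega> *
      emeasure (count_space UNIV) {i\<in>distinct_tuples n. \<forall>l<n. Z (i l) \<omega> \<in> A l} \<partial>M) =
     (\<integral>\<^sup>+\<omega>. (\<Sum>f\<in>\<Phi>. of_nat (\<Prod>c\<in>P. fact (N f c)) *
      indicator (E f) \<omega>) \<partial>M)"
    using path by (intro nn_integral_cong) auto
  also have "\<dots> = (\<Sum>f\<in>\<Phi>. of_nat (\<Prod>c\<in>P. fact (N f c)) *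
      emeasure M (E f))"
    using Emeas by (subst nn_integral_sum) (auto simp: nn_integral_cmult_indicator)
  also have "\<dots> = (\<Sum>f\<in>\<Phi>. ennreal (exp (- measure \<nu> B) * (\<Prod>l<n. measure \<nu> (C (f l)))))"
    using each by (intro sum.cong) auto
  also have "\<dots> = ennreal (exp (- measure \<nu> B) * (\<Sum>f\<in>\<Phi>. \<Prod>l<n. measure \<nu> (C (f l))))"
    by (subst sum_ennreal) (auto simp: sum_distrib_left prod_nonneg)
  also have "(\<Sum>f\<in>\<Phi>. \<Prod>l<n. measure \<nu> (C (f l))) = (\<Prod>l<n. \<Sum>c\<in>{c\<in>P. l \<in> c}. measure \<nu> (C c))"
    unfolding \<Phi>_def using finP by (subst prod_sum_PiE) auto
  also have "\<dots> = (\<Prod>l<n. measure \<nu> (A l))"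
    using mA by (intro prod.cong) auto
  finally show ?thesis .
qed

text \<open>
  The sum of \<open>h\<close> over all tuples of \<open>n\<close> distinct points with the \<open>l\<close>-th point in \<open>D l\<close>. Points are distinct as
  indices, so that multiple points are treated correctly.
\<close>

definition tuple_sum :: "nat \<Rightarrow> (nat \<Rightarrow> 'b set) \<Rightarrow> ((nat \<Rightarrow> 'b) \<Rightarrow> ennreal) \<Rightarrow> 'a \<Rightarrow> ennreal" where
  "tuple_sum n D h \<omega> = (\<integral>\<^sup>+i. indicator {i. \<forall>l<n. Z (i l) \<omega> \<in> D l} i *
      h (\<lambda>l\<in>{..<n}. Z (i l) \<omega>) \<partial>count_space (distinct_tuples n))"

lemma measurable_tuple_at [measurable]:
  "(\<lambda>\<omega>. \<lambda>l\<in>{..<n}. Z (i l) \<omega>) \<in> measurable M (\<Pi>\<^sub>M l\<in>{..<n}. \<nu>)"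
  by (intro measurable_restrict) simp

lemma borel_measurable_tuple_indicator:
  fixes n :: nat
  assumes "\<And>l. l < n \<Longrightarrow> D l \<in> sets \<nu>"
  shows "(\<lambda>\<omega>. indicator {i. \<forall>l<n. Z (i l) \<omega> \<in> D l} i :: ennreal) \<in> borel_measurable M"
  unfolding indicator_def of_bool_def mem_Collect_eq
  by (rule measurable_If) (simp_all add: pred_tuple_in[OF assms, unfolded pred_def])

lemma pred_ex_distinct_tuple:
  assumes "\<And>i. Measurable.pred M (P i)"
  shows "Measurable.pred M (\<lambda>\<omega>. \<exists>i\<in>distinct_tuples n. P i \<omega>)"
proof -
  have "{\<omega>\<in>space M. \<exists>i\<in>distinct_tuples n. P i \<omega>} = (\<Union>i\<in>distinct_tuples n. {\<omega>\<in>space M. P i \<omega>})"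
    by auto
  also have "\<dots> \<in> events"
    using assms by (intro sets.countable_UN'' countable_distinct_tuples) (simp add: pred_def)
  finally show ?thesis by (simp add: pred_def)
qed

text \<open>
  Given that \<open>B\<close> contains \<open>n\<close> points, they behave like \<open>n\<close> independent samples. The sum over all their
  orderings avoids a choice of labels, and the different restrictions \<open>D l\<close> of the entries allow a
  tuple of interest to be padded with arbitrary points of \<open>B\<close>. Both sides are integrals with respect to finite
  measures on the product space, and these measures agree on rectangles.
\<close>

lemma nn_integral_tuple_sum:
  assumes B: "B \<in> sets \<nu>" "emeasure \<nu> B < \<infinity>"
    and D: "\<And>l. l < n \<Longrightarrow> D l \<in> sets \<nu>" "\<And>l. l < n \<Longrightarrow> D l \<subseteq> B"
    and Q: "\<And>l. prob_space (Q l)" "\<And>l. sets (Q l) = sets \<nu>"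
    and b: "\<And>l. 0 \<le> b l"
    and DQ: "\<And>l A. l < n \<Longrightarrow> A \<in> sets \<nu> \<Longrightarrow> emeasure \<nu> (A \<inter> D l) = ennreal (b l) * emeasure (Q l) A"
    and h: "h \<in> borel_measurable (\<Pi>\<^sub>M l\<in>{..<n}. \<nu>)"
  shows "(\<integral>\<^sup>+\<omega>. indicator {\<omega>. point_count Z B \<omega> = of_nat n} \<omega> * tuple_sum n D h \<omega> \<partial>M) =
    ennreal (exp (- measure \<nu> B) * (\<Prod>l<n. b l)) * (\<integral>\<^sup>+z. h z \<partial>(\<Pi>\<^sub>M l\<in>{..<n}. Q l))"
proof -
  let ?P = "M \<Otimes>\<^sub>M count_space (distinct_tuples n)" and ?V = "\<Pi>\<^sub>M l\<in>{..<n}. \<nu>"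
  define w :: "'a \<times> (nat \<Rightarrow> nat) \<Rightarrow> ennreal" where
    "w = (\<lambda>(\<omega>, i). indicator {\<omega>. point_count Z B \<omega> = of_nat n} \<omega> *
        indicator {i. \<forall>l<n. Z (i l) \<omega> \<in> D l} i)"
  define tup where "tup = (\<lambda>(\<omega>, i). \<lambda>l\<in>{..<n}. Z (i l) \<omega>)"
  define K where "K = exp (- measure \<nu> B) * (\<Prod>l<n. b l)"
  have count: "(\<lambda>\<omega>. indicator {\<omega>. point_count Z B \<omega> = of_nat n} \<omega> :: ennreal) \<in> borel_measurable M"
    unfolding indicator_def of_bool_def mem_Collect_eq
    by (rule measurable_If) (simp_all add: pred_point_count_eq[OF B(1), unfolded pred_def])
  have swap: "f \<in> measurable ?P K'" if "\<And>i. (\<lambda>\<omega>. f (\<omega>, i)) \<in> measurable M K'" for f and K' :: "'z measure"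
    by (subst measurable_pair_swap_iff)
       (auto intro!: measurable_pair_measure_countable1[OF countable_distinct_tuples] that)
  have w[measurable]: "w \<in> borel_measurable ?P"
    using D count
    by (intro swap) (auto simp: w_def intro!: borel_measurable_times_ennreal borel_measurable_tuple_indicator)
  have tup[measurable]: "tup \<in> measurable ?P ?V"
    by (rule swap) (simp add: tup_def)
  have fst: "(\<integral>\<^sup>+\<omega>. \<integral>\<^sup>+i. f (\<omega>, i) \<partial>count_space (distinct_tuples n) \<partial>M) = (\<integral>\<^sup>+x. f x \<partial>?P)"
    if "f \<in> borel_measurable ?P" for f
    using that
    by (intro sigma_finite_measure.nn_integral_fst sigma_finite_measure_count_space_countable
        countable_distinct_tuples)
  have sP: "sets (\<Pi>\<^sub>M l\<in>{..<n}. Q l) = sets ?V" using Q(2) by (intro sets_PiM_cong) auto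
  have spQ: "space (Q l) = space \<nu>" for l using Q(2) by (rule sets_eq_imp_space_eq)
  interpret Q: product_prob_space Q using Q(1) by (intro product_prob_spaceI)
  define M1 where "M1 = distr (density ?P w) ?V tup"
  have eq: "M1 = scale_measure (ennreal K) (\<Pi>\<^sub>M l\<in>{..<n}. Q l)"
  proof (rule measure_eqI_PiM_finite[where A = "\<lambda>_. \<Pi>\<^sub>E l\<in>{..<n}. space \<nu>"])
    show "sets M1 = sets ?V" by (simp add: M1_def)
    show "sets (scale_measure (ennreal K) (\<Pi>\<^sub>M l\<in>{..<n}. Q l)) = sets ?V" by (simp add: sP)
    show rect: "emeasure M1 (Pi\<^sub>E {..<n} A) = emeasure (scale_measure (ennreal K) (\<Pi>\<^sub>M l\<in>{..<n}. Q l)) (Pi\<^sub>E {..<n} A)"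
      if A: "\<And>l. l \<in> {..<n} \<Longrightarrow> A l \<in> sets \<nu>" for A
    proof -
      have Am: "Pi\<^sub>E {..<n} A \<in> sets ?V" using A by (intro sets_PiM_I_finite) auto
      have "emeasure M1 (Pi\<^sub>E {..<n} A) = (\<integral>\<^sup>+x. w x * indicator (Pi\<^sub>E {..<n} A) (tup x) \<partial>?P)"
        unfolding M1_def using Am tup
        by (subst emeasure_distr)
           (auto simp: emeasure_density measurable_sets indicator_def intro!: nn_integral_cong)
      also have "\<dots> = (\<integral>\<^sup>+\<omega>. \<integral>\<^sup>+i. w (\<omega>, i) * indicator (Pi\<^sub>E {..<n} A) (tup (\<omega>, i))
          \<partial>count_space (distinct_tuples n) \<partial>M)"
        by (intro fst[symmetric] borel_measurable_times_ennreal w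
            measurable_compose[OF tup borel_measurable_indicator[OF Am]])
      also have "\<dots> = (\<integral>\<^sup>+\<omega>. indicator {\<omega>. point_count Z B \<omega> = of_nat n} \<omega> *
          emeasure (count_space UNIV) {i\<in>distinct_tuples n. \<forall>l<n. Z (i l) \<omega> \<in> A l \<inter> D l} \<partial>M)"
      proof (intro nn_integral_cong)
        fix \<omega>
        let ?T = "{i\<in>distinct_tuples n. \<forall>l<n. Z (i l) \<omega> \<in> A l \<inter> D l}"
        have "(\<integral>\<^sup>+i. w (\<omega>, i) * indicator (Pi\<^sub>E {..<n} A) (tup (\<omega>, i)) \<partial>count_space (distinct_tuples n))
          = (\<integral>\<^sup>+i. indicator {\<omega>. point_count Z B \<omega> = of_nat n} \<omega> * indicator ?T i
              \<partial>count_space (distinct_tuples n))"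
          by (intro nn_integral_cong) (auto simp: w_def tup_def indicator_def PiE_iff)
        also have "\<dots> = indicator {\<omega>. point_count Z B \<omega> = of_nat n} \<omega> *
            emeasure (count_space (distinct_tuples n)) ?T"
          by (subst nn_integral_cmult) auto
        also have "emeasure (count_space (distinct_tuples n)) ?T = emeasure (count_space UNIV) ?T"
          by (subst (1 2) emeasure_count_space) auto
        finally show "(\<integral>\<^sup>+i. w (\<omega>, i) * indicator (Pi\<^sub>E {..<n} A) (tup (\<omega>, i))
            \<partial>count_space (distinct_tuples n)) =
          indicator {\<omega>. point_count Z B \<omega> = of_nat n} \<omega> * emeasure (count_space UNIV) ?T" .
      qed
      also have "\<dots> = ennreal (exp (- measure \<nu> B) * (\<Prod>l<n. measure \<nu> (A l \<inter> D l)))"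
        using A D by (intro nn_integral_count_tuples_rectangle B) auto
      also have "(\<Prod>l<n. measure \<nu> (A l \<inter> D l)) = (\<Prod>l<n. b l) * (\<Prod>l<n. measure (Q l) (A l))"
        unfolding prod.distrib[symmetric] using A b
        by (intro prod.cong refl) (simp add: measure_def DQ enn2real_mult)
      also have "ennreal (exp (- measure \<nu> B) * ((\<Prod>l<n. b l) * (\<Prod>l<n. measure (Q l) (A l)))) =
          ennreal K * (\<Prod>l<n. emeasure (Q l) (A l))"
      proof -
        have "(\<Prod>l<n. emeasure (Q l) (A l)) = ennreal (\<Prod>l<n. measure (Q l) (A l))"
          by (simp add: Q.M.emeasure_eq_measure prod_ennreal)
        moreover have "0 \<le> K" using b by (auto simp: K_def intro!: mult_nonneg_nonneg prod_nonneg)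
        ultimately show ?thesis
          by (simp only: ennreal_mult'[symmetric]) (simp only: K_def mult.assoc)
      qed
      also have "(\<Prod>l<n. emeasure (Q l) (A l)) = emeasure (\<Pi>\<^sub>M l\<in>{..<n}. Q l) (Pi\<^sub>E {..<n} A)"
        using A Q(2) by (intro Q.emeasure_PiM[symmetric]) auto
      finally show ?thesis by simp
    qed
    show "range (\<lambda>_. \<Pi>\<^sub>E l\<in>{..<n}. space \<nu>) \<subseteq> prod_algebra {..<n} (\<lambda>_. \<nu>)"
      by (auto intro!: prod_algebraI_finite)
    show "(\<Union>i. \<Pi>\<^sub>E l\<in>{..<n}. space \<nu>) = space ?V" by (simp add: space_PiM)
    show "emeasure M1 (\<Pi>\<^sub>E l\<in>{..<n}. space \<nu>) \<noteq> \<infinity>"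
    proof -
      have "emeasure (\<Pi>\<^sub>M l\<in>{..<n}. Q l) X \<noteq> \<infinity>" for X
        using Q(1) finite_measure.emeasure_finite[OF prob_space.finite_measure[OF prob_space_PiM[of "{..<n}" Q]]]
        by (simp add: infinity_ennreal_def)
      then show ?thesis by (subst rect) (auto simp: ennreal_mult_eq_top_iff)
    qed
  qed simp
  have "(\<integral>\<^sup>+\<omega>. indicator {\<omega>. point_count Z B \<omega> = of_nat n} \<omega> * tuple_sum n D h \<omega> \<partial>M) =
    (\<integral>\<^sup>+\<omega>. \<integral>\<^sup>+i. w (\<omega>, i) * h (tup (\<omega>, i)) \<partial>count_space (distinct_tuples n) \<partial>M)"
    unfolding tuple_sum_def
    by (intro nn_integral_cong, subst nn_integral_cmult[symmetric])
       (auto simp: w_def tup_def mult.assoc)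
  also have "\<dots> = (\<integral>\<^sup>+x. w x * h (tup x) \<partial>?P)"
    by (intro fst borel_measurable_times_ennreal w measurable_compose[OF tup h])
  also have "\<dots> = (\<integral>\<^sup>+z. h z \<partial>M1)"
    unfolding M1_def using h measurable_compose[OF tup h]
    by (subst nn_integral_distr) (auto simp: nn_integral_density)
  also have "\<dots> = ennreal K * (\<integral>\<^sup>+z. h z \<partial>(\<Pi>\<^sub>M l\<in>{..<n}. Q l))"
    unfolding eq using h by (subst nn_integral_scale_measure) (auto simp: measurable_cong_sets[OF sP refl])
  finally show ?thesis by (simp add: K_def)
qed

text \<open>
  If all points of \<open>B\<close> lie in \<open>D\<close>, the sum has one term for each of the \<open>n!\<close> enumerations of these points.
\<close>

lemma tuple_sum_symmetric:
  assumes count: "point_count Z B \<omega> = of_nat n" and "D \<subseteq> B"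
    and inD: "\<And>i. Z i \<omega> \<in> B \<Longrightarrow> Z i \<omega> \<in> D"
    and h: "\<And>i. bij_betw i {..<n} {i. Z i \<omega> \<in> B} \<Longrightarrow> h (\<lambda>l\<in>{..<n}. Z (i l) \<omega>) = v"
  shows "tuple_sum n (\<lambda>_. D) h \<omega> = fact n * v"
proof -
  let ?I = "{i. Z i \<omega> \<in> B}"
  have I: "finite ?I" "card ?I = n" using count by (auto simp: point_count_eq_of_nat_iff)
  have eq: "{i \<in> distinct_tuples n. \<forall>l<n. Z (i l) \<omega> \<in> D} = {i \<in> distinct_tuples n. \<forall>l<n. i l \<in> ?I}"
    using inD \<open>D \<subseteq> B\<close> by auto
  have "tuple_sum n (\<lambda>_. D) h \<omega> = (\<Sum>i\<in>{i \<in> distinct_tuples n. \<forall>l<n. Z (i l) \<omega> \<in> D}.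
      indicator {i. \<forall>l<n. Z (i l) \<omega> \<in> D} i * h (\<lambda>l\<in>{..<n}. Z (i l) \<omega>))"
    unfolding tuple_sum_def
    using distinct_tuples_onto(2)[OF I] unfolding eq[symmetric]
    by (intro nn_integral_count_space') auto
  also have "\<dots> = (\<Sum>i\<in>{i \<in> distinct_tuples n. \<forall>l<n. Z (i l) \<omega> \<in> D}. v)"
  proof (intro sum.cong refl)
    fix i assume "i \<in> {i \<in> distinct_tuples n. \<forall>l<n. Z (i l) \<omega> \<in> D}"
    moreover from this have "bij_betw i {..<n} ?I"
      unfolding eq by (intro distinct_tuples_onto(3)[OF I]) auto
    ultimately show "indicator {i. \<forall>l<n. Z (i l) \<omega> \<in> D} i * h (\<lambda>l\<in>{..<n}. Z (i l) \<omega>) = v"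
      using h by simp
  qed
  also have "\<dots> = fact n * v"
    using distinct_tuples_onto(1)[OF I] unfolding eq[symmetric] by simp
  finally show ?thesis .
qed

lemma tuple_sum_eq_0:
  assumes count: "point_count Z B \<omega> = of_nat n" and "D \<subseteq> B"
    and i: "Z i \<omega> \<in> B" "Z i \<omega> \<notin> D"
  shows "tuple_sum n (\<lambda>_. D) h \<omega> = 0"
proof -
  let ?I = "{i. Z i \<omega> \<in> B}"
  have I: "finite ?I" "card ?I = n" using count by (auto simp: point_count_eq_of_nat_iff)
  have "\<not> (\<forall>l<n. Z (i' l) \<omega> \<in> D)" if i': "i' \<in> distinct_tuples n" for i'
  proof
    assume *: "\<forall>l<n. Z (i' l) \<omega> \<in> D"
    then have "bij_betw i' {..<n} ?I"
      using \<open>D \<subseteq> B\<close> by (intro distinct_tuples_onto(3)[OF I i']) auto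
    then have "i \<in> i' ` {..<n}" using i by (simp add: bij_betw_def)
    then obtain l where "l < n" "i' l = i" by auto
    then show False using * i by auto
  qed
  then have "tuple_sum n (\<lambda>_. D) h \<omega> = (\<integral>\<^sup>+i. 0 \<partial>count_space (distinct_tuples n))"
    unfolding tuple_sum_def by (intro nn_integral_cong) (auto simp: indicator_def)
  then show ?thesis by simp
qed

lemma tuple_sum_ge:
  assumes "i \<in> distinct_tuples n" "\<And>l. l < n \<Longrightarrow> Z (i l) \<omega> \<in> D l"
  shows "h (\<lambda>l\<in>{..<n}. Z (i l) \<omega>) \<le> tuple_sum n D h \<omega>"
proof -
  have "h (\<lambda>l\<in>{..<n}. Z (i l) \<omega>) =
      (\<integral>\<^sup>+i'. h (\<lambda>l\<in>{..<n}. Z (i l) \<omega>) * indicator {i} i' \<partial>count_space (distinct_tuples n))"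
    using assms(1) by (subst nn_integral_cmult_indicator) auto
  also have "\<dots> \<le> tuple_sum n D h \<omega>"
    unfolding tuple_sum_def using assms(2) by (intro nn_integral_mono) (auto simp: indicator_def)
  finally show ?thesis .
qed

lemma extend_distinct_tuple:
  assumes "finite I" "card I = n" "j \<le> n" and i: "i \<in> distinct_tuples j" "\<And>l. l < j \<Longrightarrow> i l \<in> I"
  obtains i' where "i' \<in> distinct_tuples n" "\<And>l. l < n \<Longrightarrow> i' l \<in> I" "\<And>l. l < j \<Longrightarrow> i' l = i l"
proof -
  have inj: "inj_on i {..<j}" using i by (auto simp: distinct_tuples_def)
  have "card (I - i ` {..<j}) = card {j..<n}"
    using assms inj by (subst card_Diff_subset) (auto simp: card_image)
  then obtain g where g: "bij_betw g {j..<n} (I - i ` {..<j})"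
    using finite_same_card_bij[of "{j..<n}" "I - i ` {..<j}"] assms(1) by auto
  define i' where "i' = (\<lambda>l\<in>{..<n}. if l < j then i l else g l)"
  have g': "g l \<in> I" "g l \<notin> i ` {..<j}" if "j \<le> l" "l < n" for l
    using bij_betw_apply[OF g, of l] that by simp_all
  have "inj_on i' {..<n}"
  proof (rule inj_onI)
    fix l l' assume l: "l \<in> {..<n}" "l' \<in> {..<n}" "i' l = i' l'"
    consider "l < j" "l' < j" | "l < j" "l' \<ge> j" | "l \<ge> j" "l' < j" | "l \<ge> j" "l' \<ge> j" by linarith
    then show "l = l'"
    proof cases
      case 1 then show ?thesis using l inj by (auto simp: i'_def inj_on_def)
    next
      case 2
      then have "i l \<in> i ` {..<j}" "g l' \<notin> i ` {..<j}" using g'(2)[of l'] l by auto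
      moreover have "i l = g l'" using 2 l by (simp add: i'_def)
      ultimately show ?thesis by metis
    next
      case 3
      then have "i l' \<in> i ` {..<j}" "g l \<notin> i ` {..<j}" using g'(2)[of l] l by auto
      moreover have "i l' = g l" using 3 l by (simp add: i'_def)
      ultimately show ?thesis by metis
    next
      case 4
      then have "g l = g l'" using l by (auto simp: i'_def)
      then show ?thesis using g 4 l by (auto simp: bij_betw_def inj_on_def)
    qed
  qed
  then show thesis
    using assms g' by (intro that[of i']) (auto simp: i'_def distinct_tuples_def)
qed

text \<open>
  First-moment bound for \<open>j\<close>-tuples in a region with \<open>n\<close> points: a \<open>j\<close>-tuple extends to at least one \<open>n\<close>-tuple, and
  each of the \<open>n - j\<close> additional points contributes a factor \<open>measure \<nu> B\<close>. The number of extensions is not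
  divided out; the resulting geometric series in \<open>n\<close> is still summable when \<open>measure \<nu> B < 1\<close>.
\<close>

lemma prob_exists_tuple_le:
  assumes B: "B \<in> sets \<nu>" "emeasure \<nu> B < \<infinity>" "emeasure \<nu> B \<noteq> 0"
    and D: "D \<in> sets \<nu>" "D \<subseteq> B"
    and Q: "prob_space Q" "sets Q = sets \<nu>"
    and b: "0 \<le> b" and DQ: "\<And>A. A \<in> sets \<nu> \<Longrightarrow> emeasure \<nu> (A \<inter> D) = ennreal b * emeasure Q A"
    and A: "A \<in> sets (\<Pi>\<^sub>M l\<in>{..<j}. \<nu>)" and "j \<le> n"
  shows "emeasure M {\<omega>\<in>space M. point_count Z B \<omega> = of_nat n \<and>
      (\<exists>i\<in>distinct_tuples j. (\<forall>l<j. Z (i l) \<omega> \<in> D) \<and> (\<lambda>l\<in>{..<j}. Z (i l) \<omega>) \<in> A)} \<le>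
    ennreal (measure \<nu> B ^ (n - j) * b ^ j * measure (\<Pi>\<^sub>M l\<in>{..<j}. Q) A)"
proof -
  define D' where "D' l = (if l < j then D else B)" for l
  define Q' where "Q' l = (if l < j then Q else uniform_measure \<nu> B)" for l
  define b' where "b' l = (if l < j then b else measure \<nu> B)" for l
  define h where "h z = (indicator A (restrict z {..<j}) :: ennreal)" for z
  let ?V = "\<Pi>\<^sub>M l\<in>{..<n}. \<nu>"
  have sub: "{..<j} \<subseteq> {..<n}" using \<open>j \<le> n\<close> by auto
  have Q': "prob_space (Q' l)" "sets (Q' l) = sets \<nu>" for l
    using Q B by (auto simp: Q'_def intro!: prob_space_uniform_measure)
  interpret Q': product_prob_space Q' using Q'(1) by (intro product_prob_spaceI)
  have [measurable]: "(\<lambda>z. restrict z {..<j}) \<in> measurable ?V (\<Pi>\<^sub>M l\<in>{..<j}. \<nu>)"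
    using sub by (rule measurable_restrict_subset)
  have h: "h \<in> borel_measurable ?V" unfolding h_def using A by measurable
  have sP: "sets (\<Pi>\<^sub>M l\<in>J. Q' l) = sets (\<Pi>\<^sub>M l\<in>J. \<nu>)" for J using Q'(2) by (intro sets_PiM_cong) auto
  have le: "indicator {\<omega>\<in>space M. point_count Z B \<omega> = of_nat n \<and>
      (\<exists>i\<in>distinct_tuples j. (\<forall>l<j. Z (i l) \<omega> \<in> D) \<and> (\<lambda>l\<in>{..<j}. Z (i l) \<omega>) \<in> A)} \<omega> \<le>
     indicator {\<omega>. point_count Z B \<omega> = of_nat n} \<omega> * tuple_sum n D' h \<omega>" (is "indicator ?E \<omega> \<le> _") for \<omega>
  proof (cases "\<omega> \<in> ?E")
    case True
    then obtain i where i: "i \<in> distinct_tuples j" "\<And>l. l < j \<Longrightarrow> Z (i l) \<omega> \<in> D"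
      "(\<lambda>l\<in>{..<j}. Z (i l) \<omega>) \<in> A" and c: "point_count Z B \<omega> = of_nat n" by auto
    have I: "finite {i. Z i \<omega> \<in> B}" "card {i. Z i \<omega> \<in> B} = n"
      using c by (auto simp: point_count_eq_of_nat_iff)
    obtain i' where i': "i' \<in> distinct_tuples n" "\<And>l. l < n \<Longrightarrow> i' l \<in> {i. Z i \<omega> \<in> B}"
       "\<And>l. l < j \<Longrightarrow> i' l = i l"
      using extend_distinct_tuple[OF I \<open>j \<le> n\<close> i(1)] i(2) D(2) by blast
    have "restrict (\<lambda>l\<in>{..<n}. Z (i' l) \<omega>) {..<j} = (\<lambda>l\<in>{..<j}. Z (i l) \<omega>)"
      using i'(3) \<open>j \<le> n\<close> by (auto simp: restrict_def fun_eq_iff)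
    then have "1 = h (\<lambda>l\<in>{..<n}. Z (i' l) \<omega>)" using i(3) unfolding h_def by simp
    also have "\<dots> \<le> tuple_sum n D' h \<omega>"
      using i' i(2) by (intro tuple_sum_ge) (auto simp: D'_def)
    finally show ?thesis using True c by simp
  qed simp
  have Emeas: "?E \<in> events"
  proof -
    have [measurable]: "Measurable.pred M (\<lambda>\<omega>. \<forall>l<j. Z (i l) \<omega> \<in> D)" for i :: "nat \<Rightarrow> nat"
      using D(1) by (intro pred_tuple_in)
    have [measurable]: "Measurable.pred M (\<lambda>\<omega>. (\<lambda>l\<in>{..<j}. Z (i l) \<omega>) \<in> A)" for i :: "nat \<Rightarrow> nat"
      by (rule pred_sets2[OF A measurable_tuple_at])
    have "Measurable.pred M (\<lambda>\<omega>. \<exists>i\<in>distinct_tuples j. (\<forall>l<j. Z (i l) \<omega> \<in> D) \<and> (\<lambda>l\<in>{..<j}. Z (i l) \<omega>) \<in> A)"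
      by (intro pred_ex_distinct_tuple pred_intros_logic pred_tuple_in D(1)
          pred_sets2[OF A measurable_tuple_at])
    then show ?thesis using pred_point_count_eq[OF B(1)] by measurable
  qed
  have "emeasure M ?E = (\<integral>\<^sup>+\<omega>. indicator ?E \<omega> \<partial>M)" using Emeas by simp
  also have "\<dots> \<le> (\<integral>\<^sup>+\<omega>. indicator {\<omega>. point_count Z B \<omega> = of_nat n} \<omega> * tuple_sum n D' h \<omega> \<partial>M)"
    by (intro nn_integral_mono le)
  also have "\<dots> = ennreal (exp (- measure \<nu> B) * (\<Prod>l<n. b' l)) * (\<integral>\<^sup>+z. h z \<partial>(\<Pi>\<^sub>M l\<in>{..<n}. Q' l))"
  proof (rule nn_integral_tuple_sum[OF B(1,2) _ _ Q' _ _ h])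
    fix l A assume A: "A \<in> sets \<nu>"
    show "emeasure \<nu> (A \<inter> D' l) = ennreal (b' l) * emeasure (Q' l) A"
    proof (cases "l < j")
      case False
      have "emeasure \<nu> B * (emeasure \<nu> (B \<inter> A) / emeasure \<nu> B) = emeasure \<nu> (B \<inter> A)"
        using B by (simp add: ennreal_mult_divide_eq ennreal_times_divide mult.commute[of "emeasure \<nu> B"])
      then show ?thesis using False A B
        by (simp add: D'_def b'_def Q'_def Int_commute emeasure_eq_ennreal_measure[symmetric])
    qed (use DQ A in \<open>simp add: D'_def b'_def Q'_def\<close>)
  qed (use D B b in \<open>auto simp: D'_def b'_def\<close>)
  also have "(\<integral>\<^sup>+z. h z \<partial>(\<Pi>\<^sub>M l\<in>{..<n}. Q' l)) = emeasure (distr (\<Pi>\<^sub>M l\<in>{..<n}. Q' l) (\<Pi>\<^sub>M l\<in>{..<j}. Q' l) (\<lambda>z. restrict z {..<j})) A"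
  proof -
    have R: "(\<lambda>z. restrict z {..<j}) \<in> measurable (\<Pi>\<^sub>M l\<in>{..<n}. Q' l) (\<Pi>\<^sub>M l\<in>{..<j}. Q' l)"
      using sub by (rule measurable_restrict_subset)
    have A': "A \<in> sets (\<Pi>\<^sub>M l\<in>{..<j}. Q' l)" using A by (simp only: sP)
    show ?thesis
      unfolding h_def
      by (subst nn_integral_distr[OF R, symmetric])
        (use A' in \<open>simp_all only: nn_integral_indicator sets_distr measurable_distr_eq1 borel_measurable_indicator\<close>)
  qed
  also have "\<dots> = emeasure (\<Pi>\<^sub>M l\<in>{..<j}. Q' l) A"
    using Q'.distr_restrict[OF sub] by simp
  also have "(\<Pi>\<^sub>M l\<in>{..<j}. Q' l) = (\<Pi>\<^sub>M l\<in>{..<j}. Q)" by (intro PiM_cong) (auto simp: Q'_def)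
  also have "emeasure (\<Pi>\<^sub>M l\<in>{..<j}. Q) A = ennreal (measure (\<Pi>\<^sub>M l\<in>{..<j}. Q) A)"
    using Q(1) by (intro finite_measure.emeasure_eq_measure prob_space.finite_measure prob_space_PiM)
  also have "(\<Prod>l<n. b' l) = b ^ j * measure \<nu> B ^ (n - j)"
  proof -
    have "(\<Prod>l<n. b' l) = (\<Prod>l\<in>{0..<j}. b' l) * (\<Prod>l\<in>{j..<n}. b' l)"
      unfolding lessThan_atLeast0 using \<open>j \<le> n\<close> by (intro prod.atLeastLessThan_concat[symmetric]) auto
    then show ?thesis by (simp add: b'_def)
  qed
  also have "ennreal (exp (- measure \<nu> B) * (b ^ j * measure \<nu> B ^ (n - j))) * ennreal (measure (\<Pi>\<^sub>M l\<in>{..<j}. Q) A)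
     \<le> ennreal (1 * (b ^ j * measure \<nu> B ^ (n - j))) * ennreal (measure (\<Pi>\<^sub>M l\<in>{..<j}. Q) A)"
    using b by (intro mult_right_mono ennreal_leI) auto
  also have "\<dots> = ennreal (measure \<nu> B ^ (n - j) * b ^ j * measure (\<Pi>\<^sub>M l\<in>{..<j}. Q) A)"
    using b by (subst ennreal_mult''[symmetric]) (simp_all only: mult_1 mult.commute measure_nonneg)
  finally show ?thesis .
qed

end

section \<open>The Pareto law as a transformed exponential law\<close>

definition exp_law :: "real \<Rightarrow> real measure" where
  "exp_law \<alpha> = density lborel (exponential_density \<alpha>)"

lemma sets_exp_law [simp, measurable_cong]: "sets (exp_law \<alpha>) = sets borel"
  and space_exp_law [simp]: "space (exp_law \<alpha>) = UNIV"
  by (simp_all add: exp_law_def)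

lemma prob_space_exp_law: "0 < \<alpha> \<Longrightarrow> prob_space (exp_law \<alpha>)"
  unfolding exp_law_def by (rule prob_space_exponential_density)

lemma distributed_exp_law: "distributed (exp_law \<alpha>) lborel (\<lambda>v. v) (exponential_density \<alpha>)"
  by (auto simp: distributed_def exp_law_def distr_id2)

text \<open>
  The tails above \<open>L\<close> determine the law, since the tail at \<open>L\<close> itself equals one.
\<close>

lemma pareto_tail_unique:
  fixes P P' :: "real measure"
  assumes "prob_space P" "prob_space P'" and sets: "sets P = sets borel" "sets P' = sets borel"
    and "0 < L"
    and tail: "\<And>x. L \<le> x \<Longrightarrow> measure P {x<..} = (x / L) powr - \<alpha>"
      "\<And>x. L \<le> x \<Longrightarrow> measure P' {x<..} = (x / L) powr - \<alpha>"
  shows "P = P'"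
proof -
  interpret P: prob_space P by fact
  interpret P': prob_space P' by fact
  have sp: "space P = UNIV" "space P' = UNIV" using sets[THEN sets_eq_imp_space_eq] by simp_all
  have R: "real_distribution P" "real_distribution P'"
    using sets sp by (auto intro!: real_distribution.intro real_distribution_axioms.intro assms)
  have c: "cdf P x = 1 - measure P {x<..}" "cdf P' x = 1 - measure P' {x<..}" for x
  proof -
    have "space P - {x<..} = {..x}" "space P' - {x<..} = {..x}" by (auto simp: sp)
    then show "cdf P x = 1 - measure P {x<..}" "cdf P' x = 1 - measure P' {x<..}"
      using P.prob_compl[of "{x<..}"] P'.prob_compl[of "{x<..}"] sets by (auto simp: cdf_def)
  qed
  have low: "measure P {x<..} = 1" "measure P' {x<..} = 1" if "x < L" for x
  proof -
    have "{L<..} \<subseteq> {x<..}" using that by auto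
    then have "measure P {L<..} \<le> measure P {x<..}" "measure P' {L<..} \<le> measure P' {x<..}"
      by (rule P.finite_measure_mono, simp add: sets, rule P'.finite_measure_mono, simp_all add: sets)
    then show "measure P {x<..} = 1" "measure P' {x<..} = 1"
      using tail[of L] \<open>0 < L\<close> P.prob_le_1[of "{x<..}"] P'.prob_le_1[of "{x<..}"] by auto
  qed
  have "cdf P = cdf P'"
  proof
    fix x show "cdf P x = cdf P' x" using tail[of x] low[of x] c[of x] by (cases "L \<le> x") auto
  qed
  with R show ?thesis by (rule cdf_unique)
qed

lemma AE_exp_law_pos:
  assumes "0 < \<alpha>" shows "AE v in exp_law \<alpha>. 0 < v"
proof -
  interpret prob_space "exp_law \<alpha>" using assms by (rule prob_space_exp_law)
  have "\<P>(v in exp_law \<alpha>. 0 < v) = 1"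
    using exponential_distributedD_gt[OF distributed_exp_law order_refl assms] by simp
  then show ?thesis by (subst (asm) prob_Collect_eq_1) auto
qed

lemma measure_exp_law_scaled_exp:
  assumes "0 < \<alpha>" "0 < L" "L \<le> x"
  shows "measure (distr (exp_law \<alpha>) borel (\<lambda>v. L * exp v)) {x<..} = (x / L) powr - \<alpha>"
proof -
  interpret prob_space "exp_law \<alpha>" using assms(1) by (rule prob_space_exp_law)
  have "measure (distr (exp_law \<alpha>) borel (\<lambda>v. L * exp v)) {x<..} =
      \<P>(v in exp_law \<alpha>. ln (x / L) < v)"
  proof -
    have "x < L * exp v \<longleftrightarrow> ln (x / L) < v" for v
    proof -
      have "x < L * exp v \<longleftrightarrow> x / L < exp v" using assms by (simp add: divide_less_eq mult.commute)
      also have "\<dots> \<longleftrightarrow> ln (x / L) < v"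
        using exp_less_cancel_iff[of "ln (x / L)" v] assms by simp
      finally show ?thesis .
    qed
    then show ?thesis by (subst measure_distr) (auto intro!: arg_cong[where f="measure (exp_law \<alpha>)"])
  qed
  also have "\<dots> = exp (- ln (x / L) * \<alpha>)"
    using assms by (intro exponential_distributedD_gt[OF distributed_exp_law]) auto
  also have "\<dots> = (x / L) powr - \<alpha>" using assms by (simp add: powr_def mult.commute)
  finally show ?thesis .
qed

lemma nn_integral_power_tail:
  assumes "0 < \<alpha>" "0 < a"
  shows "(\<integral>\<^sup>+x. ennreal (\<alpha> * x powr (- \<alpha> - 1)) * indicator {a<..} x \<partial>lborel) = ennreal (a powr - \<alpha>)"
proof -
  have "(\<integral>\<^sup>+x. ennreal (\<alpha> * x powr (- \<alpha> - 1)) * indicator {a<..} x \<partial>lborel) =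
      (\<integral>\<^sup>+x. ennreal (\<alpha> * x powr (- \<alpha> - 1)) * indicator {a..} x \<partial>lborel)"
  proof (rule nn_integral_cong_AE)
    have "AE x in lborel. x \<noteq> a" by (rule AE_lborel_singleton)
    then show "AE x in lborel. ennreal (\<alpha> * x powr (- \<alpha> - 1)) * indicator {a<..} x =
        ennreal (\<alpha> * x powr (- \<alpha> - 1)) * indicator {a..} x"
      by eventually_elim (auto simp: indicator_def)
  qed
  also have "\<dots> = ennreal (0 - - (a powr - \<alpha>))"
  proof (rule nn_integral_FTC_atLeast[where F = "\<lambda>x. - (x powr - \<alpha>)"])
    show "((\<lambda>x. - (x powr - \<alpha>)) has_real_derivative \<alpha> * x powr (- \<alpha> - 1)) (at x)" if "a \<le> x" for x
      using that assms by (auto intro!: derivative_eq_intros)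
    have "((\<lambda>x::real. x powr - \<alpha>) \<longlongrightarrow> 0) at_top"
      using assms by (intro tendsto_neg_powr filterlim_ident) auto
    then show "((\<lambda>x. - (x powr - \<alpha>)) \<longlongrightarrow> 0) at_top" using tendsto_minus by fastforce
  qed (use assms in auto)
  finally show ?thesis by simp
qed

text \<open>
  Above level \<open>L\<close> the intensity of the magnitudes is a multiple of a Pareto law, written in logarithmic
  coordinates. In these coordinates a product of magnitudes is a sum of exponential variables.
\<close>

lemma power_density_eq_scaled_exp:
  assumes "0 < \<alpha>" "0 < L"
  shows "density lborel (\<lambda>x. ennreal (\<alpha> * x powr (- \<alpha> - 1)) * indicator {L<..} x) =
    scale_measure (ennreal (L powr - \<alpha>)) (distr (exp_law \<alpha>) borel (\<lambda>v. L * exp v))"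
proof -
  let ?\<rho> = "density lborel (\<lambda>x. ennreal (\<alpha> * x powr (- \<alpha> - 1)) * indicator {L<..} x)"
  let ?D = "distr (exp_law \<alpha>) borel (\<lambda>v. L * exp v)"
  let ?P = "scale_measure (ennreal (L powr \<alpha>)) ?\<rho>"
  interpret E: prob_space "exp_law \<alpha>" using assms(1) by (rule prob_space_exp_law)
  have em: "emeasure ?\<rho> A = (\<integral>\<^sup>+x. ennreal (\<alpha> * x powr (- \<alpha> - 1)) * indicator {max L a<..} x \<partial>lborel)"
    if "A \<in> sets borel" "A \<inter> {L<..} = {max L a<..}" for A a
  proof -
    have "indicator {L<..} x * indicator A x = (indicator {max L a<..} x :: ennreal)" for x
      unfolding that(2)[symmetric] indicator_inter_arith by (rule mult.commute)
    then show ?thesis using that(1) by (subst emeasure_density) (auto simp: mult.assoc intro!: nn_integral_cong)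
  qed
  have "emeasure ?\<rho> UNIV = ennreal (L powr - \<alpha>)"
    using em[of UNIV L] nn_integral_power_tail[of \<alpha> L] assms by simp
  then have "prob_space ?P"
    using assms by (intro prob_spaceI)
      (simp add: space_scale_measure powr_add[symmetric] flip: ennreal_mult'')
  moreover have "measure ?P {x<..} = (x / L) powr - \<alpha>" if "L \<le> x" for x
  proof -
    have "emeasure ?\<rho> {x<..} = ennreal (x powr - \<alpha>)"
    proof -
      have "{x<..} \<inter> {L<..} = {max L x<..}" "max L x = x" using that by auto
      then show ?thesis using em[of "{x<..}" x] nn_integral_power_tail[of \<alpha> x] assms that by simp
    qed
    then show ?thesis
      using assms that by (simp add: measure_def enn2real_mult powr_divide powr_minus field_simps)
  qed
  moreover have "prob_space ?D" by (rule E.prob_space_distr) simp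
  ultimately have eq: "?P = ?D"
    using assms measure_exp_law_scaled_exp[OF assms] by (intro pareto_tail_unique[of _ _ L \<alpha>]) auto
  show ?thesis
  proof (rule measure_eqI)
    fix A assume "A \<in> sets ?\<rho>"
    have "emeasure (scale_measure (ennreal (L powr - \<alpha>)) ?P) A = ennreal (L powr - \<alpha> * L powr \<alpha>) * emeasure ?\<rho> A"
      by (simp add: ennreal_mult' mult.assoc)
    then show "emeasure ?\<rho> A = emeasure (scale_measure (ennreal (L powr - \<alpha>)) ?D) A"
      unfolding eq using assms by (simp add: powr_add[symmetric])
  qed simp
qed

section \<open>The intensity measure of the regenerative model\<close>

locale regenerative_setup =
  fixes \<alpha> :: real and p :: "nat pmf"
  assumes \<alpha>: "0 < \<alpha>" and step_positive: "0 \<notin> set_pmf p"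
begin

abbreviation "R \<equiv> renewal_law p"
abbreviation "\<mu> \<equiv> stationary_renewal_measure p"
abbreviation "\<nu> \<equiv> regenerative_intensity \<alpha> p"

lemma sets_R [simp, measurable_cong]: "sets R = sets E_space"
  and sets_\<mu> [simp, measurable_cong]: "sets \<mu> = sets E_space"
  by (simp_all add: renewal_law_def stationary_renewal_measure_def)

lemma space_R [simp]: "space R = space E_space" and space_\<mu> [simp]: "space \<mu> = space E_space"
  by (rule sets_eq_imp_space_eq, simp)+

lemma prob_space_R: "prob_space R"
  unfolding renewal_law_def
  by (intro prob_space.prob_space_distr measurable_renewal_set prob_space_PiM) (rule prob_space_measure_pmf)

lemma AE_zero_in_R: "AE u in R. 0 \<in> u"
proof -
  have "{u \<in> space E_space. 0 \<in> u} \<in> sets E_space"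
    using pred_mem_E_space[of 0] by (simp add: pred_def)
  then show ?thesis
    unfolding renewal_law_def
    by (subst AE_distr_iff[OF measurable_renewal_set])
       (auto simp: renewal_set_def image_iff intro!: AE_I2 exI[of _ 0])
qed

lemma step_tail_0: "step_tail p 0 = 1"
proof -
  have "measure (measure_pmf p) {x. real x \<le> 0} = 0"
    using step_positive by (auto simp: measure_pmf_zero_iff)
  then show ?thesis
    by (simp add: step_tail_def step_df_def cdf_def measure_distr vimage_def)
qed

lemma step_tail_le_1: "step_tail p x \<le> 1"
  by (simp add: step_tail_def step_df_def cdf_def)

lemma emeasure_\<mu>:
  assumes A: "A \<in> sets E_space"
  shows "emeasure \<mu> A = (\<integral>\<^sup>+d. ennreal (step_tail p (real d)) *
      emeasure R {u\<in>space E_space. (\<lambda>s. d + s) ` u \<in> A} \<partial>count_space UNIV)"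
proof -
  interpret R: prob_space R by (rule prob_space_R)
  have "emeasure \<mu> A = emeasure (delay_measure p \<Otimes>\<^sub>M R)
      ((\<lambda>(d, u). (\<lambda>s. d + s) ` u) -` A \<inter> space (delay_measure p \<Otimes>\<^sub>M R))"
    unfolding stationary_renewal_measure_def using A by (intro emeasure_distr measurable_delayed_set)
  also have "\<dots> = (\<integral>\<^sup>+d. emeasure R (Pair d -` ((\<lambda>(d, u). (\<lambda>s. d + s) ` u) -` A \<inter>
      space (delay_measure p \<Otimes>\<^sub>M R))) \<partial>delay_measure p)"
    using A by (intro R.emeasure_pair_measure_alt measurable_sets[OF measurable_delayed_set])
  also have "\<dots> = (\<integral>\<^sup>+d. emeasure R {u\<in>space E_space. (\<lambda>s. d + s) ` u \<in> A} \<partial>delay_measure p)"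
    by (intro nn_integral_cong arg_cong[where f = "emeasure R"])
       (auto simp: space_pair_measure)
  also have "\<dots> = (\<integral>\<^sup>+d. ennreal (step_tail p (real d)) *
      emeasure R {u\<in>space E_space. (\<lambda>s. d + s) ` u \<in> A} \<partial>count_space UNIV)"
    unfolding delay_measure_def by (subst nn_integral_density) auto
  finally show ?thesis .
qed

text \<open>
  A delayed renewal set can contain \<open>0\<close> only with delay \<open>0\<close>, which has mass \<open>step_tail p 0 = 1\<close>. The
  sets that contain \<open>0\<close> therefore follow the law of the renewal process without delay.
\<close>

lemma emeasure_\<mu>_zero:
  assumes A: "A \<in> sets E_space"
  shows "emeasure \<mu> {u\<in>A. 0 \<in> u} = emeasure R A"
proof -
  interpret R: prob_space R by (rule prob_space_R)
  have A0: "{u\<in>A. 0 \<in> u} \<in> sets E_space"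
  proof -
    have "{u\<in>A. 0 \<in> u} = A \<inter> {u\<in>space E_space. 0 \<in> u}" using sets.sets_into_space[OF A] by auto
    then show ?thesis using A pred_mem_E_space[of 0] by (simp add: pred_def)
  qed
  have "emeasure \<mu> {u\<in>A. 0 \<in> u} = (\<integral>\<^sup>+d. emeasure R {u\<in>A. 0 \<in> u} * indicator {0::nat} d \<partial>count_space UNIV)"
    unfolding emeasure_\<mu>[OF A0]
  proof (intro nn_integral_cong)
    fix d :: nat
    show "ennreal (step_tail p (real d)) *
        emeasure R {u\<in>space E_space. (\<lambda>s. d + s) ` u \<in> {u\<in>A. 0 \<in> u}} =
      emeasure R {u\<in>A. 0 \<in> u} * indicator {0} d"
    proof (cases "d = 0")
      case True
      have "{u\<in>space E_space. (\<lambda>s. d + s) ` u \<in> {u\<in>A. 0 \<in> u}} = {u\<in>A. 0 \<in> u}"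
        using True sets.sets_into_space[OF A] by auto
      then show ?thesis using True step_tail_0 by simp
    next
      case False
      then have empty: "{u\<in>space E_space. (\<lambda>s. d + s) ` u \<in> {u\<in>A. 0 \<in> u}} = {}" by auto
      show ?thesis unfolding empty using False by simp
    qed
  qed
  also have "\<dots> = emeasure R {u\<in>A. 0 \<in> u}" by (subst nn_integral_cmult_indicator) auto
  also have "\<dots> = emeasure R A"
    using A A0 AE_zero_in_R by (intro emeasure_eq_AE) auto
  finally show ?thesis .
qed

definition hitting :: "nat \<Rightarrow> nat set set" where
  "hitting t = {u\<in>space E_space. \<exists>s\<le>t. s \<in> u}"

lemma sets_hitting [measurable]: "hitting t \<in> sets E_space"
proof -
  have "hitting t = (\<Union>s\<in>{..t}. {u\<in>space E_space. s \<in> u})" by (auto simp: hitting_def)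
  also have "\<dots> \<in> sets E_space"
    using pred_mem_E_space by (intro sets.finite_UN) (auto simp: pred_def)
  finally show ?thesis .
qed

text \<open>
  Only delays up to \<open>t\<close> matter, and each of them has mass at most one.
\<close>

lemma emeasure_\<mu>_hitting: "emeasure \<mu> (hitting t) \<le> of_nat (t + 1)"
proof -
  interpret R: prob_space R by (rule prob_space_R)
  have "emeasure \<mu> (hitting t) \<le> (\<integral>\<^sup>+d. indicator {..t} d \<partial>count_space UNIV)"
    unfolding emeasure_\<mu>[OF sets_hitting]
  proof (intro nn_integral_mono)
    fix d :: nat
    show "ennreal (step_tail p (real d)) * emeasure R {u\<in>space E_space. (\<lambda>s. d + s) ` u \<in> hitting t}
      \<le> indicator {..t} d"
    proof (cases "d \<le> t")
      case True
      have "ennreal (step_tail p (real d)) * emeasure R {u\<in>space E_space. (\<lambda>s. d + s) ` u \<in> hitting t} \<le> 1 * 1"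
        using step_tail_le_1[of "real d"] by (intro mult_mono R.measure_le_1) (auto simp: ennreal_le_1 R.emeasure_le_1)
      then show ?thesis using True by simp
    next
      case False
      then have empty: "{u\<in>space E_space. (\<lambda>s. d + s) ` u \<in> hitting t} = {}" by (auto simp: hitting_def)
      show ?thesis unfolding empty by simp
    qed
  qed
  also have "\<dots> = of_nat (t + 1)" by (subst nn_integral_indicator) (auto simp: emeasure_count_space_finite)
  finally show ?thesis .
qed

lemma sigma_finite_\<mu>: "sigma_finite_measure \<mu>"
proof
  show "\<exists>A. countable A \<and> A \<subseteq> sets \<mu> \<and> \<Union> A = space \<mu> \<and> (\<forall>a\<in>A. emeasure \<mu> a \<noteq> \<infinity>)"
  proof (intro exI[of _ "range hitting"] conjI ballI)
    show "\<Union> (range hitting) = space \<mu>" by (auto simp: hitting_def space_E_space)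
    fix a assume "a \<in> range hitting"
    then obtain t where a: "a = hitting t" by auto
    show "emeasure \<mu> a \<noteq> \<infinity>"
      unfolding a using emeasure_\<mu>_hitting[of t]
      by (metis ennreal_of_nat_neq_top infinity_ennreal_def neq_top_trans)
  qed auto
qed

lemma sets_\<nu>: "sets \<nu> = sets (restrict_space borel {0<..} \<Otimes>\<^sub>M E_space)"
  unfolding regenerative_intensity_def
  by (intro sets_pair_measure_cong) (simp_all add: sets_restrict_space)

lemma space_\<nu>: "space \<nu> = {0<..} \<times> space E_space"
  by (simp add: regenerative_intensity_def space_pair_measure space_restrict_space)

text \<open>
  Integration over the magnitudes in logarithmic coordinates.
\<close>

lemma emeasure_\<nu>:
  assumes A: "A \<in> sets \<nu>" and AL: "A \<subseteq> {L<..} \<times> UNIV" and L: "0 < L"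
  shows "emeasure \<nu> A = ennreal (L powr - \<alpha>) * (\<integral>\<^sup>+v. emeasure \<mu> (Pair (L * exp v) -` A) \<partial>exp_law \<alpha>)"
proof -
  interpret sigma_finite_measure \<mu> by (rule sigma_finite_\<mu>)
  let ?f = "\<lambda>x. ennreal (\<alpha> * x powr (- \<alpha> - 1))"
  let ?\<rho> = "density (restrict_space lborel {0<..}) ?f"
  define g where "g x = emeasure \<mu> (Pair x -` A)" for x
  have g0: "g x = 0" if "x \<le> L" for x
  proof -
    have "Pair x -` A = {}" using AL that by auto
    then show ?thesis by (simp add: g_def)
  qed
  have "g \<in> borel_measurable ?\<rho>"
    unfolding g_def using A unfolding regenerative_intensity_def by (rule measurable_emeasure_Pair)
  then have gr: "g \<in> borel_measurable (restrict_space borel {0<..})"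
    by (subst measurable_cong_sets[OF _ refl, of _ ?\<rho>]) (simp_all add: sets_restrict_space)
  then have "(\<lambda>x. g x * indicator {0<..} x) \<in> borel_measurable borel"
    by (subst (asm) borel_measurable_restrict_space_iff_ennreal) auto
  also have "(\<lambda>x. g x * indicator {0<..} x) = g"
    using g0 L by (auto simp: fun_eq_iff indicator_def)
  finally have g[measurable]: "g \<in> borel_measurable borel" .
  have "emeasure \<nu> A = (\<integral>\<^sup>+x. g x \<partial>?\<rho>)"
    unfolding g_def regenerative_intensity_def
    by (rule emeasure_pair_measure_alt[OF A[unfolded regenerative_intensity_def]])
  also have "\<dots> = (\<integral>\<^sup>+x. ?f x * g x \<partial>restrict_space lborel {0<..})"
    by (intro nn_integral_density measurable_restrict_space1) auto
  also have "\<dots> = (\<integral>\<^sup>+x. ?f x * g x * indicator {0<..} x \<partial>lborel)"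
    by (intro nn_integral_restrict_space) simp
  also have "\<dots> = (\<integral>\<^sup>+x. ?f x * indicator {L<..} x * g x \<partial>lborel)"
    using g0 L by (intro nn_integral_cong) (auto simp: indicator_def not_less)
  also have "\<dots> = (\<integral>\<^sup>+x. g x \<partial>density lborel (\<lambda>x. ?f x * indicator {L<..} x))"
    by (intro nn_integral_density[symmetric]) auto
  also have "\<dots> = ennreal (L powr - \<alpha>) * (\<integral>\<^sup>+x. g x \<partial>distr (exp_law \<alpha>) borel (\<lambda>v. L * exp v))"
    unfolding power_density_eq_scaled_exp[OF \<alpha> L] by (intro nn_integral_scale_measure) simp
  also have "(\<integral>\<^sup>+x. g x \<partial>distr (exp_law \<alpha>) borel (\<lambda>v. L * exp v)) = (\<integral>\<^sup>+v. g (L * exp v) \<partial>exp_law \<alpha>)"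
    by (intro nn_integral_distr) auto
  finally show ?thesis by (simp add: g_def)
qed

definition big_hitting :: "nat \<Rightarrow> real \<Rightarrow> (real \<times> nat set) set" where
  "big_hitting t L = {L<..} \<times> hitting t"

definition big_zero :: "real \<Rightarrow> (real \<times> nat set) set" where
  "big_zero L = {L<..} \<times> hitting 0"

definition zero_law :: "real \<Rightarrow> (real \<times> nat set) measure" where
  "zero_law L = distr (exp_law \<alpha> \<Otimes>\<^sub>M R) \<nu> (\<lambda>(v, u). (L * exp v, u))"

lemma sets_big_hitting: "0 < L \<Longrightarrow> big_hitting t L \<in> sets \<nu>"
  unfolding big_hitting_def sets_\<nu> by (intro pair_measureI) (auto simp: sets_restrict_space_iff)

lemma sets_big_zero: "0 < L \<Longrightarrow> big_zero L \<in> sets \<nu>"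
  unfolding big_zero_def sets_\<nu> by (intro pair_measureI) (auto simp: sets_restrict_space_iff)

lemma hitting_mono: "s \<le> t \<Longrightarrow> hitting s \<subseteq> hitting t"
  unfolding hitting_def using le_trans by blast

lemma emeasure_\<mu>_hitting_0: "emeasure \<mu> (hitting 0) = 1"
proof -
  have "hitting 0 = {u\<in>space E_space. 0 \<in> u}" by (auto simp: hitting_def)
  then show ?thesis
    using emeasure_\<mu>_zero[of "space E_space"] prob_space.emeasure_space_1[OF prob_space_R] by simp
qed

lemma emeasure_\<nu>_big_hitting:
  assumes "0 < L"
  shows "emeasure \<nu> (big_hitting t L) = ennreal (L powr - \<alpha>) * emeasure \<mu> (hitting t)"
proof -
  interpret prob_space "exp_law \<alpha>" using \<alpha> by (rule prob_space_exp_law)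
  have "emeasure \<nu> (big_hitting t L) =
      ennreal (L powr - \<alpha>) * (\<integral>\<^sup>+v. emeasure \<mu> (Pair (L * exp v) -` big_hitting t L) \<partial>exp_law \<alpha>)"
    using assms by (intro emeasure_\<nu> sets_big_hitting) (auto simp: big_hitting_def)
  also have "(\<integral>\<^sup>+v. emeasure \<mu> (Pair (L * exp v) -` big_hitting t L) \<partial>exp_law \<alpha>) =
      (\<integral>\<^sup>+v. emeasure \<mu> (hitting t) \<partial>exp_law \<alpha>)"
  proof (rule nn_integral_cong_AE)
    show "AE v in exp_law \<alpha>. emeasure \<mu> (Pair (L * exp v) -` big_hitting t L) = emeasure \<mu> (hitting t)"
      using AE_exp_law_pos[OF \<alpha>]
    proof eventually_elim
      case (elim v)
      then have "Pair (L * exp v) -` big_hitting t L = hitting t"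
        using assms by (auto simp: big_hitting_def)
      then show ?case by simp
    qed
  qed
  finally show ?thesis using emeasure_space_1 by simp
qed

lemma measurable_zero_law:
  assumes "0 < L"
  shows "(\<lambda>(v, u). (L * exp v, u)) \<in> measurable (exp_law \<alpha> \<Otimes>\<^sub>M R) \<nu>"
proof -
  have "(\<lambda>x. L * exp (fst x)) \<in> measurable (exp_law \<alpha> \<Otimes>\<^sub>M R) (restrict_space borel {0<..})"
    using assms by (intro measurable_restrict_space2) auto
  moreover have "snd \<in> measurable (exp_law \<alpha> \<Otimes>\<^sub>M R) E_space" by measurable
  ultimately have "(\<lambda>x. (L * exp (fst x), snd x)) \<in> measurable (exp_law \<alpha> \<Otimes>\<^sub>M R) (restrict_space borel {0<..} \<Otimes>\<^sub>M E_space)"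
    by (rule measurable_Pair)
  then show ?thesis by (simp add: case_prod_beta' measurable_cong_sets[OF refl sets_\<nu>])
qed

lemma prob_space_zero_law: "0 < L \<Longrightarrow> prob_space (zero_law L)"
  unfolding zero_law_def
  by (intro prob_space.prob_space_distr measurable_zero_law prob_space_pair prob_space_R prob_space_exp_law \<alpha>)

lemma sets_zero_law [simp]: "sets (zero_law L) = sets \<nu>" by (simp add: zero_law_def)

text \<open>
  The points above \<open>L\<close> whose set contains \<open>0\<close> have a finite intensity, and normalising it gives \<open>zero_law L\<close>: a
  Pareto magnitude and an independent renewal set.
\<close>

lemma emeasure_\<nu>_big_zero:
  assumes A: "A \<in> sets \<nu>" and L: "0 < L"
  shows "emeasure \<nu> (A \<inter> big_zero L) = ennreal (L powr - \<alpha>) * emeasure (zero_law L) A"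
proof -
  interpret E: prob_space "exp_law \<alpha>" using \<alpha> by (rule prob_space_exp_law)
  interpret R: prob_space R by (rule prob_space_R)
  have "emeasure \<nu> (A \<inter> big_zero L) =
      ennreal (L powr - \<alpha>) * (\<integral>\<^sup>+v. emeasure \<mu> (Pair (L * exp v) -` (A \<inter> big_zero L)) \<partial>exp_law \<alpha>)"
    using A L by (intro emeasure_\<nu> sets.Int sets_big_zero) (auto simp: big_zero_def)
  also have "(\<integral>\<^sup>+v. emeasure \<mu> (Pair (L * exp v) -` (A \<inter> big_zero L)) \<partial>exp_law \<alpha>) =
      (\<integral>\<^sup>+v. emeasure R (Pair (L * exp v) -` A) \<partial>exp_law \<alpha>)"
  proof (rule nn_integral_cong_AE)
    show "AE v in exp_law \<alpha>. emeasure \<mu> (Pair (L * exp v) -` (A \<inter> big_zero L)) =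
        emeasure R (Pair (L * exp v) -` A)"
      using AE_exp_law_pos[OF \<alpha>]
    proof eventually_elim
      case (elim v)
      have S: "Pair (L * exp v) -` A \<in> sets E_space"
        using A unfolding sets_\<nu> by (rule sets_Pair1)
      have "Pair (L * exp v) -` (A \<inter> big_zero L) = {u\<in>Pair (L * exp v) -` A. 0 \<in> u}"
        using L elim sets.sets_into_space[OF S] by (auto simp: big_zero_def hitting_def)
      then show ?case using emeasure_\<mu>_zero[OF S] by simp
    qed
  qed
  also have "\<dots> = emeasure (zero_law L) A"
  proof -
    let ?m = "\<lambda>(v, u). (L * exp v, u)"
    have m: "?m -` A \<inter> space (exp_law \<alpha> \<Otimes>\<^sub>M R) \<in> sets (exp_law \<alpha> \<Otimes>\<^sub>M R)"
      by (rule measurable_sets[OF measurable_zero_law[OF L] A])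
    have "emeasure (zero_law L) A = emeasure (exp_law \<alpha> \<Otimes>\<^sub>M R) (?m -` A \<inter> space (exp_law \<alpha> \<Otimes>\<^sub>M R))"
      unfolding zero_law_def using A L by (intro emeasure_distr measurable_zero_law)
    also have "\<dots> = (\<integral>\<^sup>+v. emeasure R (Pair v -` (?m -` A \<inter> space (exp_law \<alpha> \<Otimes>\<^sub>M R))) \<partial>exp_law \<alpha>)"
      by (rule R.emeasure_pair_measure_alt[OF m])
    also have "\<dots> = (\<integral>\<^sup>+v. emeasure R (Pair (L * exp v) -` A) \<partial>exp_law \<alpha>)"
      using sets.sets_into_space[OF A]
      by (intro nn_integral_cong arg_cong[where f = "emeasure R"]) (auto simp: space_pair_measure space_\<nu>)
    finally show ?thesis by simp
  qed
  finally show ?thesis .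
qed

end

section \<open>Products of Pareto variables\<close>

text \<open>
  The leading term of the probability that a product of \<open>k\<close> independent Pareto variables exceeds \<open>c\<close>.
\<close>

definition tail_rate :: "real \<Rightarrow> nat \<Rightarrow> real \<Rightarrow> real" where
  "tail_rate \<alpha> k c = c powr - \<alpha> * (\<alpha> * ln c) ^ (k - 1) / fact (k - 1)"

lemma tail_rate_pos: "0 < \<alpha> \<Longrightarrow> 1 < c \<Longrightarrow> 0 < tail_rate \<alpha> k c"
  by (simp add: tail_rate_def)

lemma ln_scale_ratio:
  assumes "0 < b" shows "((\<lambda>c::real. ln (b * c) / ln c) \<longlongrightarrow> 1) at_top"
proof -
  have "((\<lambda>c::real. ln b / ln c + 1) \<longlongrightarrow> 0 + 1) at_top"
    by (intro tendsto_add tendsto_const tendsto_divide_0[OF tendsto_const] filterlim_at_top_imp_at_infinity ln_at_top)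
  moreover have "\<forall>\<^sub>F c in at_top. ln b / ln c + 1 = ln (b * c) / ln c"
    using eventually_gt_at_top[of 1]
    by eventually_elim (use assms in \<open>simp add: ln_mult field_simps\<close>)
  ultimately show ?thesis by (auto intro: Lim_transform_eventually)
qed

lemma tail_rate_scale:
  assumes "0 < \<alpha>" "0 < b"
  shows "((\<lambda>c. tail_rate \<alpha> k (b * c) / tail_rate \<alpha> k c) \<longlongrightarrow> b powr - \<alpha>) at_top"
proof -
  have "((\<lambda>c. b powr - \<alpha> * (ln (b * c) / ln c) ^ (k - 1)) \<longlongrightarrow> b powr - \<alpha> * 1 ^ (k - 1)) at_top"
    by (intro tendsto_intros ln_scale_ratio assms)
  moreover have "\<forall>\<^sub>F c in at_top. b powr - \<alpha> * (ln (b * c) / ln c) ^ (k - 1) =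
      tail_rate \<alpha> k (b * c) / tail_rate \<alpha> k c"
    using eventually_gt_at_top[of 1]
  proof eventually_elim
    case (elim c)
    then show ?case using assms
      by (simp add: tail_rate_def powr_mult power_mult_distrib power_divide field_simps)
  qed
  ultimately show ?thesis by (auto intro: Lim_transform_eventually)
qed

text \<open>
  Each factor of the product contributes one logarithm, so tuples with fewer than \<open>k\<close> large points are negligible.
\<close>

lemma tail_rate_less_factors:
  assumes "0 < \<alpha>" "1 \<le> j" "j < k"
  shows "((\<lambda>c. tail_rate \<alpha> j c / tail_rate \<alpha> k c) \<longlongrightarrow> 0) at_top"
proof -
  have lim: "filterlim (\<lambda>c::real. (\<alpha> * ln c) ^ (k - j)) at_top at_top"
    using assms by (intro filterlim_pow_at_top filterlim_tendsto_pos_mult_at_top[OF tendsto_const] ln_at_top) auto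
  have "((\<lambda>c. fact (k - 1) / fact (j - 1) * inverse ((\<alpha> * ln c) ^ (k - j))) \<longlongrightarrow> fact (k - 1) / fact (j - 1) * 0) at_top"
    by (intro tendsto_mult tendsto_const tendsto_inverse_0_at_top lim)
  moreover have "\<forall>\<^sub>F c in at_top. fact (k - 1) / fact (j - 1) * inverse ((\<alpha> * ln c) ^ (k - j)) =
      tail_rate \<alpha> j c / tail_rate \<alpha> k c"
    using eventually_gt_at_top[of 1]
  proof eventually_elim
    case (elim c)
    have "k - 1 = (k - j) + (j - 1)" using assms by auto
    then have "(\<alpha> * ln c) ^ (k - 1) = (\<alpha> * ln c) ^ (k - j) * (\<alpha> * ln c) ^ (j - 1)"
      by (metis power_add)
    then show ?case using elim assms by (simp add: tail_rate_def field_simps)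
  qed
  ultimately show ?thesis by (auto intro: Lim_transform_eventually)
qed

lemma integrable_erlang_density: "0 < l \<Longrightarrow> integrable lborel (erlang_density n l)"
proof (rule integrableI_nonneg)
  assume l: "0 < l"
  interpret prob_space "density lborel (erlang_density n l)" using l by (rule prob_space_erlang_density)
  show "(\<integral>\<^sup>+x. ennreal (erlang_density n l x) \<partial>lborel) < \<infinity>"
    using emeasure_space_1 by (simp add: emeasure_density)
qed auto

text \<open>
  The substitution \<open>w = ln (c / L ^ k) + v\<close> extracts the factor \<open>c powr - \<alpha>\<close> and leaves the exponential density
  times the \<open>(k - 1)\<close>-st power of \<open>(v + ln (c / L ^ k)) / ln c\<close>, which tends to one. The prefactor
  \<open>L powr (- \<alpha> * real k)\<close> is the total intensity of \<open>k\<close>-tuples above \<open>L\<close>; it compensates the level, and the limit is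
  an expectation under the Pareto law \<open>exp V\<close> that does not involve \<open>L\<close>.
\<close>

lemma erlang_tail_asymptotics:
  fixes g :: "real \<Rightarrow> real"
  assumes \<alpha>: "0 < \<alpha>" and L: "1 \<le> L" and k: "1 \<le> k"
    and g[measurable]: "g \<in> borel_measurable borel" and gM: "\<And>y. \<bar>g y\<bar> \<le> Mg"
  shows "((\<lambda>c. L powr (- \<alpha> * real k) * (\<integral>w. erlang_density (k - 1) \<alpha> w *
      (indicator {w. c < L ^ k * exp w} w * g (L ^ k * exp w / c)) \<partial>lborel) / tail_rate \<alpha> k c)
    \<longlongrightarrow> (\<integral>v. g (exp v) \<partial>exp_law \<alpha>)) at_top"
proof -
  define m where "m = k - 1"
  define s where "s c v = indicator {0<..} v * (\<alpha> * exp (- \<alpha> * v)) * g (exp v) * ((v + ln (c / L ^ k)) / ln c) ^ m" for c v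
  define f where "f v = indicator {0<..} v * (\<alpha> * exp (- \<alpha> * v)) * g (exp v)" for v
  \<comment> \<open>An integrable majorant: the power of the ratio is at most \<open>(1 + v) ^ m \<le> 2 ^ m * (1 + v ^ m)\<close> once \<open>ln c \<ge> 1\<close>.\<close>
  define w where "w v = Mg * 2 ^ m * (erlang_density 0 \<alpha> v + fact m / \<alpha> ^ m * erlang_density m \<alpha> v)" for v
  have Lk: "0 < L ^ k" "1 \<le> L ^ k" using L by auto
  have Mg: "0 \<le> Mg" using gM[of 0] by linarith
  have lnratio: "((\<lambda>c. (v + ln (c / L ^ k)) / ln c) \<longlongrightarrow> 1) at_top" for v
  proof -
    have "((\<lambda>c. v / ln c + ln (1 / L ^ k * c) / ln c) \<longlongrightarrow> 0 + 1) at_top"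
      using Lk by (intro tendsto_add ln_scale_ratio tendsto_divide_0[OF tendsto_const] filterlim_at_top_imp_at_infinity ln_at_top) auto
    then show ?thesis by (simp add: add_divide_distrib)
  qed
  have "((\<lambda>c. integral\<^sup>L lborel (s c)) \<longlongrightarrow> integral\<^sup>L lborel f) at_top"
  proof (rule integral_dominated_convergence_at_top)
    show "f \<in> borel_measurable lborel" "\<And>c. s c \<in> borel_measurable lborel"
      unfolding f_def s_def by measurable
    show "integrable lborel w" unfolding w_def
      by (intro integrable_mult_right Bochner_Integration.integrable_add integrable_erlang_density \<alpha>)
    show "AE v in lborel. ((\<lambda>c. s c v) \<longlongrightarrow> f v) at_top"
    proof (rule AE_I2)
      fix v
      have "((\<lambda>c. s c v) \<longlongrightarrow> f v * 1 ^ m) at_top"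
        unfolding s_def f_def by (intro tendsto_intros lnratio)
      then show "((\<lambda>c. s c v) \<longlongrightarrow> f v) at_top" by simp
    qed
    show "\<forall>\<^sub>F c in at_top. AE v in lborel. norm (s c v) \<le> w v"
      \<comment> \<open>From this threshold on, \<open>ln c \<ge> 1\<close> and \<open>0 \<le> ln (c / L ^ k) \<le> ln c\<close>.\<close>
      using eventually_ge_at_top[of "exp 1 * L ^ k"]
    proof eventually_elim
      case (elim c)
      have "L ^ k \<le> exp 1 * L ^ k" using Lk mult_right_mono[of 1 "exp 1" "L ^ k"] by simp
      moreover have "exp 1 \<le> exp 1 * L ^ k" using Lk mult_left_mono[of 1 "L ^ k" "exp 1"] by simp
      ultimately have c: "0 < c" "L ^ k \<le> c" "exp 1 \<le> c"
        using elim Lk(1) by linarith+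
      have lnc: "1 \<le> ln c" using c by (subst ln_ge_iff) auto
      show ?case
      proof (rule AE_I2)
        fix v show "norm (s c v) \<le> w v"
        proof (cases "0 < v")
          case True
          have a: "0 \<le> ln (c / L ^ k)" "ln (c / L ^ k) \<le> ln c"
            using c Lk by (auto simp: ln_div intro!: ln_ge_zero)
          have "(v + ln (c / L ^ k)) / ln c \<le> 1 + v"
          proof -
            have "v + ln (c / L ^ k) \<le> v * ln c + ln c"
            proof -
              have "v * 1 \<le> v * ln c" using lnc True by (intro mult_left_mono) auto
              then show ?thesis using a(2) by linarith
            qed
            then show ?thesis using lnc by (simp add: field_simps)
          qed
          moreover have "0 \<le> (v + ln (c / L ^ k)) / ln c" using a lnc True by auto
          ultimately have "((v + ln (c / L ^ k)) / ln c) ^ m \<le> (1 + v) ^ m" by (rule power_mono)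
          also have "\<dots> \<le> (2 * max 1 v) ^ m" using True by (intro power_mono) auto
          also have "\<dots> = 2 ^ m * (max 1 v) ^ m" by (rule power_mult_distrib)
          also have "(max 1 v) ^ m \<le> 1 + v ^ m" using True by (auto simp: max_def)
          finally have p: "((v + ln (c / L ^ k)) / ln c) ^ m \<le> 2 ^ m * (1 + v ^ m)" by simp
          have "norm (s c v) = (\<alpha> * exp (- \<alpha> * v)) * \<bar>g (exp v)\<bar> * ((v + ln (c / L ^ k)) / ln c) ^ m"
            using True \<alpha> a lnc by (simp add: s_def abs_mult)
          also have "\<dots> \<le> (\<alpha> * exp (- \<alpha> * v)) * Mg * (2 ^ m * (1 + v ^ m))"
            using \<alpha> Mg p gM[of "exp v"] a lnc True by (intro mult_mono) auto
          also have "\<dots> = w v"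
            using True \<alpha> by (simp add: w_def erlang_density_def field_simps)
          finally show ?thesis .
        next
          case False
          then show ?thesis using Mg \<alpha> by (simp add: s_def w_def)
        qed
      qed
    qed
  qed
  moreover have "integral\<^sup>L lborel f = (\<integral>v. g (exp v) \<partial>exp_law \<alpha>)"
  proof -
    have "(\<integral>v. g (exp v) \<partial>exp_law \<alpha>) = (\<integral>v. exponential_density \<alpha> v * g (exp v) \<partial>lborel)"
      unfolding exp_law_def using \<alpha> by (subst integral_real_density) (auto simp: exponential_density_nonneg)
    also have "\<dots> = integral\<^sup>L lborel f"
    proof (rule integral_cong_AE)
      have "AE v in lborel. v \<noteq> (0::real)" by (rule AE_lborel_singleton)
      then show "AE v in lborel. exponential_density \<alpha> v * g (exp v) = f v"
        by eventually_elim (auto simp: exponential_density_def f_def mult.commute)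
      show "f \<in> borel_measurable lborel" unfolding f_def by measurable
    qed simp
    finally show ?thesis by simp
  qed
  moreover have "\<forall>\<^sub>F c in at_top. integral\<^sup>L lborel (s c) = L powr (- \<alpha> * real k) * (\<integral>w. erlang_density (k - 1) \<alpha> w *
      (indicator {w. c < L ^ k * exp w} w * g (L ^ k * exp w / c)) \<partial>lborel) / tail_rate \<alpha> k c"
    using eventually_ge_at_top[of "exp 1 * L ^ k"]
  proof eventually_elim
    case (elim c)
    have "L ^ k \<le> exp 1 * L ^ k" using Lk mult_right_mono[of 1 "exp 1" "L ^ k"] by simp
      moreover have "exp 1 \<le> exp 1 * L ^ k" using Lk mult_left_mono[of 1 "L ^ k" "exp 1"] by simp
    ultimately have c: "0 < c" "L ^ k \<le> c" "exp 1 \<le> c"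
      using elim Lk(1) by linarith+
    have lnc: "1 \<le> ln c" using c by (subst ln_ge_iff) auto
    have c1: "1 < c" using c(3) exp_gt_one[of 1] by linarith
    define a where "a = ln (c / L ^ k)"
    have a0: "0 \<le> a" using c Lk by (auto simp: a_def intro!: ln_ge_zero)
    have ea: "L ^ k * exp a = c"
      unfolding a_def exp_ln[OF divide_pos_pos[OF c(1) Lk(1)]] using L by simp
    have ea': "L ^ k * exp (a + v) = c * exp v" for v unfolding exp_add ea[symmetric] by simp
    have "exp (- \<alpha> * a) = (c / L ^ k) powr - \<alpha>"
      using divide_pos_pos[OF c(1) Lk(1)] c(1) L
      by (simp only: a_def powr_def) simp
    also have "\<dots> = c powr - \<alpha> / (L ^ k) powr - \<alpha>" by (intro powr_divide)
    also have "(L ^ k) powr - \<alpha> = L powr (- \<alpha> * real k)"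
      using L by (simp add: powr_realpow[symmetric] powr_powr mult.commute)
    finally have Lc: "L powr (- \<alpha> * real k) * exp (- \<alpha> * a) = c powr - \<alpha>" using L by simp
    have shift: "(\<integral>w. erlang_density (k - 1) \<alpha> w *
      (indicator {w. c < L ^ k * exp w} w * g (L ^ k * exp w / c)) \<partial>lborel) =
      (\<integral>v. erlang_density m \<alpha> (a + v) *
      (indicator {0<..} v * g (exp v)) \<partial>lborel)"
    proof -
      have "indicator {w. c < L ^ k * exp w} (a + v) = (indicator {0<..} v :: real)" for v
        using c by (simp add: indicator_def ea')
      moreover have "L ^ k * exp (a + v) / c = exp v" for v using c by (simp add: ea')
      ultimately show ?thesis
        by (subst lborel_integral_real_affine[where c = 1 and t = a]) (simp_all add: m_def)
    qed
    have "L powr (- \<alpha> * real k) * (\<integral>w. erlang_density (k - 1) \<alpha> w *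
      (indicator {w. c < L ^ k * exp w} w * g (L ^ k * exp w / c)) \<partial>lborel) =
      (\<integral>v. L powr (- \<alpha> * real k) * (erlang_density m \<alpha> (a + v) *
      (indicator {0<..} v * g (exp v))) \<partial>lborel)" unfolding shift by simp
    also have "\<dots> = (\<integral>v. tail_rate \<alpha> k c * s c v \<partial>lborel)"
    proof (intro Bochner_Integration.integral_cong refl)
      fix v
      show "L powr (- \<alpha> * real k) * (erlang_density m \<alpha> (a + v) * (indicator {0<..} v * g (exp v))) =
         tail_rate \<alpha> k c * s c v"
      proof (cases "0 < v")
        case True
        have "tail_rate \<alpha> k c * s c v = c powr - \<alpha> * \<alpha> ^ m * (ln c) ^ m / fact m *
            ((\<alpha> * exp (- \<alpha> * v)) * g (exp v) * ((v + a) ^ m / (ln c) ^ m))"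
          using True by (simp add: tail_rate_def s_def m_def a_def power_divide power_mult_distrib)
        also have "\<dots> = c powr - \<alpha> * \<alpha> ^ Suc m / fact m * exp (- \<alpha> * v) * g (exp v) * (v + a) ^ m"
          using lnc by simp
        also have "\<dots> = L powr (- \<alpha> * real k) * (\<alpha> ^ Suc m / fact m * exp (- \<alpha> * (a + v)) * g (exp v) * (a + v) ^ m)"
          unfolding Lc[symmetric] by (simp add: exp_add[symmetric] algebra_simps)
        finally show ?thesis using True a0 by (simp add: erlang_density_def)
      qed (simp add: s_def)
    qed
    also have "\<dots> = tail_rate \<alpha> k c * integral\<^sup>L lborel (s c)" by simp
    finally show ?case using tail_rate_pos[OF \<alpha> c1, of k] by simp
  qed
  ultimately show ?thesis by (auto intro: Lim_transform_eventually)
qed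

lemma PiM_pair_eq_distr:
  assumes "finite I" "prob_space A" "prob_space B"
  shows "(\<Pi>\<^sub>M i\<in>I. A \<Otimes>\<^sub>M B) =
    distr ((\<Pi>\<^sub>M i\<in>I. A) \<Otimes>\<^sub>M (\<Pi>\<^sub>M i\<in>I. B)) (\<Pi>\<^sub>M i\<in>I. A \<Otimes>\<^sub>M B) (\<lambda>(x, y). \<lambda>i\<in>I. (x i, y i))"
proof -
  interpret A: product_prob_space "\<lambda>_. A" using assms by (intro product_prob_spaceI)
  interpret B: product_prob_space "\<lambda>_. B" using assms by (intro product_prob_spaceI)
  interpret AB: product_prob_space "\<lambda>_. A \<Otimes>\<^sub>M B" using assms by (intro product_prob_spaceI prob_space_pair)
  have PB: "sigma_finite_measure (\<Pi>\<^sub>M i\<in>I. B)"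
    using assms by (intro prob_space_imp_sigma_finite prob_space_PiM)
  let ?P = "(\<Pi>\<^sub>M i\<in>I. A) \<Otimes>\<^sub>M (\<Pi>\<^sub>M i\<in>I. B)" and ?m = "\<lambda>(x, y). \<lambda>i\<in>I. (x i, y i)"
  have m: "?m \<in> measurable ?P (\<Pi>\<^sub>M i\<in>I. A \<Otimes>\<^sub>M B)"
    unfolding case_prod_beta' by (intro measurable_restrict measurable_Pair) auto
  show ?thesis
  proof (rule AB.PiM_eqI[symmetric, OF \<open>finite I\<close>])
    fix C assume C: "\<And>i. i \<in> I \<Longrightarrow> C i \<in> sets (A \<Otimes>\<^sub>M B)"
    then have PC: "Pi\<^sub>E I C \<in> sets (\<Pi>\<^sub>M i\<in>I. A \<Otimes>\<^sub>M B)" using \<open>finite I\<close> by (intro sets_PiM_I_finite)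
    have Cs: "Pair x -` C i \<in> sets B" if "i \<in> I" for x i using C[OF that] by (rule sets_Pair1)
    have "emeasure (distr ?P (\<Pi>\<^sub>M i\<in>I. A \<Otimes>\<^sub>M B) ?m) (Pi\<^sub>E I C) = emeasure ?P (?m -` Pi\<^sub>E I C \<inter> space ?P)"
      by (rule emeasure_distr[OF m PC])
    also have "\<dots> = (\<integral>\<^sup>+x. emeasure (\<Pi>\<^sub>M i\<in>I. B) (Pair x -` (?m -` Pi\<^sub>E I C \<inter> space ?P)) \<partial>(\<Pi>\<^sub>M i\<in>I. A))"
      by (rule sigma_finite_measure.emeasure_pair_measure_alt[OF PB measurable_sets[OF m PC]])
    also have "\<dots> = (\<integral>\<^sup>+x. (\<Prod>i\<in>I. emeasure B (Pair (x i) -` C i)) \<partial>(\<Pi>\<^sub>M i\<in>I. A))"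
    proof (intro nn_integral_cong)
      fix x assume x: "x \<in> space (\<Pi>\<^sub>M i\<in>I. A)"
      have "Pair x -` (?m -` Pi\<^sub>E I C \<inter> space ?P) = (\<Pi>\<^sub>E i\<in>I. Pair (x i) -` C i)"
        using x sets.sets_into_space[OF Cs]
        by (fastforce simp: space_pair_measure space_PiM PiE_iff extensional_def)
      then show "emeasure (\<Pi>\<^sub>M i\<in>I. B) (Pair x -` (?m -` Pi\<^sub>E I C \<inter> space ?P)) =
          (\<Prod>i\<in>I. emeasure B (Pair (x i) -` C i))"
        using Cs \<open>finite I\<close> by (simp add: B.emeasure_PiM)
    qed
    also have "\<dots> = (\<Prod>i\<in>I. \<integral>\<^sup>+x. emeasure B (Pair x -` C i) \<partial>A)"
      using C \<open>finite I\<close> by (intro A.product_nn_integral_prod B.M.measurable_emeasure_Pair) auto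
    also have "\<dots> = (\<Prod>i\<in>I. emeasure (A \<Otimes>\<^sub>M B) (C i))"
      using C by (intro prod.cong refl B.M.emeasure_pair_measure_alt[symmetric])
    finally show "emeasure (distr ?P (\<Pi>\<^sub>M i\<in>I. A \<Otimes>\<^sub>M B) ?m) (Pi\<^sub>E I C) =
        (\<Prod>i\<in>I. emeasure (A \<Otimes>\<^sub>M B) (C i))" .
  qed simp
qed

lemma distributed_sum_exp_law:
  assumes "0 < \<alpha>" "1 \<le> k"
  shows "distributed (\<Pi>\<^sub>M l\<in>{..<k}. exp_law \<alpha>) lborel (\<lambda>v. \<Sum>l<k. v l) (erlang_density (k - 1) \<alpha>)"
proof -
  let ?P = "\<Pi>\<^sub>M l\<in>{..<k}. exp_law \<alpha>"
  interpret prob_space ?P using assms by (intro prob_space_PiM prob_space_exp_law)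
  have ne: "{..<k} \<noteq> {}" using assms(2) by (auto simp: lessThan_empty_iff)
  have comp: "distr ?P borel (\<lambda>v. v l) = exp_law \<alpha>" if "l < k" for l
  proof -
    have "distr ?P (exp_law \<alpha>) (\<lambda>v. v l) = exp_law \<alpha>"
      using that assms by (intro distr_PiM_component prob_space_exp_law) auto
    then show ?thesis by (simp cong: distr_cong)
  qed
  have [measurable]: "(\<lambda>v. v l) \<in> borel_measurable ?P" if "l < k" for l
    using measurable_component_singleton[of l "{..<k}" "\<lambda>_. exp_law \<alpha>"] that by simp
  have "indep_vars (\<lambda>_. borel) (\<lambda>l v. v l) {..<k}"
  proof (subst indep_vars_iff_distr_eq_PiM'[OF ne])
    have "distr ?P (\<Pi>\<^sub>M l\<in>{..<k}. borel) (\<lambda>v. \<lambda>l\<in>{..<k}. v l) = distr ?P ?P (\<lambda>v. v)"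
      by (intro distr_cong refl sets_PiM_cong) (auto simp: space_PiM PiE_def extensional_restrict)
    also have "\<dots> = ?P" by (rule distr_id)
    also have "\<dots> = (\<Pi>\<^sub>M l\<in>{..<k}. distr ?P borel (\<lambda>v. v l))"
      using comp by (intro PiM_cong) auto
    finally show "distr ?P (\<Pi>\<^sub>M l\<in>{..<k}. borel) (\<lambda>v. \<lambda>l\<in>{..<k}. v l) = (\<Pi>\<^sub>M l\<in>{..<k}. distr ?P borel (\<lambda>v. v l))" .
  qed simp
  moreover have "distributed ?P lborel (\<lambda>v. v l) (exponential_density \<alpha>)" if "l < k" for l
  proof -
    have "distr ?P lborel (\<lambda>v. v l) = exp_law \<alpha>"
      using comp[OF that] distr_cong[OF refl sets_lborel, of ?P "\<lambda>v. v l" "\<lambda>v. v l"] by simp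
    then show ?thesis using that by (simp add: distributed_def exp_law_def)
  qed
  ultimately have "distributed ?P lborel (\<lambda>v. \<Sum>l\<in>{..<k}. v l) (erlang_density (card {..<k} - 1) \<alpha>)"
    using ne assms by (intro exponential_distributed_sum) auto
  then show ?thesis by simp
qed

context regenerative_setup
begin

lemma PiM_zero_law:
  fixes k :: nat
  assumes L: "0 < L"
  shows "(\<Pi>\<^sub>M l\<in>{..<k}. zero_law L) =
    distr ((\<Pi>\<^sub>M l\<in>{..<k}. exp_law \<alpha>) \<Otimes>\<^sub>M (\<Pi>\<^sub>M l\<in>{..<k}. R)) (\<Pi>\<^sub>M l\<in>{..<k}. \<nu>)
      (\<lambda>(v, u). \<lambda>l\<in>{..<k}. (L * exp (v l), u l))"
proof -
  let ?E = "exp_law \<alpha>" and ?m = "\<lambda>(v, u). (L * exp v, u)"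
  let ?pair = "\<lambda>(x, y). \<lambda>i\<in>{..<k}. (x i, y i)"
  have m: "?m \<in> measurable (?E \<Otimes>\<^sub>M R) (zero_law L)"
    using measurable_zero_law[OF L] by (simp add: measurable_cong_sets[OF refl sets_zero_law])
  have P: "prob_space ?E" "prob_space R" "prob_space (?E \<Otimes>\<^sub>M R)" "prob_space (zero_law L)"
    using prob_space_exp_law[OF \<alpha>] prob_space_R prob_space_zero_law[OF L] by (auto intro: prob_space_pair)
  have sZ: "sets (\<Pi>\<^sub>M l\<in>{..<k}. zero_law L) = sets (\<Pi>\<^sub>M l\<in>{..<k}. \<nu>)" by (intro sets_PiM_cong) auto
  have zl: "zero_law L = distr (?E \<Otimes>\<^sub>M R) (zero_law L) ?m"
    unfolding zero_law_def[of L] by (intro distr_cong) auto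
  have "(\<Pi>\<^sub>M l\<in>{..<k}. zero_law L) = (\<Pi>\<^sub>M l\<in>{..<k}. distr (?E \<Otimes>\<^sub>M R) (zero_law L) ?m)"
    using zl by (intro PiM_cong) auto
  also have "\<dots> = distr (\<Pi>\<^sub>M l\<in>{..<k}. ?E \<Otimes>\<^sub>M R) (\<Pi>\<^sub>M l\<in>{..<k}. zero_law L) (compose {..<k} ?m)"
    using P m by (intro distr_PiM_finite_prob_space'[symmetric]) auto
  also have "\<dots> = distr (distr ((\<Pi>\<^sub>M i\<in>{..<k}. ?E) \<Otimes>\<^sub>M (\<Pi>\<^sub>M i\<in>{..<k}. R)) (\<Pi>\<^sub>M i\<in>{..<k}. ?E \<Otimes>\<^sub>M R) ?pair)
      (\<Pi>\<^sub>M l\<in>{..<k}. zero_law L) (compose {..<k} ?m)"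
    by (subst PiM_pair_eq_distr[symmetric]) (use P in auto)
  also have "\<dots> = distr ((\<Pi>\<^sub>M i\<in>{..<k}. ?E) \<Otimes>\<^sub>M (\<Pi>\<^sub>M i\<in>{..<k}. R)) (\<Pi>\<^sub>M l\<in>{..<k}. zero_law L) (compose {..<k} ?m \<circ> ?pair)"
  proof (rule distr_distr)
    show "compose {..<k} ?m \<in> measurable (\<Pi>\<^sub>M i\<in>{..<k}. ?E \<Otimes>\<^sub>M R) (\<Pi>\<^sub>M l\<in>{..<k}. zero_law L)"
      unfolding compose_def
    proof (intro measurable_restrict)
      fix l assume l: "l \<in> {..<k}"
      show "(\<lambda>x. ?m (x l)) \<in> measurable (\<Pi>\<^sub>M i\<in>{..<k}. ?E \<Otimes>\<^sub>M R) (zero_law L)"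
        by (rule measurable_compose[OF _ m]) (rule measurable_component_singleton[OF l])
    qed
    show "?pair \<in> measurable ((\<Pi>\<^sub>M i\<in>{..<k}. ?E) \<Otimes>\<^sub>M (\<Pi>\<^sub>M i\<in>{..<k}. R)) (\<Pi>\<^sub>M i\<in>{..<k}. ?E \<Otimes>\<^sub>M R)"
      unfolding case_prod_beta' by (intro measurable_restrict measurable_Pair) auto
  qed
  also have "\<dots> = distr ((\<Pi>\<^sub>M l\<in>{..<k}. ?E) \<Otimes>\<^sub>M (\<Pi>\<^sub>M l\<in>{..<k}. R)) (\<Pi>\<^sub>M l\<in>{..<k}. \<nu>)
      (\<lambda>(v, u). \<lambda>l\<in>{..<k}. (L * exp (v l), u l))"
    using sZ by (intro distr_cong refl) (auto simp: compose_def)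
  finally show ?thesis .
qed

lemma measurable_tuple_functional:
  fixes G :: "real \<Rightarrow> (nat \<Rightarrow> nat set) \<Rightarrow> real"
  assumes G[measurable]: "case_prod G \<in> borel_measurable (borel \<Otimes>\<^sub>M (\<Pi>\<^sub>M l\<in>{..<k}. R))"
  shows "(\<lambda>z. if c < (\<Prod>l<k. fst (z l)) then G ((\<Prod>l<k. fst (z l)) / c) (\<lambda>l\<in>{..<k}. snd (z l)) else 0)
    \<in> borel_measurable (\<Pi>\<^sub>M l\<in>{..<k}. \<nu>)" (is "?h \<in> _")
proof -
  let ?R = "\<Pi>\<^sub>M l\<in>{..<k}. R"
  have sZ: "sets (\<Pi>\<^sub>M l\<in>{..<k}. \<nu>) = sets (\<Pi>\<^sub>M l\<in>{..<k}. restrict_space borel {0<..} \<Otimes>\<^sub>M E_space)"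
    by (intro sets_PiM_cong refl sets_\<nu>)
  have id: "(\<lambda>x. x) \<in> borel_measurable (restrict_space borel {0::real<..})"
    by (intro measurable_restrict_space1) simp
  have fstm: "fst \<in> borel_measurable (restrict_space borel {0::real<..} \<Otimes>\<^sub>M E_space)"
  proof -
    have "(\<lambda>z. (\<lambda>x. x) (fst z)) \<in> borel_measurable (restrict_space borel {0::real<..} \<Otimes>\<^sub>M E_space)"
      by (rule measurable_compose[OF measurable_fst id])
    then show ?thesis by simp
  qed
  have c1: "(\<lambda>z. fst (z l)) \<in> borel_measurable (\<Pi>\<^sub>M l\<in>{..<k}. restrict_space borel {0::real<..} \<Otimes>\<^sub>M E_space)"
    and c2: "(\<lambda>z. snd (z l)) \<in> measurable (\<Pi>\<^sub>M l\<in>{..<k}. restrict_space borel {0::real<..} \<Otimes>\<^sub>M E_space) E_space"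
    if "l < k" for l
    using that
    by (auto intro!: measurable_compose[OF measurable_component_singleton] fstm)
  have pr: "(\<lambda>z. \<Prod>l<k. fst (z l)) \<in> borel_measurable (\<Pi>\<^sub>M l\<in>{..<k}. restrict_space borel {0::real<..} \<Otimes>\<^sub>M E_space)"
    using c1 by (intro borel_measurable_prod) auto
  have "(\<lambda>z. \<lambda>l\<in>{..<k}. snd (z l)) \<in> measurable (\<Pi>\<^sub>M l\<in>{..<k}. restrict_space borel {0::real<..} \<Otimes>\<^sub>M E_space) ?R"
    using c2 by (intro measurable_restrict) auto
  note [measurable] = this pr
  have "?h \<in> borel_measurable (\<Pi>\<^sub>M l\<in>{..<k}. restrict_space borel {0<..} \<Otimes>\<^sub>M E_space)"
    by measurable
  then show ?thesis by (subst measurable_cong_sets[OF sZ refl])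
qed

lemma measurable_common_profile:
  fixes k :: nat
  shows "(\<lambda>(y, u) s. y * indicator (\<Inter>l\<in>{..<k}. u l) s) \<in>
    measurable ((borel :: real measure) \<Otimes>\<^sub>M (\<Pi>\<^sub>M l\<in>{..<k}. R)) (borel :: (nat \<Rightarrow> real) measure)"
proof (rule measurable_coordinatewise_then_product)
  let ?P = "(borel :: real measure) \<Otimes>\<^sub>M (\<Pi>\<^sub>M l\<in>{..<k}. R)"
  fix s
  have "Measurable.pred ?P (\<lambda>x. s \<in> snd x l)" if "l \<in> {..<k}" for l
  proof -
    have "(\<lambda>x. snd x l) \<in> measurable ?P R"
      by (rule measurable_compose[OF measurable_snd measurable_component_singleton[OF that]])
    then have "(\<lambda>x. snd x l) \<in> measurable ?P E_space" by (simp add: measurable_cong_sets[OF refl sets_R])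
    from measurable_compose[OF this pred_mem_E_space] show ?thesis .
  qed
  then have [measurable]: "Measurable.pred ?P (\<lambda>x. \<forall>l\<in>{..<k}. s \<in> snd x l)"
    by (intro pred_intros_finite(3)) auto
  have eq: "(\<lambda>x. (case x of (y, u) \<Rightarrow> \<lambda>s. y * indicator (\<Inter>l\<in>{..<k}. u l) s) s) =
     (\<lambda>x. fst x * (if \<forall>l\<in>{..<k}. s \<in> snd x l then 1 else (0::real)))"
    by (auto simp: indicator_def fun_eq_iff)
  show "(\<lambda>x. (case x of (y, u) \<Rightarrow> \<lambda>s. y * indicator (\<Inter>l\<in>{..<k}. u l) s) s) \<in> borel_measurable ?P"
    unfolding eq by measurable
qed

lemma measurable_profile_functional:
  fixes F :: "(nat \<Rightarrow> real) \<Rightarrow> real" and k :: nat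
  assumes "F \<in> borel_measurable borel"
  shows "case_prod (\<lambda>y u. F (\<lambda>s. y * indicator (\<Inter>l\<in>{..<k}. u l) s)) \<in>
    borel_measurable (borel \<Otimes>\<^sub>M (\<Pi>\<^sub>M l\<in>{..<k}. R))"
  using measurable_compose[OF measurable_common_profile assms, of k] by (simp add: case_prod_beta')

text \<open>
  Given that the product exceeds \<open>c\<close>, its ratio to \<open>c\<close> becomes Pareto distributed and is independent of the
  sets. The densities converge, so \<open>G\<close> may be any bounded measurable function.
\<close>

lemma tuple_integral_asymptotics:
  fixes G :: "real \<Rightarrow> (nat \<Rightarrow> nat set) \<Rightarrow> real"
  assumes L: "1 \<le> L" and k: "1 \<le> k"
    and G[measurable]: "case_prod G \<in> borel_measurable (borel \<Otimes>\<^sub>M (\<Pi>\<^sub>M l\<in>{..<k}. R))"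
    and GM: "\<And>y u. \<bar>G y u\<bar> \<le> Mg"
  shows "((\<lambda>c. L powr (- \<alpha> * real k) *
      (\<integral>z. (if c < (\<Prod>l<k. fst (z l)) then G ((\<Prod>l<k. fst (z l)) / c) (\<lambda>l\<in>{..<k}. snd (z l)) else 0)
        \<partial>(\<Pi>\<^sub>M l\<in>{..<k}. zero_law L)) / tail_rate \<alpha> k c)
    \<longlongrightarrow> (\<integral>v. (\<integral>u. G (exp v) u \<partial>(\<Pi>\<^sub>M l\<in>{..<k}. R)) \<partial>exp_law \<alpha>)) at_top"
proof -
  let ?E = "\<Pi>\<^sub>M l\<in>{..<k}. exp_law \<alpha>" and ?R = "\<Pi>\<^sub>M l\<in>{..<k}. R"
  let ?h = "\<lambda>c z. if c < (\<Prod>l<k. fst (z l)) then G ((\<Prod>l<k. fst (z l)) / c) (\<lambda>l\<in>{..<k}. snd (z l)) else 0"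
  define g where "g y = (\<integral>u. G y u \<partial>?R)" for y
  interpret E: prob_space ?E using \<alpha> by (intro prob_space_PiM prob_space_exp_law)
  interpret RR: prob_space ?R by (intro prob_space_PiM prob_space_R)
  interpret ER: pair_prob_space ?E ?R ..
  have L0: "0 < L" using L by simp
  have g[measurable]: "g \<in> borel_measurable borel"
    unfolding g_def by measurable
  have Mg: "0 \<le> Mg" using GM[of 0 undefined] by linarith
  have gM: "\<bar>g y\<bar> \<le> Mg" for y
  proof -
    have "\<bar>g y\<bar> \<le> (\<integral>u. Mg \<partial>?R)"
      unfolding g_def using GM Mg by (intro order_trans[OF integral_abs_bound] integral_mono') auto
    then show ?thesis by (simp add: RR.prob_space)
  qed
  have eq: "(\<integral>z. ?h c z \<partial>(\<Pi>\<^sub>M l\<in>{..<k}. zero_law L)) = (\<integral>w. erlang_density (k - 1) \<alpha> w *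
      (indicator {w. c < L ^ k * exp w} w * g (L ^ k * exp w / c)) \<partial>lborel)" for c
  proof -
    define f where "f = (\<lambda>(w, u). indicator {w. c < L ^ k * exp w} w * G (L ^ k * exp w / c) u)"
    have [measurable]: "f \<in> borel_measurable (borel \<Otimes>\<^sub>M ?R)" unfolding f_def by measurable
    have sm: "(\<lambda>v. \<Sum>l<k. v l) \<in> borel_measurable ?E"
      using distributed_measurable[OF distributed_sum_exp_law[OF \<alpha> k]] by simp
    note [measurable] = sm
    have hm: "?h c \<in> borel_measurable (\<Pi>\<^sub>M l\<in>{..<k}. \<nu>)"
      by (rule measurable_tuple_functional) (rule G)
    have mm: "(\<lambda>(v, u). \<lambda>l\<in>{..<k}. (L * exp (v l), u l)) \<in> measurable (?E \<Otimes>\<^sub>M ?R) (\<Pi>\<^sub>M l\<in>{..<k}. \<nu>)"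
    proof -
      have "(\<lambda>x. (L * exp (fst x l), snd x l)) \<in> measurable (?E \<Otimes>\<^sub>M ?R) \<nu>" if "l < k" for l
      proof -
        have "(\<lambda>x. (fst x l, snd x l)) \<in> measurable (?E \<Otimes>\<^sub>M ?R) (exp_law \<alpha> \<Otimes>\<^sub>M R)"
          using that
          by (intro measurable_Pair measurable_compose[OF measurable_fst measurable_component_singleton]
              measurable_compose[OF measurable_snd measurable_component_singleton]) auto
        from measurable_compose[OF this measurable_zero_law[OF L0]] show ?thesis by simp
      qed
      then show ?thesis unfolding case_prod_beta' by (intro measurable_restrict) auto
    qed
    have "(\<integral>z. ?h c z \<partial>(\<Pi>\<^sub>M l\<in>{..<k}. zero_law L)) =
      (\<integral>x. ?h c ((\<lambda>(v, u). \<lambda>l\<in>{..<k}. (L * exp (v l), u l)) x) \<partial>(?E \<Otimes>\<^sub>M ?R))"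
      unfolding PiM_zero_law[OF L0] by (rule integral_distr[OF mm hm])
    also have "\<dots> = (\<integral>x. f (\<Sum>l<k. fst x l, snd x) \<partial>(?E \<Otimes>\<^sub>M ?R))"
    proof (intro Bochner_Integration.integral_cong refl)
      fix x assume x: "x \<in> space (?E \<Otimes>\<^sub>M ?R)"
      have "(\<Prod>l<k. L * exp (fst x l)) = L ^ k * exp (\<Sum>l<k. fst x l)"
        by (simp add: prod.distrib exp_sum)
      moreover have "(\<lambda>l\<in>{..<k}. snd x l) = snd x"
        using x by (auto simp: space_pair_measure space_PiM PiE_def extensional_restrict)
      ultimately show "?h c ((\<lambda>(v, u). \<lambda>l\<in>{..<k}. (L * exp (v l), u l)) x) = f (\<Sum>l<k. fst x l, snd x)"
        by (simp add: case_prod_beta' f_def indicator_def cong: restrict_cong)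
    qed
    also have "\<dots> = (\<integral>v. (\<integral>u. f (\<Sum>l<k. v l, u) \<partial>?R) \<partial>?E)"
    proof -
      have "integrable (?E \<Otimes>\<^sub>M ?R) (\<lambda>x. f (\<Sum>l<k. fst x l, snd x))"
      proof (rule ER.integrable_const_bound[where B = Mg])
        show "AE x in ?E \<Otimes>\<^sub>M ?R. norm (f (\<Sum>l<k. fst x l, snd x)) \<le> Mg"
          using GM Mg by (auto simp: f_def indicator_def)
        show "(\<lambda>x. f (\<Sum>l<k. fst x l, snd x)) \<in> borel_measurable (?E \<Otimes>\<^sub>M ?R)"
          by (rule measurable_compose[where g = f and N = "borel \<Otimes>\<^sub>M ?R"])
             (intro measurable_Pair measurable_compose[OF measurable_fst sm] measurable_snd, measurable)
      qed
      from ER.integral_fst'[OF this] show ?thesis by simp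
    qed
    also have "\<dots> = (\<integral>v. (\<lambda>w. indicator {w. c < L ^ k * exp w} w * g (L ^ k * exp w / c)) (\<Sum>l<k. v l) \<partial>?E)"
      by (simp add: f_def g_def)
    also have "\<dots> = (\<integral>w. erlang_density (k - 1) \<alpha> w *
      (indicator {w. c < L ^ k * exp w} w * g (L ^ k * exp w / c)) \<partial>lborel)"
      using \<alpha> by (intro distributed_integral[OF distributed_sum_exp_law[OF \<alpha> k], symmetric]) auto
    finally show ?thesis .
  qed
  show ?thesis
    unfolding eq g_def[symmetric] by (rule erlang_tail_asymptotics[OF \<alpha> L k g gM])
qed

end

section \<open>Paths on the dominating event\<close>

locale tuple_model = regenerative_setup \<alpha> p for \<alpha> p +
  fixes M :: "'a measure" and \<eta> :: "nat \<Rightarrow> 'a \<Rightarrow> real" and S :: "nat \<Rightarrow> 'a \<Rightarrow> nat set"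
    and k t :: nat
  assumes ppp: "poisson_point_process M (regenerative_intensity \<alpha> p) (\<lambda>i \<omega>. (\<eta> i \<omega>, S i \<omega>))"
    and k: "1 \<le> k"

sublocale tuple_model \<subseteq> poisson_process M "regenerative_intensity \<alpha> p" "\<lambda>i \<omega>. (\<eta> i \<omega>, S i \<omega>)"
proof (intro poisson_process.intro poisson_process_axioms.intro)
  show "prob_space M" using ppp unfolding poisson_point_process_def by (rule conjunct1)
  show "poisson_point_process M (regenerative_intensity \<alpha> p) (\<lambda>i \<omega>. (\<eta> i \<omega>, S i \<omega>))" by (rule ppp)
qed

context tuple_model
begin

abbreviation "Z \<equiv> \<lambda>i \<omega>. (\<eta> i \<omega>, S i \<omega>)"
abbreviation "X \<equiv> tuple_process k \<eta> S"

lemma point_in_space: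
  assumes "\<omega> \<in> space M" shows "0 < \<eta> i \<omega>" "S i \<omega> \<in> space E_space"
  using measurable_space[OF measurable_point assms, of i] by (auto simp: space_\<nu>)

lemma measurable_point': "Z i \<in> measurable M (restrict_space borel {0<..} \<Otimes>\<^sub>M E_space)"
  using measurable_point[of i] by (simp only: measurable_cong_sets[OF refl sets_\<nu>])

lemma measurable_\<eta> [measurable]: "\<eta> i \<in> borel_measurable M"
proof -
  have id: "(\<lambda>x. x) \<in> borel_measurable (restrict_space borel {0::real<..})"
    by (intro measurable_restrict_space1) simp
  from measurable_compose[OF measurable_compose[OF measurable_point' measurable_fst] id]
  show ?thesis by simp
qed

lemma pred_mem_S [measurable]: "Measurable.pred M (\<lambda>\<omega>. s \<in> S i \<omega>)"
  using measurable_compose[OF measurable_compose[OF measurable_point' measurable_snd] pred_mem_E_space]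
  by simp

lemma measurable_X [measurable]: "X s \<in> borel_measurable M"
proof -
  have "(\<lambda>\<omega>. indicator (S i \<omega>) s :: real) \<in> borel_measurable M" for i
    unfolding indicator_def of_bool_def by measurable
  note [measurable] = this
  have "(\<lambda>\<omega>. \<Squnion>i\<in>distinct_tuples k. ennreal ((\<Prod>j<k. \<eta> (i j) \<omega>) * (\<Prod>j<k. indicator (S (i j) \<omega>) s)))
      \<in> borel_measurable M"
    by (intro borel_measurable_SUP countable_distinct_tuples) measurable
  then show ?thesis unfolding tuple_process_def by measurable
qed

lemma X_nonneg: "0 \<le> X s \<omega>" by (simp add: tuple_process_def)

lemma point_in_big_hitting_iff:
  assumes "\<omega> \<in> space M" "0 < L"
  shows "Z i \<omega> \<in> big_hitting t L \<longleftrightarrow> L < \<eta> i \<omega> \<and> (\<exists>s\<le>t. s \<in> S i \<omega>)"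
  using point_in_space[OF assms(1), of i] assms by (auto simp: big_hitting_def hitting_def)

lemma point_in_big_zero_iff:
  assumes "\<omega> \<in> space M" "0 < L"
  shows "Z i \<omega> \<in> big_zero L \<longleftrightarrow> L < \<eta> i \<omega> \<and> 0 \<in> S i \<omega>"
  using point_in_space[OF assms(1), of i] assms by (auto simp: big_zero_def hitting_def)

lemma big_zero_subset: "L \<le> L' \<Longrightarrow> big_zero L' \<subseteq> big_hitting t L"
  using hitting_mono[of 0 t] by (auto simp: big_zero_def big_hitting_def)

text \<open>
  There are two levels: \<open>L\<close> is the one above which points are counted, \<open>L'\<close> is the one that the points of the
  tuple have to exceed.
\<close>

definition tuple_event :: "nat \<Rightarrow> real \<Rightarrow> real \<Rightarrow> real \<Rightarrow> nat \<Rightarrow> 'a set" where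
  "tuple_event j L L' c n = {\<omega>\<in>space M. point_count Z (big_hitting t L) \<omega> = of_nat n \<and>
     (\<exists>i\<in>distinct_tuples j. (\<forall>l<j. Z (i l) \<omega> \<in> big_zero L') \<and> c < (\<Prod>l<j. \<eta> (i l) \<omega>))}"

abbreviation good :: "real \<Rightarrow> real \<Rightarrow> real \<Rightarrow> 'a set" where
  "good L L' c \<equiv> tuple_event k L L' c k"

definition big_indices :: "real \<Rightarrow> 'a \<Rightarrow> nat set" where
  "big_indices L \<omega> = {i. Z i \<omega> \<in> big_hitting t L}"

text \<open>
  Any tuple of points whose sets contain \<open>s\<close> is compared with the enumeration of the big points. If \<open>m\<close>
  of its entries are not big, they are at most \<open>L\<close>, whereas the \<open>m\<close> big points that it misses exceed \<open>L'\<close>. The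
  loss is a factor \<open>(L / L') ^ m\<close>, and \<open>m = 0\<close> is possible only if all big points contain \<open>s\<close>.
\<close>

lemma tuple_product_le:
  assumes \<omega>: "\<omega> \<in> space M" and L: "0 < L" "L \<le> L'"
    and I: "finite (big_indices L \<omega>)" "card (big_indices L \<omega>) = k"
      "\<And>i. i \<in> big_indices L \<omega> \<Longrightarrow> L' < \<eta> i \<omega>"
    and i: "i \<in> distinct_tuples k" and s: "s \<le> t" "\<And>l. l < k \<Longrightarrow> s \<in> S (i l) \<omega>"
  shows "(\<Prod>l<k. \<eta> (i l) \<omega>) \<le>
    (\<Prod>j\<in>big_indices L \<omega>. \<eta> j \<omega>) * (if s \<in> (\<Inter>j\<in>big_indices L \<omega>. S j \<omega>) then 1 else L / L')"
proof -
  let ?I = "big_indices L \<omega>"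
  define J where "J = {l\<in>{..<k}. i l \<in> ?I}"
  define m where "m = k - card J"
  have inj: "inj_on i {..<k}" using i by (simp add: distinct_tuples_def)
  have injJ: "inj_on i J" using inj by (rule inj_on_subset) (auto simp: J_def)
  have J: "J \<subseteq> {..<k}" "finite J" by (auto simp: J_def)
  have iJ: "i ` J \<subseteq> ?I" by (auto simp: J_def)
  have pos: "0 < \<eta> j \<omega>" for j using point_in_space(1)[OF \<omega>] .
  have small: "\<eta> (i l) \<omega> \<le> L" if "l \<in> {..<k} - J" for l
    using that s point_in_big_hitting_iff[OF \<omega> L(1), of "i l"] by (auto simp: J_def big_indices_def not_less)
  have cardm: "card ({..<k} - J) = m" using J by (simp add: m_def card_Diff_subset)
  have cardm': "card (?I - i ` J) = m"
    using I iJ J injJ by (simp add: m_def card_Diff_subset card_image)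
  have "(\<Prod>l<k. \<eta> (i l) \<omega>) = (\<Prod>l\<in>J. \<eta> (i l) \<omega>) * (\<Prod>l\<in>{..<k} - J. \<eta> (i l) \<omega>)"
    using J by (subst prod.subset_diff[of J]) (auto simp: mult.commute)
  also have "(\<Prod>l\<in>{..<k} - J. \<eta> (i l) \<omega>) \<le> (\<Prod>l\<in>{..<k} - J. L)"
    using small pos by (intro prod_mono) (auto intro: less_imp_le)
  also have "\<dots> = L ^ m" by (simp add: cardm)
  also have "(\<Prod>l\<in>J. \<eta> (i l) \<omega>) = (\<Prod>j\<in>i ` J. \<eta> j \<omega>)" using injJ by (simp add: prod.reindex)
  finally have 1: "(\<Prod>l<k. \<eta> (i l) \<omega>) \<le> (\<Prod>j\<in>i ` J. \<eta> j \<omega>) * L ^ m"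
    using pos by (simp add: mult_left_mono prod_nonneg less_imp_le)
  have "(\<Prod>j\<in>i ` J. \<eta> j \<omega>) * L' ^ m \<le> (\<Prod>j\<in>i ` J. \<eta> j \<omega>) * (\<Prod>j\<in>?I - i ` J. \<eta> j \<omega>)"
  proof (intro mult_left_mono)
    have "(\<Prod>j\<in>?I - i ` J. L') \<le> (\<Prod>j\<in>?I - i ` J. \<eta> j \<omega>)"
      using I(3) L by (intro prod_mono) (auto intro: less_imp_le)
    then show "L' ^ m \<le> (\<Prod>j\<in>?I - i ` J. \<eta> j \<omega>)" by (simp add: cardm')
  qed (use pos in \<open>simp add: prod_nonneg less_imp_le\<close>)
  also have "\<dots> = (\<Prod>j\<in>?I. \<eta> j \<omega>)"
    using iJ I(1) by (subst prod.subset_diff[of "i ` J" ?I]) (auto simp: mult.commute)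
  finally have 2: "(\<Prod>j\<in>i ` J. \<eta> j \<omega>) * L' ^ m \<le> (\<Prod>j\<in>?I. \<eta> j \<omega>)" .
  have P: "0 \<le> (\<Prod>j\<in>?I. \<eta> j \<omega>)" using pos by (simp add: prod_nonneg less_imp_le)
  have L': "0 < L'" using L by simp
  have "(\<Prod>j\<in>i ` J. \<eta> j \<omega>) * L ^ m = ((\<Prod>j\<in>i ` J. \<eta> j \<omega>) * L' ^ m) * (L / L') ^ m"
    using L' by (simp add: power_divide)
  also have "\<dots> \<le> (\<Prod>j\<in>?I. \<eta> j \<omega>) * (L / L') ^ m"
    using 2 L L' by (intro mult_right_mono) auto
  finally have 3: "(\<Prod>l<k. \<eta> (i l) \<omega>) \<le> (\<Prod>j\<in>?I. \<eta> j \<omega>) * (L / L') ^ m" using 1 by linarith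
  have "(L / L') ^ m \<le> (if s \<in> (\<Inter>j\<in>?I. S j \<omega>) then 1 else L / L')"
  proof (cases "m = 0")
    case True
    then have "i ` J = ?I" using cardm' I(1) iJ by auto
    then have "s \<in> (\<Inter>j\<in>i ` J. S j \<omega>) \<longleftrightarrow> s \<in> (\<Inter>j\<in>?I. S j \<omega>)" by simp
    moreover have "s \<in> (\<Inter>j\<in>i ` J. S j \<omega>)" using s J by auto
    ultimately have "s \<in> (\<Inter>j\<in>?I. S j \<omega>)" by blast
    then show ?thesis using True by simp
  next
    case False
    have "(L / L') ^ m \<le> (L / L') ^ 1" using False L L' by (intro power_decreasing) auto
    moreover have "L / L' \<le> 1" using L L' by simp
    ultimately show ?thesis by auto
  qed
  then have "(\<Prod>j\<in>?I. \<eta> j \<omega>) * (L / L') ^ m \<le> (\<Prod>j\<in>?I. \<eta> j \<omega>) * (if s \<in> (\<Inter>j\<in>?I. S j \<omega>) then 1 else L / L')"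
    using P by (rule mult_left_mono)
  with 3 show ?thesis by linarith
qed

lemma good_structure:
  assumes \<omega>: "\<omega> \<in> good L L' c" and L: "0 < L" "L \<le> L'"
  defines "I \<equiv> big_indices L \<omega>" and "P \<equiv> (\<Prod>j\<in>big_indices L \<omega>. \<eta> j \<omega>)"
  shows "finite I" "card I = k" "\<And>i. i \<in> I \<Longrightarrow> Z i \<omega> \<in> big_zero L'" "c < P"
    and "\<And>s. s \<le> t \<Longrightarrow> s \<in> (\<Inter>i\<in>I. S i \<omega>) \<Longrightarrow> X s \<omega> = P"
    and "\<And>s. s \<le> t \<Longrightarrow> s \<notin> (\<Inter>i\<in>I. S i \<omega>) \<Longrightarrow> X s \<omega> \<le> P * (L / L')"
    and "X 0 \<omega> = P"
proof -
  have sp: "\<omega> \<in> space M" and cnt: "point_count Z (big_hitting t L) \<omega> = of_nat k"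
    using \<omega> by (auto simp: tuple_event_def)
  obtain i where i: "i \<in> distinct_tuples k" "\<And>l. l < k \<Longrightarrow> Z (i l) \<omega> \<in> big_zero L'"
    "c < (\<Prod>l<k. \<eta> (i l) \<omega>)" using \<omega> by (auto simp: tuple_event_def)
  show I: "finite I" "card I = k"
    using cnt by (auto simp: point_count_eq_of_nat_iff I_def big_indices_def)
  have bij: "bij_betw i {..<k} I"
    using i big_zero_subset[OF L(2)]
    by (intro distinct_tuples_onto(3)[OF I]) (auto simp: I_def big_indices_def)
  show D: "Z j \<omega> \<in> big_zero L'" if "j \<in> I" for j
  proof -
    have "j \<in> i ` {..<k}" using bij that by (simp add: bij_betw_def)
    then show ?thesis using i(2) by auto
  qed
  have prodP: "(\<Prod>l<k. \<eta> (i l) \<omega>) = P"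
    unfolding P_def I_def[symmetric] by (rule prod.reindex_bij_betw[OF bij])
  then show cP: "c < P" using i(3) by simp
  have pos: "0 < \<eta> j \<omega>" for j using point_in_space(1)[OF sp] .
  have P0: "0 \<le> P" unfolding P_def using pos by (simp add: prod_nonneg less_imp_le)
  have L': "0 < L'" using L by simp
  have big: "L' < \<eta> j \<omega>" "0 \<in> S j \<omega>" if "j \<in> I" for j
    using D[OF that] point_in_big_zero_iff[OF sp L'] by auto
  have upper: "X s \<omega> \<le> P * (if s \<in> (\<Inter>i\<in>I. S i \<omega>) then 1 else L / L')"
    "(\<Squnion>i\<in>distinct_tuples k. ennreal ((\<Prod>j<k. \<eta> (i j) \<omega>) * (\<Prod>j<k. indicator (S (i j) \<omega>) s)))
      \<le> ennreal (P * (if s \<in> (\<Inter>i\<in>I. S i \<omega>) then 1 else L / L'))" if s: "s \<le> t" for s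
  proof -
    let ?b = "P * (if s \<in> (\<Inter>i\<in>I. S i \<omega>) then 1 else L / L')"
    have b0: "0 \<le> ?b" using P0 L L' by auto
    show sup: "(\<Squnion>i\<in>distinct_tuples k. ennreal ((\<Prod>j<k. \<eta> (i j) \<omega>) * (\<Prod>j<k. indicator (S (i j) \<omega>) s))) \<le> ennreal ?b"
    proof (intro SUP_least ennreal_leI)
      fix i' assume i': "i' \<in> distinct_tuples k"
      show "(\<Prod>j<k. \<eta> (i' j) \<omega>) * (\<Prod>j<k. indicator (S (i' j) \<omega>) s) \<le> ?b"
      proof (cases "\<forall>l<k. s \<in> S (i' l) \<omega>")
        case True
        then have "(\<Prod>j<k. indicator (S (i' j) \<omega>) s) = (1::real)" by (intro prod.neutral) auto
        moreover have "(\<Prod>j<k. \<eta> (i' j) \<omega>) \<le> ?b"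
          unfolding P_def I_def
          using tuple_product_le[OF sp L I[unfolded I_def] _ i' s] big(1) True
          by (auto simp: I_def)
        ultimately show ?thesis by simp
      next
        case False
        then obtain l where "l < k" "s \<notin> S (i' l) \<omega>" by auto
        then have "(\<Prod>j<k. indicator (S (i' j) \<omega>) s) = (0::real)"
          by (intro prod_zero) (auto intro!: bexI[of _ l])
        then show ?thesis using b0 by (simp only: mult_zero_right)
      qed
    qed
    show "X s \<omega> \<le> ?b"
      unfolding tuple_process_def using enn2real_mono[OF sup] b0 by simp
  qed
  show eq: "X s \<omega> = P" if s: "s \<le> t" "s \<in> (\<Inter>i\<in>I. S i \<omega>)" for s
  proof -
    have "(\<Prod>j<k. indicator (S (i j) \<omega>) s) = (1::real)"
      using s(2) bij by (intro prod.neutral) (auto simp: bij_betw_def)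
    then have "ennreal P \<le> (\<Squnion>i\<in>distinct_tuples k. ennreal ((\<Prod>j<k. \<eta> (i j) \<omega>) * (\<Prod>j<k. indicator (S (i j) \<omega>) s)))"
      using i(1) prodP by (intro SUP_upper2[of i]) auto
    with upper(2)[OF s(1)] s(2) have "(\<Squnion>i\<in>distinct_tuples k. ennreal ((\<Prod>j<k. \<eta> (i j) \<omega>) * (\<Prod>j<k. indicator (S (i j) \<omega>) s))) = ennreal P"
      by (intro antisym) auto
    then show ?thesis using P0 by (simp add: tuple_process_def)
  qed
  show "X s \<omega> \<le> P * (L / L')" if "s \<le> t" "s \<notin> (\<Inter>i\<in>I. S i \<omega>)" for s
    using upper(1)[OF that(1)] that(2) by (simp only: if_False)
  show "X 0 \<omega> = P" using big(2) by (intro eq) auto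
qed

text \<open>
  Dropping the magnitudes that are at most \<open>L\<close> from a tuple whose product exceeds \<open>c\<close> leaves a tuple of \<open>j\<close> big
  points whose product exceeds \<open>c / L ^ (k - j)\<close>. The case \<open>j = 0\<close> is excluded by \<open>c \<ge> L ^ k\<close>.
\<close>

lemma exceedance_tuple:
  assumes \<omega>: "\<omega> \<in> space M" "c < X 0 \<omega>" and L: "1 \<le> L" "L ^ k \<le> c"
    and cnt: "point_count Z (big_hitting t L) \<omega> = of_nat n"
  obtains j i where "1 \<le> j" "j \<le> k" "j \<le> n" "i \<in> distinct_tuples j"
    "\<And>l. l < j \<Longrightarrow> Z (i l) \<omega> \<in> big_zero L" "c / L ^ (k - j) < (\<Prod>l<j. \<eta> (i l) \<omega>)"
proof -
  let ?sup = "\<Squnion>i\<in>distinct_tuples k. ennreal ((\<Prod>j<k. \<eta> (i j) \<omega>) * (\<Prod>j<k. indicator (S (i j) \<omega>) 0))"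
  have L0: "0 < L" "0 < L ^ k" using L by auto
  then have c0: "0 < c" using L by linarith
  \<comment> \<open>The supremum may be infinite, in which case \<open>enn2real\<close> sends it to \<open>0\<close>; the bound holds all the same.\<close>
  have "ennreal c < ?sup"
  proof (cases ?sup)
    case (real r)
    then show ?thesis using \<omega>(2) c0 by (simp add: tuple_process_def ennreal_less_iff)
  next
    case top
    show ?thesis unfolding top by simp
  qed
  then obtain i where i: "i \<in> distinct_tuples k"
      "ennreal c < ennreal ((\<Prod>j<k. \<eta> (i j) \<omega>) * (\<Prod>j<k. indicator (S (i j) \<omega>) 0))"
    by (auto simp: less_SUP_iff)
  then have ic: "c < (\<Prod>j<k. \<eta> (i j) \<omega>) * (\<Prod>j<k. indicator (S (i j) \<omega>) 0)"
    using c0 by (simp add: ennreal_less_iff)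
  have S0: "0 \<in> S (i l) \<omega>" if "l < k" for l
  proof (rule ccontr)
    assume "0 \<notin> S (i l) \<omega>"
    then have "(\<Prod>j<k. indicator (S (i j) \<omega>) 0) = (0::real)" using that by (intro prod_zero) (auto intro!: bexI[of _ l])
    then show False using ic c0 by (simp only: mult_zero_right less_asym)
  qed
  then have "(\<Prod>j<k. indicator (S (i j) \<omega>) 0) = (1::real)" by (intro prod.neutral) auto
  with ic have ic: "c < (\<Prod>j<k. \<eta> (i j) \<omega>)" by simp
  define J where "J = {l\<in>{..<k}. L < \<eta> (i l) \<omega>}"
  define j where "j = card J"
  have J: "J \<subseteq> {..<k}" "finite J" by (auto simp: J_def)
  have jk: "j \<le> k" using card_mono[OF _ J(1)] by (simp add: j_def)
  have pos: "0 < \<eta> l \<omega>" for l using point_in_space(1)[OF \<omega>(1)] .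
  have "(\<Prod>l<k. \<eta> (i l) \<omega>) = (\<Prod>l\<in>J. \<eta> (i l) \<omega>) * (\<Prod>l\<in>{..<k} - J. \<eta> (i l) \<omega>)"
    using J by (subst prod.subset_diff[of J]) (auto simp: mult.commute)
  also have "(\<Prod>l\<in>{..<k} - J. \<eta> (i l) \<omega>) \<le> (\<Prod>l\<in>{..<k} - J. L)"
    using pos by (intro prod_mono) (auto simp: J_def intro: less_imp_le)
  also have "\<dots> = L ^ (k - j)" using J by (simp add: j_def card_Diff_subset)
  finally have "(\<Prod>l<k. \<eta> (i l) \<omega>) \<le> (\<Prod>l\<in>J. \<eta> (i l) \<omega>) * L ^ (k - j)"
    using pos by (simp add: mult_left_mono prod_nonneg less_imp_le)
  with ic have cJ: "c < (\<Prod>l\<in>J. \<eta> (i l) \<omega>) * L ^ (k - j)" by linarith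
  have j1: "1 \<le> j"
  proof (rule ccontr)
    assume "\<not> 1 \<le> j"
    then have "j = 0" by simp
    moreover from this have "J = {}" using J(2) by (simp add: j_def)
    ultimately have "J = {}" "j = 0" by simp_all
    then show False using cJ L by simp
  qed
  obtain e where e: "bij_betw e {..<j} J"
    using ex_bij_betw_nat_finite[OF J(2)] by (auto simp: j_def lessThan_atLeast0)
  define i' where "i' = (\<lambda>l\<in>{..<j}. i (e l))"
  have eJ: "e l \<in> J" if "l < j" for l using bij_betw_apply[OF e, of l] that by simp
  have inji: "inj_on i {..<k}" using i(1) by (simp add: distinct_tuples_def)
  have inj: "inj_on i' {..<j}"
  proof (rule inj_onI)
    fix l l' assume l: "l \<in> {..<j}" "l' \<in> {..<j}" "i' l = i' l'"
    then have "i (e l) = i (e l')" by (simp add: i'_def)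
    then have "e l = e l'" using inji eJ J(1) l by (auto dest!: inj_onD)
    then show "l = l'" using e l by (auto simp: bij_betw_def inj_on_def)
  qed
  have i'D: "Z (i' l) \<omega> \<in> big_zero L" if "l < j" for l
    using eJ[OF that] S0 that by (auto simp: i'_def J_def point_in_big_zero_iff[OF \<omega>(1) L0(1)])
  have "(\<Prod>l<j. \<eta> (i' l) \<omega>) = (\<Prod>l\<in>J. \<eta> (i l) \<omega>)"
    unfolding prod.reindex_bij_betw[OF e, symmetric] by (intro prod.cong) (auto simp: i'_def)
  then have prod: "c / L ^ (k - j) < (\<Prod>l<j. \<eta> (i' l) \<omega>)"
    using cJ L0 by (simp add: divide_less_eq)
  have "j \<le> n"
  proof -
    have I: "finite {i. Z i \<omega> \<in> big_hitting t L}" "card {i. Z i \<omega> \<in> big_hitting t L} = n"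
      using cnt by (auto simp: point_count_eq_of_nat_iff)
    have "card (i' ` {..<j}) \<le> card {i. Z i \<omega> \<in> big_hitting t L}"
      using i'D big_zero_subset[OF order_refl, of L] by (intro card_mono I) auto
    then show ?thesis using inj I by (simp add: card_image)
  qed
  then show thesis
    using j1 jk inj i'D prod by (intro that[of j i']) (auto simp: distinct_tuples_def i'_def)
qed

section \<open>Tail of the process at time zero\<close>

text \<open>
  The path divided by \<open>c\<close>, up to a small error, on \<open>good L L' c\<close>.
\<close>

definition profile :: "real \<Rightarrow> real \<Rightarrow> 'a \<Rightarrow> nat \<Rightarrow> real" where
  "profile L c \<omega> = (\<lambda>s. X 0 \<omega> / c * indicator (\<Inter>i\<in>big_indices L \<omega>. S i \<omega>) s)"

text \<open>
  The intensity of the \<open>j\<close>-tuples of points above \<open>L\<close> that contain \<open>0\<close> and have a product above \<open>c\<close>.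
\<close>

definition tuple_tail :: "nat \<Rightarrow> real \<Rightarrow> real \<Rightarrow> real" where
  "tuple_tail j L c = L powr (- \<alpha> * real j) *
     (\<integral>z. (if c < (\<Prod>l<j. fst (z l)) then 1 else 0) \<partial>(\<Pi>\<^sub>M l\<in>{..<j}. zero_law L))"

lemma pred_point_in: "A \<in> sets \<nu> \<Longrightarrow> Measurable.pred M (\<lambda>\<omega>. Z i \<omega> \<in> A)"
  using measurable_point by (rule pred_sets2[rotated])

lemma sets_tuple_event [measurable]:
  assumes "0 < L" "0 < L'" shows "tuple_event j L L' c n \<in> events"
proof -
  have "Measurable.pred M (\<lambda>\<omega>. \<exists>i\<in>distinct_tuples j.
      (\<forall>l<j. Z (i l) \<omega> \<in> big_zero L') \<and> c < (\<Prod>l<j. \<eta> (i l) \<omega>))"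
    using assms by (intro pred_ex_distinct_tuple pred_intros_logic pred_tuple_in sets_big_zero) measurable
  with pred_point_count_eq[OF sets_big_hitting[OF assms(1)], of t n]
  show ?thesis unfolding tuple_event_def pred_def by (simp add: sets.sets_Collect_conj)
qed

lemma measurable_profile [measurable]:
  assumes "0 < L" shows "profile L c \<in> borel_measurable M"
proof (rule measurable_coordinatewise_then_product)
  fix s
  have "Measurable.pred M (\<lambda>\<omega>. \<forall>i. Z i \<omega> \<in> big_hitting t L \<longrightarrow> s \<in> S i \<omega>)"
    using pred_point_in[OF sets_big_hitting[OF assms]] by measurable
  moreover have "(\<lambda>\<omega>. profile L c \<omega> s) =
      (\<lambda>\<omega>. X 0 \<omega> / c * (if \<forall>i. Z i \<omega> \<in> big_hitting t L \<longrightarrow> s \<in> S i \<omega> then 1 else 0))"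
    by (auto simp: profile_def big_indices_def indicator_def fun_eq_iff)
  ultimately show "(\<lambda>\<omega>. profile L c \<omega> s) \<in> borel_measurable M" by simp
qed

lemma emeasure_big_hitting_finite: "0 < L \<Longrightarrow> emeasure \<nu> (big_hitting t L) < \<infinity>"
proof -
  have "emeasure \<mu> (hitting t) < \<infinity>"
    using emeasure_\<mu>_hitting[of t] by (rule le_less_trans) (simp add: of_nat_less_top)
  then show "0 < L \<Longrightarrow> emeasure \<nu> (big_hitting t L) < \<infinity>"
    by (simp add: emeasure_\<nu>_big_hitting ennreal_mult_less_top)
qed

lemma emeasure_big_hitting_neq_0: "0 < L \<Longrightarrow> emeasure \<nu> (big_hitting t L) \<noteq> 0"
proof -
  have "1 \<le> emeasure \<mu> (hitting t)"
    using emeasure_mono[OF hitting_mono[of 0 t], of \<mu>] emeasure_\<mu>_hitting_0 by simp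
  then show "0 < L \<Longrightarrow> emeasure \<nu> (big_hitting t L) \<noteq> 0"
    by (auto simp: emeasure_\<nu>_big_hitting)
qed

lemma measure_big_hitting_le:
  assumes "0 < L" shows "measure \<nu> (big_hitting t L) \<le> (real t + 1) * L powr - \<alpha>"
proof -
  have "emeasure \<nu> (big_hitting t L) \<le> ennreal (L powr - \<alpha>) * ennreal (real t + 1)"
    unfolding emeasure_\<nu>_big_hitting[OF assms] using emeasure_\<mu>_hitting[of t]
    by (intro mult_left_mono) (simp_all add: ennreal_of_nat_eq_real_of_nat add.commute)
  also have "\<dots> = ennreal ((real t + 1) * L powr - \<alpha>)" by (simp add: ennreal_mult' mult.commute)
  finally show ?thesis unfolding measure_def by (intro enn2real_leI) auto
qed

text \<open>
  On \<open>good L L' c\<close> the big points are exactly the entries of any admissible tuple. The functional is symmetric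
  in them, so the indicator of the event times the functional is the sum over tuples divided by \<open>k!\<close>.
\<close>

lemma nn_integral_good:
  fixes F :: "(nat \<Rightarrow> real) \<Rightarrow> real"
  assumes F: "F \<in> borel_measurable borel" "\<And>y. 0 \<le> F y" "\<And>y. F y \<le> Mf" and L: "0 < L" "L \<le> L'"
  shows "(\<integral>\<^sup>+\<omega>. indicator (good L L' c) \<omega> * ennreal (F (profile L c \<omega>)) \<partial>M) =
    ennreal (exp (- measure \<nu> (big_hitting t L)) / fact k * (L' powr (- \<alpha> * real k) *
      (\<integral>z. (if c < (\<Prod>l<k. fst (z l)) then
          F (\<lambda>s. (\<Prod>l<k. fst (z l)) / c * indicator (\<Inter>l\<in>{..<k}. (\<lambda>l\<in>{..<k}. snd (z l)) l) s) else 0)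
        \<partial>(\<Pi>\<^sub>M l\<in>{..<k}. zero_law L'))))"
proof -
  let ?B = "big_hitting t L" and ?D = "big_zero L'" and ?Q = "\<Pi>\<^sub>M l\<in>{..<k}. zero_law L'"
  let ?cnt = "\<lambda>\<omega>. indicator {\<omega>. point_count Z ?B \<omega> = of_nat k} \<omega> :: ennreal"
  define h where "h z = (if c < (\<Prod>l<k. fst (z l)) then
      F (\<lambda>s. (\<Prod>l<k. fst (z l)) / c * indicator (\<Inter>l\<in>{..<k}. (\<lambda>l\<in>{..<k}. snd (z l)) l) s) else 0)"
    for z :: "nat \<Rightarrow> real \<times> nat set"
  have L': "0 < L'" using L by simp
  have DB: "?D \<subseteq> ?B" by (rule big_zero_subset[OF L(2)])
  have h: "h \<in> borel_measurable (\<Pi>\<^sub>M l\<in>{..<k}. \<nu>)"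
    unfolding h_def by (rule measurable_tuple_functional[OF measurable_profile_functional[OF F(1)]])
  have Mf: "0 \<le> Mf" using F(2)[of undefined] F(3)[of undefined] by linarith
  have h0: "0 \<le> h z" "h z \<le> Mf" for z using F Mf by (auto simp: h_def)
  have path: "?cnt \<omega> * tuple_sum k (\<lambda>_. ?D) (\<lambda>z. ennreal (h z)) \<omega> =
      fact k * (indicator (good L L' c) \<omega> * ennreal (F (profile L c \<omega>)))" if \<omega>: "\<omega> \<in> space M" for \<omega>
  proof (cases "point_count Z ?B \<omega> = of_nat k")
    case False
    then show ?thesis by (auto simp: tuple_event_def)
  next
    case cnt: True
    let ?I = "big_indices L \<omega>"
    have I: "finite ?I" "card ?I = k"
      using cnt by (auto simp: point_count_eq_of_nat_iff big_indices_def)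
    show ?thesis
    proof (cases "\<forall>i. Z i \<omega> \<in> ?B \<longrightarrow> Z i \<omega> \<in> ?D")
      case False
      then obtain i where i: "Z i \<omega> \<in> ?B" "Z i \<omega> \<notin> ?D" by auto
      have "\<omega> \<notin> good L L' c"
        using good_structure(3)[of \<omega> L L' c i] i L by (auto simp: big_indices_def)
      moreover have "tuple_sum k (\<lambda>_. ?D) (\<lambda>z. ennreal (h z)) \<omega> = 0"
        by (rule tuple_sum_eq_0[OF cnt DB i])
      ultimately show ?thesis by simp
    next
      case True
      define P where "P = (\<Prod>j\<in>?I. \<eta> j \<omega>)"
      define v where "v = (if c < P then F (\<lambda>s. P / c * indicator (\<Inter>i\<in>?I. S i \<omega>) s) else 0)"
      have "tuple_sum k (\<lambda>_. ?D) (\<lambda>z. ennreal (h z)) \<omega> = fact k * ennreal v"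
      proof (rule tuple_sum_symmetric[OF cnt DB])
        fix i assume "bij_betw i {..<k} {i. Z i \<omega> \<in> ?B}"
        then have bij: "bij_betw i {..<k} ?I" by (simp add: big_indices_def)
        have "(\<Prod>l<k. fst ((\<lambda>l\<in>{..<k}. Z (i l) \<omega>) l)) = P"
          unfolding P_def prod.reindex_bij_betw[OF bij, symmetric] by (intro prod.cong) auto
        moreover have "(\<Inter>l\<in>{..<k}. (\<lambda>l\<in>{..<k}. snd ((\<lambda>l\<in>{..<k}. Z (i l) \<omega>) l)) l) = (\<Inter>j\<in>?I. S j \<omega>)"
          unfolding bij_betw_imp_surj_on[OF bij, symmetric] by auto
        ultimately show "ennreal (h (\<lambda>l\<in>{..<k}. Z (i l) \<omega>)) = ennreal v"
          unfolding h_def v_def by simp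
      qed (use True in auto)
      moreover have gd: "\<omega> \<in> good L L' c \<longleftrightarrow> c < P"
      proof
        assume "\<omega> \<in> good L L' c"
        then show "c < P" unfolding P_def by (rule good_structure(4)[OF _ L])
      next
        assume cP: "c < P"
        obtain i where i: "i \<in> distinct_tuples k" "\<forall>l<k. i l \<in> ?I"
        proof -
          have "{i \<in> distinct_tuples k. \<forall>l<k. i l \<in> ?I} \<noteq> {}"
            using distinct_tuples_onto(1)[OF I] by (metis card.empty fact_nonzero)
          then show ?thesis using that by auto
        qed
        have bij: "bij_betw i {..<k} ?I" by (rule distinct_tuples_onto(3)[OF I i])
        have "(\<Prod>l<k. \<eta> (i l) \<omega>) = P" unfolding P_def by (rule prod.reindex_bij_betw[OF bij])
        then show "\<omega> \<in> good L L' c"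
          using \<omega> cnt i True cP unfolding tuple_event_def by (auto simp: big_indices_def intro!: bexI[of _ i])
      qed
      moreover have "indicator (good L L' c) \<omega> * ennreal (F (profile L c \<omega>)) = ennreal v"
      proof (cases "c < P")
        case True
        then have "\<omega> \<in> good L L' c" using gd by simp
        then have "X 0 \<omega> = P" unfolding P_def by (rule good_structure(7)[OF _ L])
        then show ?thesis using True gd by (simp add: v_def profile_def)
      qed (use gd in \<open>simp add: v_def\<close>)
      ultimately show ?thesis using cnt by simp
    qed
  qed
  have meas: "(\<lambda>\<omega>. indicator (good L L' c) \<omega> * ennreal (F (profile L c \<omega>))) \<in> borel_measurable M"
    using sets_tuple_event[OF L(1) L'] measurable_compose[OF measurable_profile[OF L(1)] F(1)]
    by (intro borel_measurable_times_ennreal measurable_compose[OF _ measurable_ennreal]) auto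
  interpret Q: prob_space ?Q by (intro prob_space_PiM prob_space_zero_law L')
  have sQ: "sets ?Q = sets (\<Pi>\<^sub>M l\<in>{..<k}. \<nu>)" by (intro sets_PiM_cong) auto
  have hQ: "h \<in> borel_measurable ?Q" using h by (simp add: measurable_cong_sets[OF sQ refl])
  have "fact k * (\<integral>\<^sup>+\<omega>. indicator (good L L' c) \<omega> * ennreal (F (profile L c \<omega>)) \<partial>M) =
      (\<integral>\<^sup>+\<omega>. ?cnt \<omega> * tuple_sum k (\<lambda>_. ?D) (\<lambda>z. ennreal (h z)) \<omega> \<partial>M)"
    unfolding nn_integral_cmult[OF meas, symmetric] using path by (intro nn_integral_cong) auto
  also have "\<dots> = ennreal (exp (- measure \<nu> ?B) * (\<Prod>l<k. L' powr - \<alpha>)) * (\<integral>\<^sup>+z. ennreal (h z) \<partial>?Q)"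
    using DB h
    by (intro nn_integral_tuple_sum sets_big_hitting sets_big_zero emeasure_big_hitting_finite
        prob_space_zero_law L L' sets_zero_law emeasure_\<nu>_big_zero measurable_compose[OF _ measurable_ennreal]) auto
  also have "(\<integral>\<^sup>+z. ennreal (h z) \<partial>?Q) = ennreal (\<integral>z. h z \<partial>?Q)"
    using h0 hQ by (intro nn_integral_eq_integral Q.integrable_const_bound[where B = Mf]) auto
  also have "(\<Prod>l<k. L' powr - \<alpha>) = L' powr (- \<alpha> * real k)"
    using L' by (simp add: powr_realpow[symmetric] powr_powr)
  also have "ennreal (exp (- measure \<nu> ?B) * L' powr (- \<alpha> * real k)) * ennreal (\<integral>z. h z \<partial>?Q) =
     ennreal (exp (- measure \<nu> ?B) * L' powr (- \<alpha> * real k) * (\<integral>z. h z \<partial>?Q))"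
    by (simp add: ennreal_mult')
  also have "\<dots> = fact k * ennreal (exp (- measure \<nu> ?B) / fact k * (L' powr (- \<alpha> * real k) * (\<integral>z. h z \<partial>?Q)))"
  proof -
    have "exp (- measure \<nu> ?B) * L' powr (- \<alpha> * real k) * (\<integral>z. h z \<partial>?Q) =
      fact k * (exp (- measure \<nu> ?B) / fact k * (L' powr (- \<alpha> * real k) * (\<integral>z. h z \<partial>?Q)))" by simp
    moreover have "(fact k :: ennreal) = ennreal (fact k)"
      by (metis ennreal_of_nat_eq_real_of_nat of_nat_fact)
    ultimately show ?thesis by (simp only: ennreal_mult' fact_ge_zero)
  qed
  finally have "fact k * (\<integral>\<^sup>+\<omega>. indicator (good L L' c) \<omega> * ennreal (F (profile L c \<omega>)) \<partial>M) =
     fact k * ennreal (exp (- measure \<nu> ?B) / fact k * (L' powr (- \<alpha> * real k) * (\<integral>z. h z \<partial>?Q)))" .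
  then show ?thesis
    unfolding h_def[symmetric]
    by (subst (asm) ennreal_mult_cancel_left) (metis ennreal_of_nat_neq_top fact_nonzero of_nat_fact)
qed

lemma prob_good:
  assumes L: "0 < L" "L \<le> L'"
  shows "prob (good L L' c) = exp (- measure \<nu> (big_hitting t L)) / fact k * tuple_tail k L' c"
proof -
  have L': "0 < L'" using L by simp
  have "emeasure M (good L L' c) = (\<integral>\<^sup>+\<omega>. indicator (good L L' c) \<omega> * ennreal 1 \<partial>M)"
    using sets_tuple_event[OF L(1) L'] by simp
  also have "\<dots> = ennreal (exp (- measure \<nu> (big_hitting t L)) / fact k * tuple_tail k L' c)"
    unfolding tuple_tail_def using nn_integral_good[of "\<lambda>_. 1" 1 L L' c] L by simp
  finally show ?thesis
    unfolding measure_def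
    by (simp add: tuple_tail_def enn2real_ennreal)
qed

lemma tuple_tail_nonneg: "0 \<le> tuple_tail j L c" by (simp add: tuple_tail_def)

lemma tuple_tail_asymptotics:
  assumes "1 \<le> L" "1 \<le> j"
  shows "((\<lambda>c. tuple_tail j L c / tail_rate \<alpha> j c) \<longlongrightarrow> 1) at_top"
proof -
  have "(\<integral>v. (\<integral>u. 1 \<partial>(\<Pi>\<^sub>M l\<in>{..<j}. R)) \<partial>exp_law \<alpha>) = (1::real)"
    using prob_space.prob_space[OF prob_space_PiM[of "{..<j}" "\<lambda>_. R"]] prob_space_R
      prob_space.prob_space[OF prob_space_exp_law[OF \<alpha>]] by simp
  then show ?thesis
    unfolding tuple_tail_def
    using tuple_integral_asymptotics[OF assms, of "\<lambda>_ _. 1" 1] by simp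
qed

lemma emeasure_tuple_event_le:
  assumes L: "0 < L" and "j \<le> n"
  shows "emeasure M (tuple_event j L L c n) \<le> ennreal (measure \<nu> (big_hitting t L) ^ (n - j) * tuple_tail j L c)"
proof -
  let ?B = "big_hitting t L" and ?V = "\<Pi>\<^sub>M l\<in>{..<j}. \<nu>" and ?Q = "\<Pi>\<^sub>M l\<in>{..<j}. zero_law L"
  define A where "A = {z\<in>space ?V. c < (\<Prod>l<j. fst (z l))}"
  define E where "E = {\<omega>\<in>space M. point_count Z ?B \<omega> = of_nat n \<and>
      (\<exists>i\<in>distinct_tuples j. (\<forall>l<j. Z (i l) \<omega> \<in> big_zero L) \<and> (\<lambda>l\<in>{..<j}. Z (i l) \<omega>) \<in> A)}"
  have sQ: "sets ?Q = sets ?V" by (intro sets_PiM_cong) auto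
  have A: "A \<in> sets ?V"
  proof -
    have "(\<lambda>z. if c < (\<Prod>l<j. fst (z l)) then 1 else (0::real)) \<in> borel_measurable ?V"
      using measurable_tuple_functional[of "\<lambda>_ _. 1" j c] by simp
    from measurable_sets[OF this, of "{1::real}"]
    have "(\<lambda>z. if c < (\<Prod>l<j. fst (z l)) then 1 else (0::real)) -` {1::real} \<inter> space ?V \<in> sets ?V" by simp
    also have "(\<lambda>z. if c < (\<Prod>l<j. fst (z l)) then 1 else (0::real)) -` {1::real} \<inter> space ?V = A"
      by (auto simp: A_def split: if_splits)
    finally show ?thesis .
  qed
  have "tuple_event j L L c n \<subseteq> E"
  proof
    fix \<omega> assume "\<omega> \<in> tuple_event j L L c n"
    then obtain i where i: "\<omega> \<in> space M" "point_count Z ?B \<omega> = of_nat n" "i \<in> distinct_tuples j"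
      "\<forall>l<j. Z (i l) \<omega> \<in> big_zero L" "c < (\<Prod>l<j. \<eta> (i l) \<omega>)" by (auto simp: tuple_event_def)
    have "(\<lambda>l\<in>{..<j}. Z (i l) \<omega>) \<in> space ?V" using measurable_space[OF measurable_tuple_at i(1)] .
    with i(5) have "(\<lambda>l\<in>{..<j}. Z (i l) \<omega>) \<in> A" by (simp add: A_def)
    with i show "\<omega> \<in> E" unfolding E_def by blast
  qed
  moreover have "E \<in> events"
  proof -
    have "Measurable.pred M (\<lambda>\<omega>. \<exists>i\<in>distinct_tuples j. (\<forall>l<j. Z (i l) \<omega> \<in> big_zero L) \<and> (\<lambda>l\<in>{..<j}. Z (i l) \<omega>) \<in> A)"
      by (intro pred_ex_distinct_tuple pred_intros_logic pred_tuple_in sets_big_zero L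
          pred_sets2[OF A measurable_tuple_at])
    with pred_point_count_eq[OF sets_big_hitting[OF L], of t n]
    show ?thesis unfolding E_def pred_def by (simp add: sets.sets_Collect_conj)
  qed
  ultimately have "emeasure M (tuple_event j L L c n) \<le> emeasure M E"
    by (rule emeasure_mono)
  also have "\<dots> \<le> ennreal (measure \<nu> ?B ^ (n - j) * (L powr - \<alpha>) ^ j * measure ?Q A)"
    unfolding E_def using A \<open>j \<le> n\<close> big_zero_subset[OF order_refl, of L]
    by (intro prob_exists_tuple_le sets_big_hitting sets_big_zero emeasure_big_hitting_finite
        emeasure_big_hitting_neq_0 prob_space_zero_law L sets_zero_law emeasure_\<nu>_big_zero) auto
  also have "measure \<nu> ?B ^ (n - j) * (L powr - \<alpha>) ^ j * measure ?Q A = measure \<nu> ?B ^ (n - j) * tuple_tail j L c"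
  proof -
    have "measure ?Q A = (\<integral>z. indicator A z \<partial>?Q)"
    proof -
      have "A \<inter> space ?Q = A" using sets_eq_imp_space_eq[OF sQ] by (auto simp: A_def)
      then show ?thesis by simp
    qed
    also have "\<dots> = (\<integral>z. (if c < (\<Prod>l<j. fst (z l)) then 1 else 0) \<partial>?Q)"
      by (intro Bochner_Integration.integral_cong refl) (auto simp: A_def sets_eq_imp_space_eq[OF sQ])
    finally show ?thesis
      using L by (simp add: tuple_tail_def powr_realpow[symmetric] powr_powr)
  qed
  finally show ?thesis .
qed

text \<open>
  Summation over the number of big points; \<open>m\<close> is the least number of big points outside the tuple.
\<close>

lemma emeasure_tuple_events_le:
  assumes L: "0 < L" and small: "measure \<nu> (big_hitting t L) \<le> 1 / 2"
  shows "emeasure M (\<Union>n. tuple_event j L L c (j + m + n)) \<le>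
    ennreal (2 * measure \<nu> (big_hitting t L) ^ m * tuple_tail j L c)"
proof -
  let ?q = "measure \<nu> (big_hitting t L)"
  have "emeasure M (\<Union>n. tuple_event j L L c (j + m + n)) \<le> (\<Sum>n. emeasure M (tuple_event j L L c (j + m + n)))"
    using L by (intro emeasure_subadditive_countably) auto
  also have "\<dots> \<le> (\<Sum>n. ennreal (?q ^ m * tuple_tail j L c * ?q ^ n))"
  proof (intro suminf_le summableI)
    fix n
    show "emeasure M (tuple_event j L L c (j + m + n)) \<le> ennreal (?q ^ m * tuple_tail j L c * ?q ^ n)"
      using emeasure_tuple_event_le[OF L, of j "j + m + n" c] by (simp add: power_add mult_ac)
  qed
  also have "\<dots> = ennreal (\<Sum>n. ?q ^ m * tuple_tail j L c * ?q ^ n)"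
    using small tuple_tail_nonneg by (intro suminf_ennreal2 summable_mult summable_geometric) auto
  also have "\<dots> \<le> ennreal (2 * ?q ^ m * tuple_tail j L c)"
  proof (rule ennreal_leI)
    have "(\<Sum>n. ?q ^ m * tuple_tail j L c * ?q ^ n) = ?q ^ m * tuple_tail j L c * (1 / (1 - ?q))"
      using small by (subst suminf_mult) (auto simp: suminf_geometric intro!: summable_geometric)
    also have "\<dots> \<le> ?q ^ m * tuple_tail j L c * 2"
      using small tuple_tail_nonneg by (intro mult_left_mono) (auto simp: field_simps)
    finally show "(\<Sum>n. ?q ^ m * tuple_tail j L c * ?q ^ n) \<le> 2 * ?q ^ m * tuple_tail j L c"
      by (simp add: mult_ac)
  qed
  finally show ?thesis .
qed

text \<open>
  An exceedance outside \<open>good L L c\<close> is due either to \<open>k\<close> big points in the presence of another one or to fewer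
  than \<open>k\<close> big points that contain \<open>0\<close> in the tuple.
\<close>

lemma prob_exceedance_le:
  assumes L: "1 \<le> L" and c: "L ^ k \<le> c" and small: "measure \<nu> (big_hitting t L) \<le> 1 / 2"
  shows "prob {\<omega>\<in>space M. c < X 0 \<omega>} \<le> prob (good L L c) +
    2 * measure \<nu> (big_hitting t L) * tuple_tail k L c +
    (\<Sum>j\<in>{1..<k}. 2 * tuple_tail j L (c / L ^ (k - j)))"
proof -
  have L0: "0 < L" using L by simp
  let ?B = "big_hitting t L"
  define U where "U j m c = (\<Union>n. tuple_event j L L c (j + m + n))" for j m c
  have Uev: "U j m c \<in> events" for j m c unfolding U_def using L0 by (intro sets.countable_UN) auto
  have U: "prob (U j m c) \<le> 2 * measure \<nu> ?B ^ m * tuple_tail j L c" for j m c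
    using emeasure_tuple_events_le[OF L0 small, of j c m] tuple_tail_nonneg[of j L c]
    unfolding emeasure_eq_measure U_def[symmetric] by (subst (asm) ennreal_le_iff) auto
  have gev: "good L L c \<in> events" using L0 by simp
  have "prob {\<omega>\<in>space M. c < X 0 \<omega>} \<le>
      prob (good L L c \<union> U k 1 c \<union> (\<Union>j\<in>{1..<k}. U j 0 (c / L ^ (k - j))))"
  proof (rule finite_measure_mono_AE)
    show "good L L c \<union> U k 1 c \<union> (\<Union>j\<in>{1..<k}. U j 0 (c / L ^ (k - j))) \<in> events"
      using gev Uev by (intro sets.Un sets.finite_UN) auto
    show "AE \<omega> in M. \<omega> \<in> {\<omega>\<in>space M. c < X 0 \<omega>} \<longrightarrow>
        \<omega> \<in> good L L c \<union> U k 1 c \<union> (\<Union>j\<in>{1..<k}. U j 0 (c / L ^ (k - j)))"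
      using AE_finite_point_count[OF sets_big_hitting[OF L0] emeasure_big_hitting_finite[OF L0]]
    proof eventually_elim
      case (elim \<omega>)
      then obtain n where n: "point_count Z ?B \<omega> = of_nat n" by auto
      show ?case
      proof
        assume "\<omega> \<in> {\<omega>\<in>space M. c < X 0 \<omega>}"
        then have \<omega>: "\<omega> \<in> space M" "c < X 0 \<omega>" by auto
        obtain j i where ji: "1 \<le> j" "j \<le> k" "j \<le> n" "i \<in> distinct_tuples j"
          "\<And>l. l < j \<Longrightarrow> Z (i l) \<omega> \<in> big_zero L" "c / L ^ (k - j) < (\<Prod>l<j. \<eta> (i l) \<omega>)"
          by (rule exceedance_tuple[OF \<omega> L c n]) blast
        have ev: "\<omega> \<in> tuple_event j L L (c / L ^ (k - j)) n"
          using \<omega> n ji by (auto simp: tuple_event_def)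
        consider "j < k" | "j = k" "n = k" | "j = k" "k < n" using ji by linarith
        then show "\<omega> \<in> good L L c \<union> U k 1 c \<union> (\<Union>j\<in>{1..<k}. U j 0 (c / L ^ (k - j)))"
        proof cases
          case 1
          have "\<omega> \<in> tuple_event j L L (c / L ^ (k - j)) (j + 0 + (n - j))" using ev ji by simp
          then have "\<omega> \<in> U j 0 (c / L ^ (k - j))" unfolding U_def by blast
          then show ?thesis using 1 ji by (intro UnI2 UN_I[of j]) auto
        next
          case 2
          then have "\<omega> \<in> good L L c" using ev by (auto simp: tuple_event_def)
          then show ?thesis by blast
        next
          case 3
          have "\<omega> \<in> tuple_event k L L c (k + 1 + (n - k - 1))" using ev 3 by simp
          then have "\<omega> \<in> U k 1 c" unfolding U_def by blast
          then show ?thesis by blast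
        qed
      qed
    qed
  qed
  also have "\<dots> \<le> prob (good L L c \<union> U k 1 c) + prob (\<Union>j\<in>{1..<k}. U j 0 (c / L ^ (k - j)))"
    using gev Uev by (intro measure_Un_le sets.Un sets.finite_UN) auto
  also have "\<dots> \<le> (prob (good L L c) + prob (U k 1 c)) + (\<Sum>j\<in>{1..<k}. prob (U j 0 (c / L ^ (k - j))))"
    using gev Uev by (intro add_mono measure_Un_le finite_measure_subadditive_finite) auto
  also have "\<dots> \<le> (prob (good L L c) + 2 * measure \<nu> ?B * tuple_tail k L c) +
      (\<Sum>j\<in>{1..<k}. 2 * tuple_tail j L (c / L ^ (k - j)))"
    using U[of k 1 c] U[of _ 0] by (intro add_mono order_refl sum_mono) auto
  finally show ?thesis .
qed

lemma exists_small_intensity: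
  assumes "0 < e"
  obtains L where "1 \<le> L" "measure \<nu> (big_hitting t L) \<le> e"
proof -
  have "((\<lambda>L. (real t + 1) * L powr - \<alpha>) \<longlongrightarrow> (real t + 1) * 0) at_top"
    using \<alpha> by (intro tendsto_mult tendsto_const tendsto_neg_powr filterlim_ident) auto
  then have "\<forall>\<^sub>F L in at_top. (real t + 1) * L powr - \<alpha> < e"
    using assms by (intro order_tendstoD) auto
  with eventually_ge_at_top[of 1] have "\<forall>\<^sub>F L in at_top. 1 \<le> L \<and> measure \<nu> (big_hitting t L) \<le> e"
  proof eventually_elim
    case (elim L)
    then show ?case using measure_big_hitting_le[of L] by auto
  qed
  then obtain L where "1 \<le> L \<and> measure \<nu> (big_hitting t L) \<le> e"
    using eventually_happens'[OF trivial_limit_at_top_linorder] by blast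
  then show ?thesis using that by blast
qed

lemma exp_minus_over_fact_ge:
  assumes "0 \<le> q" shows "1 / fact k - q \<le> exp (- q) / (fact k :: real)"
proof -
  have "1 - q \<le> exp (- q)" using exp_ge_add_one_self[of "- q"] by simp
  moreover have "q / fact k \<le> q / 1"
    using assms by (intro divide_left_mono) (auto simp: fact_ge_1)
  ultimately show ?thesis
    by (smt (verit) diff_divide_distrib divide_right_mono fact_ge_zero div_by_1)
qed

lemma fewer_factors_negligible:
  assumes L: "1 \<le> L" and j: "1 \<le> j" "j < k"
  shows "((\<lambda>c. tuple_tail j L (c / L ^ (k - j)) / tail_rate \<alpha> k c) \<longlongrightarrow> 0) at_top"
proof -
  define b where "b = L ^ (k - j)"
  have b: "0 < b" "1 \<le> b" using L by (auto simp: b_def)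
  have fl: "filterlim (\<lambda>c. 1 / b * c) at_top at_top"
    using b by (intro filterlim_tendsto_pos_mult_at_top[OF tendsto_const] filterlim_ident) auto
  have "((\<lambda>c. tuple_tail j L (1 / b * c) / tail_rate \<alpha> j (1 / b * c) *
      (tail_rate \<alpha> j (1 / b * c) / tail_rate \<alpha> j c) * (tail_rate \<alpha> j c / tail_rate \<alpha> k c))
      \<longlongrightarrow> 1 * (1 / b) powr - \<alpha> * 0) at_top"
    using b \<alpha> j
    by (intro tendsto_mult filterlim_compose[OF tuple_tail_asymptotics[OF L j(1)] fl]
        tail_rate_scale tail_rate_less_factors) auto
  moreover have "\<forall>\<^sub>F c in at_top. tuple_tail j L (1 / b * c) / tail_rate \<alpha> j (1 / b * c) *
      (tail_rate \<alpha> j (1 / b * c) / tail_rate \<alpha> j c) * (tail_rate \<alpha> j c / tail_rate \<alpha> k c) =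
      tuple_tail j L (c / L ^ (k - j)) / tail_rate \<alpha> k c"
    using eventually_gt_at_top[of b]
  proof eventually_elim
    case (elim c)
    then have "1 < c" "1 < 1 / b * c" using b by auto
    then have "tail_rate \<alpha> j c \<noteq> 0" "tail_rate \<alpha> j (1 / b * c) \<noteq> 0"
      using tail_rate_pos[OF \<alpha>, of _ j] by (metis less_irrefl)+
    then show ?case by (simp add: b_def)
  qed
  ultimately show ?thesis by (auto intro: Lim_transform_eventually)
qed

lemma prob_good_asymptotics:
  assumes "1 \<le> L" "L \<le> L'"
  shows "((\<lambda>c. prob (good L L' c) / tail_rate \<alpha> k c) \<longlongrightarrow>
    exp (- measure \<nu> (big_hitting t L)) / fact k) at_top"
proof -
  have "((\<lambda>c. exp (- measure \<nu> (big_hitting t L)) / fact k * (tuple_tail k L' c / tail_rate \<alpha> k c)) \<longlongrightarrow>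
    exp (- measure \<nu> (big_hitting t L)) / fact k * 1) at_top"
    using assms k by (intro tendsto_mult tendsto_const tuple_tail_asymptotics) auto
  then show ?thesis using assms by (simp add: prob_good)
qed

lemma good_subset_exceedance:
  assumes "0 < L" "L \<le> L'" shows "good L L' c \<subseteq> {\<omega>\<in>space M. c < X 0 \<omega>}"
proof
  fix \<omega> assume \<omega>: "\<omega> \<in> good L L' c"
  then have "\<omega> \<in> space M" by (simp add: tuple_event_def)
  then show "\<omega> \<in> {\<omega>\<in>space M. c < X 0 \<omega>}"
    using good_structure(4,7)[OF \<omega> assms] by simp
qed

text \<open>
  For fixed \<open>L\<close> the bounds above and below differ by a multiple of \<open>q = measure \<nu> (big_hitting t L)\<close> in the limit,
  and \<open>q\<close> is as small as desired.
\<close>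

lemma prob_exceedance_asymptotics:
  "((\<lambda>c. prob {\<omega>\<in>space M. c < X 0 \<omega>} / tail_rate \<alpha> k c) \<longlongrightarrow> 1 / fact k) at_top"
proof (rule tendstoI)
  fix e :: real assume e: "0 < e"
  obtain L where L: "1 \<le> L" "measure \<nu> (big_hitting t L) \<le> min (1 / 2) (e / 4)"
    using exists_small_intensity[of "min (1 / 2) (e / 4)"] e by auto
  define q where "q = measure \<nu> (big_hitting t L)"
  have q: "0 \<le> q" "q \<le> 1 / 2" "q \<le> e / 4" using L by (auto simp: q_def)
  have L0: "0 < L" using L by simp
  let ?r = "tail_rate \<alpha> k"
  have low: "((\<lambda>c. prob (good L L c) / ?r c) \<longlongrightarrow> exp (- q) / fact k) at_top"
    unfolding q_def by (rule prob_good_asymptotics[OF L(1) order_refl])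
  have "((\<lambda>c. prob (good L L c) / ?r c + 2 * q * (tuple_tail k L c / ?r c) +
      (\<Sum>j\<in>{1..<k}. 2 * (tuple_tail j L (c / L ^ (k - j)) / ?r c))) \<longlongrightarrow>
      exp (- q) / fact k + 2 * q * 1 + (\<Sum>j\<in>{1..<k}. 2 * 0)) at_top"
    using L(1) k by (intro tendsto_add tendsto_mult tendsto_const tendsto_sum low
        tuple_tail_asymptotics fewer_factors_negligible) auto
  moreover have "exp (- q) / fact k + 2 * q * 1 + (\<Sum>j\<in>{1..<k}. 2 * 0) < 1 / fact k + e"
  proof -
    have "exp (- q) / fact k \<le> 1 / (fact k :: real)" using q by (intro divide_right_mono) auto
    then show ?thesis using q e by simp
  qed
  ultimately have up: "\<forall>\<^sub>F c in at_top. prob (good L L c) / ?r c + 2 * q * (tuple_tail k L c / ?r c) +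
      (\<Sum>j\<in>{1..<k}. 2 * (tuple_tail j L (c / L ^ (k - j)) / ?r c)) < 1 / fact k + e"
    by (rule order_tendstoD)
  have "1 / fact k - e < exp (- q) / (fact k :: real)"
    using exp_minus_over_fact_ge[OF q(1)] q e by linarith
  with low have "\<forall>\<^sub>F c in at_top. 1 / fact k - e < prob (good L L c) / ?r c"
    by (rule order_tendstoD)
  with up eventually_ge_at_top[of "L ^ k"] eventually_gt_at_top[of 1]
  show "\<forall>\<^sub>F c in at_top. dist (prob {\<omega>\<in>space M. c < X 0 \<omega>} / ?r c) (1 / fact k) < e"
  proof eventually_elim
    case (elim c)
    have r: "0 < ?r c" using elim by (intro tail_rate_pos \<alpha>) auto
    have "prob (good L L c) \<le> prob {\<omega>\<in>space M. c < X 0 \<omega>}"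
      using good_subset_exceedance[OF L0 order_refl] by (intro finite_measure_mono) auto
    then have "prob (good L L c) / ?r c \<le> prob {\<omega>\<in>space M. c < X 0 \<omega>} / ?r c"
      using r by (intro divide_right_mono) auto
    moreover have "prob {\<omega>\<in>space M. c < X 0 \<omega>} / ?r c \<le> (prob (good L L c) +
        2 * q * tuple_tail k L c + (\<Sum>j\<in>{1..<k}. 2 * tuple_tail j L (c / L ^ (k - j)))) / ?r c"
      using r q elim prob_exceedance_le[OF L(1), of c] unfolding q_def by (intro divide_right_mono) auto
    ultimately show ?case using elim
      by (simp add: dist_real_def abs_less_iff add_divide_distrib sum_divide_distrib)
  qed
qed

lemma prob_scaled_exceedance_asymptotics:
  assumes "0 < K"
  shows "((\<lambda>c. prob {\<omega>\<in>space M. K * c < X 0 \<omega>} / tail_rate \<alpha> k c) \<longlongrightarrow> 1 / fact k * K powr - \<alpha>) at_top"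
proof -
  have fl: "filterlim (\<lambda>c. K * c) at_top at_top"
    using assms by (intro filterlim_tendsto_pos_mult_at_top[OF tendsto_const] filterlim_ident) auto
  have "((\<lambda>c. prob {\<omega>\<in>space M. K * c < X 0 \<omega>} / tail_rate \<alpha> k (K * c) *
      (tail_rate \<alpha> k (K * c) / tail_rate \<alpha> k c)) \<longlongrightarrow> 1 / fact k * K powr - \<alpha>) at_top"
    using assms by (intro tendsto_mult filterlim_compose[OF prob_exceedance_asymptotics fl] tail_rate_scale \<alpha>)
  moreover have "\<forall>\<^sub>F c in at_top. prob {\<omega>\<in>space M. K * c < X 0 \<omega>} / tail_rate \<alpha> k (K * c) *
      (tail_rate \<alpha> k (K * c) / tail_rate \<alpha> k c) = prob {\<omega>\<in>space M. K * c < X 0 \<omega>} / tail_rate \<alpha> k c"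
    using eventually_gt_at_top[of "1 / K"]
  proof eventually_elim
    case (elim c)
    then have "1 < K * c" using assms by (simp add: field_simps)
    then have "tail_rate \<alpha> k (K * c) \<noteq> 0" using tail_rate_pos[OF \<alpha>, of "K * c" k] by simp
    then show ?case by simp
  qed
  ultimately show ?thesis by (auto intro: Lim_transform_eventually)
qed

section \<open>Functionals of the path given an exceedance\<close>

lemma profile_close:
  assumes \<omega>: "\<omega> \<in> good L L' c" and L: "0 < L" "L \<le> L'" and c: "0 < c" and K: "X 0 \<omega> \<le> K * c"
    and s: "s \<le> t"
  shows "0 \<le> X s \<omega> / c" "X s \<omega> / c \<le> K" "0 \<le> profile L c \<omega> s" "profile L c \<omega> s \<le> K"
    "\<bar>X s \<omega> / c - profile L c \<omega> s\<bar> \<le> K * (L / L')"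
proof -
  have X0: "X 0 \<omega> / c \<le> K" "0 \<le> X 0 \<omega> / c" using K c X_nonneg by (auto simp: divide_le_eq)
  have LL: "0 \<le> L / L'" "L / L' \<le> 1" using L by auto
  have KLL: "0 \<le> K * (L / L')" "K * (L / L') \<le> K"
  proof -
    have "0 \<le> K" using X0 by linarith
    then show "0 \<le> K * (L / L')" using LL by (intro mult_nonneg_nonneg)
    show "K * (L / L') \<le> K" using \<open>0 \<le> K\<close> LL by (intro mult_left_le)
  qed
  show X0': "0 \<le> X s \<omega> / c" using X_nonneg c by simp
  have "X s \<omega> / c \<le> K \<and> 0 \<le> profile L c \<omega> s \<and> profile L c \<omega> s \<le> K \<and>
    \<bar>X s \<omega> / c - profile L c \<omega> s\<bar> \<le> K * (L / L')"
  proof (cases "s \<in> (\<Inter>i\<in>big_indices L \<omega>. S i \<omega>)")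
    case True
    then have "X s \<omega> = X 0 \<omega>"
      using good_structure(5)[OF \<omega> L s] good_structure(7)[OF \<omega> L] by simp
    then show ?thesis using True X0 KLL by (simp add: profile_def)
  next
    case False
    then have "X s \<omega> \<le> X 0 \<omega> * (L / L')"
      using good_structure(6)[OF \<omega> L s] good_structure(7)[OF \<omega> L] by simp
    then have "X s \<omega> / c \<le> X 0 \<omega> * (L / L') / c" using c by (intro divide_right_mono) auto
    then have "X s \<omega> / c \<le> X 0 \<omega> / c * (L / L')" by (simp add: mult.commute)
    also have "\<dots> \<le> K * (L / L')" using X0 LL by (intro mult_right_mono) auto
    finally show ?thesis using False X0 X0' KLL by (simp add: profile_def)
  qed
  then show "X s \<omega> / c \<le> K" "0 \<le> profile L c \<omega> s" "profile L c \<omega> s \<le> K"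
    "\<bar>X s \<omega> / c - profile L c \<omega> s\<bar> \<le> K * (L / L')" by auto
qed

lemma measurable_scaled_path: "(\<lambda>\<omega> s. X s \<omega> / c) \<in> borel_measurable M"
  by (rule measurable_coordinatewise_then_product) measurable

text \<open>
  The functional of the path is compared with the functional of the profile on \<open>good L L' c\<close>, whose integral
  is known asymptotically. The error has three parts: exceedances outside the good event, values
  \<open>X 0 / c > K\<close> where the uniform continuity of \<open>F\<close> is not available, and the modulus of continuity of
  \<open>F\<close> on the box with sides \<open>[0, K]\<close>.
\<close>

lemma exceedance_functional_asymptotics:
  fixes F :: "(nat \<Rightarrow> real) \<Rightarrow> real"
  assumes F: "F \<in> borel_measurable borel" "\<And>y. 0 \<le> F y" "\<And>y. F y \<le> Mf"
    and unif: "\<And>K e. 0 < e \<Longrightarrow> \<exists>\<delta>>0. \<forall>y y'. (\<forall>s\<le>t. 0 \<le> y s \<and> y s \<le> K \<and> 0 \<le> y' s \<and> y' s \<le> K \<and>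
        \<bar>y s - y' s\<bar> \<le> \<delta>) \<longrightarrow> \<bar>F y - F y'\<bar> \<le> e"
  defines "Q \<equiv> (\<integral>v. (\<integral>u. F (\<lambda>s. exp v * indicator (\<Inter>l\<in>{..<k}. u l) s) \<partial>(\<Pi>\<^sub>M l\<in>{..<k}. R)) \<partial>exp_law \<alpha>)"
  shows "((\<lambda>c. (\<integral>\<omega>. indicator {\<omega>\<in>space M. c < X 0 \<omega>} \<omega> * F (\<lambda>s. X s \<omega> / c) \<partial>M) / tail_rate \<alpha> k c)
    \<longlongrightarrow> Q / fact k) at_top"
proof (rule tendstoI)
  fix e :: real assume e: "0 < e"
  let ?r = "tail_rate \<alpha> k"
  let ?A = "\<lambda>c. {\<omega>\<in>space M. c < X 0 \<omega>}"
  have Mf: "0 \<le> Mf" using F(2)[of undefined] F(3)[of undefined] by linarith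
  have Q: "0 \<le> Q" "Q \<le> Mf"
  proof -
    have R: "prob_space (\<Pi>\<^sub>M l\<in>{..<k}. R)" by (intro prob_space_PiM prob_space_R)
    interpret E: prob_space "exp_law \<alpha>" by (rule prob_space_exp_law[OF \<alpha>])
    interpret R: prob_space "\<Pi>\<^sub>M l\<in>{..<k}. R" by (rule R)
    show "0 \<le> Q" unfolding Q_def using F by (intro integral_nonneg_AE AE_I2) auto
    have "(\<integral>u. F (\<lambda>s. exp v * indicator (\<Inter>l\<in>{..<k}. u l) s) \<partial>(\<Pi>\<^sub>M l\<in>{..<k}. R)) \<le> (\<integral>u. Mf \<partial>(\<Pi>\<^sub>M l\<in>{..<k}. R))" for v
      using F Mf by (intro integral_mono') auto
    then have "(\<integral>u. F (\<lambda>s. exp v * indicator (\<Inter>l\<in>{..<k}. u l) s) \<partial>(\<Pi>\<^sub>M l\<in>{..<k}. R)) \<le> Mf" for v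
      by (simp add: R.prob_space)
    then have "Q \<le> (\<integral>v. Mf \<partial>exp_law \<alpha>)"
      unfolding Q_def using Mf by (intro integral_mono') auto
    then show "Q \<le> Mf" using E.prob_space by simp
  qed
  \<comment> \<open>Each of the parameters \<open>K\<close>, \<open>\<delta>\<close> and \<open>L\<close> is chosen to make its contribution to the limiting error at most \<open>e / 4\<close>.\<close>
  obtain K where K: "1 \<le> K" "Mf * K powr - \<alpha> < e / 4"
  proof -
    have "((\<lambda>K. Mf * K powr - \<alpha>) \<longlongrightarrow> Mf * 0) at_top"
      using \<alpha> by (intro tendsto_mult tendsto_const tendsto_neg_powr filterlim_ident) auto
    then have "\<forall>\<^sub>F K in at_top. Mf * K powr - \<alpha> < e / 4"
      using e by (intro order_tendstoD) auto
    with eventually_ge_at_top[of 1] have "\<forall>\<^sub>F K in at_top. 1 \<le> K \<and> Mf * K powr - \<alpha> < e / 4"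
      by eventually_elim auto
    then show ?thesis using eventually_happens'[OF trivial_limit_at_top_linorder] that by blast
  qed
  obtain \<delta> where \<delta>: "0 < \<delta>" "\<And>y y'. (\<And>s. s \<le> t \<Longrightarrow> 0 \<le> y s \<and> y s \<le> K \<and> 0 \<le> y' s \<and> y' s \<le> K \<and>
        \<bar>y s - y' s\<bar> \<le> \<delta>) \<Longrightarrow> \<bar>F y - F y'\<bar> \<le> e / 4"
    using unif[of "e / 4" K] e by auto
  obtain L where L: "1 \<le> L" "measure \<nu> (big_hitting t L) \<le> e / (8 * (Mf + 1))"
    using exists_small_intensity[of "e / (8 * (Mf + 1))"] e Mf by auto
  define q where "q = measure \<nu> (big_hitting t L)"
  have q: "0 \<le> q" "2 * Mf * q \<le> e / 4"
  proof -
    show "0 \<le> q" by (simp add: q_def)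
    have "2 * Mf * q \<le> 2 * Mf * (e / (8 * (Mf + 1)))"
      unfolding q_def using L Mf by (intro mult_left_mono) auto
    also have "\<dots> \<le> e / 4" using Mf e by (simp add: field_simps)
    finally show "2 * Mf * q \<le> e / 4" .
  qed
  \<comment> \<open>With this second level the path is within \<open>K * (L / L') \<le> \<delta>\<close> of its profile when \<open>X 0 \<le> K * c\<close>.\<close>
  define L' where "L' = max L (L * K / \<delta>)"
  have L0: "0 < L" "L \<le> L'" using L by (auto simp: L'_def)
  have KL: "K * (L / L') \<le> \<delta>"
  proof -
    have "L * K / \<delta> \<le> L'" by (simp add: L'_def)
    then show ?thesis using \<delta>(1) L0 by (simp add: field_simps)
  qed
  let ?W = "\<lambda>c. \<integral>\<omega>. indicator (good L L' c) \<omega> * F (profile L c \<omega>) \<partial>M"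
  let ?V = "\<lambda>c. \<integral>\<omega>. indicator (?A c) \<omega> * F (\<lambda>s. X s \<omega> / c) \<partial>M"
  have Fp: "(\<lambda>\<omega>. F (profile L c \<omega>)) \<in> borel_measurable M" for c
    using measurable_compose[OF measurable_profile[OF L0(1)] F(1)] .
  have Fx: "(\<lambda>\<omega>. F (\<lambda>s. X s \<omega> / c)) \<in> borel_measurable M" for c
    using measurable_compose[OF measurable_scaled_path F(1)] .
  have gev: "good L L' c \<in> events" for c using L0 by (intro sets_tuple_event) auto
  have Aev: "?A c \<in> events" for c by measurable
  have Wm: "(\<lambda>\<omega>. indicator (good L L' c) \<omega> * F (profile L c \<omega>)) \<in> borel_measurable M" for c
    using gev Fp by (intro borel_measurable_times borel_measurable_indicator)
  have Vm: "(\<lambda>\<omega>. indicator (?A c) \<omega> * F (\<lambda>s. X s \<omega> / c)) \<in> borel_measurable M" for c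
    using Aev Fx by (intro borel_measurable_times borel_measurable_indicator)
  have Wi: "integrable M (\<lambda>\<omega>. indicator (good L L' c) \<omega> * F (profile L c \<omega>))" for c
    using F Mf by (intro integrable_const_bound[where B = Mf] AE_I2 Wm) (auto simp: indicator_def)
  have Vi: "integrable M (\<lambda>\<omega>. indicator (?A c) \<omega> * F (\<lambda>s. X s \<omega> / c))" for c
    using F Mf by (intro integrable_const_bound[where B = Mf] AE_I2 Vm) (auto simp: indicator_def)
  have Wlim: "((\<lambda>c. ?W c / ?r c) \<longlongrightarrow> exp (- q) / fact k * Q) at_top"
  proof -
    let ?G = "\<lambda>y u. F (\<lambda>s. y * indicator (\<Inter>l\<in>{..<k}. u l) s)"
    let ?J = "\<lambda>c. L' powr (- \<alpha> * real k) * (\<integral>z. (if c < (\<Prod>l<k. fst (z l)) then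
          ?G ((\<Prod>l<k. fst (z l)) / c) (\<lambda>l\<in>{..<k}. snd (z l)) else 0) \<partial>(\<Pi>\<^sub>M l\<in>{..<k}. zero_law L'))"
    have J0: "0 \<le> ?J c" for c using F by (intro mult_nonneg_nonneg integral_nonneg_AE AE_I2) auto
    have W: "?W c = exp (- q) / fact k * ?J c" for c
    proof -
      have "?W c = enn2real (\<integral>\<^sup>+\<omega>. ennreal (indicator (good L L' c) \<omega> * F (profile L c \<omega>)) \<partial>M)"
        using Wm F by (intro integral_eq_nn_integral) auto
      also have "(\<integral>\<^sup>+\<omega>. ennreal (indicator (good L L' c) \<omega> * F (profile L c \<omega>)) \<partial>M) =
          (\<integral>\<^sup>+\<omega>. indicator (good L L' c) \<omega> * ennreal (F (profile L c \<omega>)) \<partial>M)"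
        by (intro nn_integral_cong) (auto simp: indicator_def)
      also have "\<dots> = ennreal (exp (- q) / fact k * ?J c)"
        unfolding q_def by (rule nn_integral_good[OF F L0])
      finally show ?thesis using J0[of c] by simp
    qed
    have "((\<lambda>c. ?J c / ?r c) \<longlongrightarrow> Q) at_top"
      unfolding Q_def using L L0 F Mf k
      by (intro tuple_integral_asymptotics[where G = ?G and Mg = Mf] measurable_profile_functional) auto
    then have "((\<lambda>c. exp (- q) / fact k * (?J c / ?r c)) \<longlongrightarrow> exp (- q) / fact k * Q) at_top"
      by (intro tendsto_mult tendsto_const)
    then show ?thesis unfolding W by simp
  qed
  have diff: "\<bar>?V c - ?W c\<bar> \<le> Mf * (prob (?A c) - prob (good L L' c)) + e / 4 * prob (?A c) + Mf * prob (?A (K * c))"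
    if c: "0 < c" for c
  proof -
    let ?b = "\<lambda>\<omega>. Mf * (indicator (?A c) \<omega> - indicator (good L L' c) \<omega>) + e / 4 * indicator (?A c) \<omega> + Mf * indicator (?A (K * c)) \<omega>"
    have sub: "good L L' c \<subseteq> ?A c" by (rule good_subset_exceedance[OF L0])
    have Fd: "\<bar>F y - F y'\<bar> \<le> Mf" for y y' using F(2,3)[of y] F(2,3)[of y'] by auto
    have bi: "integrable M ?b"
      using gev Aev by (intro integrable_const_bound[where B = "Mf + e / 4 + Mf"])
        (use Mf e sub in \<open>auto simp: indicator_def\<close>)
    have "\<bar>?V c - ?W c\<bar> = \<bar>\<integral>\<omega>. indicator (?A c) \<omega> * F (\<lambda>s. X s \<omega> / c) - indicator (good L L' c) \<omega> * F (profile L c \<omega>) \<partial>M\<bar>"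
      using Vi Wi by simp
    also have "\<dots> \<le> (\<integral>\<omega>. \<bar>indicator (?A c) \<omega> * F (\<lambda>s. X s \<omega> / c) - indicator (good L L' c) \<omega> * F (profile L c \<omega>)\<bar> \<partial>M)"
      by (rule integral_abs_bound)
    also have "\<dots> \<le> (\<integral>\<omega>. ?b \<omega> \<partial>M)"
    proof (rule integral_mono[OF _ bi])
      show "integrable M (\<lambda>\<omega>. \<bar>indicator (?A c) \<omega> * F (\<lambda>s. X s \<omega> / c) - indicator (good L L' c) \<omega> * F (profile L c \<omega>)\<bar>)"
        using Vi Wi by (intro integrable_abs Bochner_Integration.integrable_diff)
      fix \<omega> assume \<omega>: "\<omega> \<in> space M"
      show "\<bar>indicator (?A c) \<omega> * F (\<lambda>s. X s \<omega> / c) - indicator (good L L' c) \<omega> * F (profile L c \<omega>)\<bar> \<le> ?b \<omega>"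
      proof (cases "\<omega> \<in> good L L' c")
        case False
        then show ?thesis using F(2,3)[of "\<lambda>s. X s \<omega> / c"] Mf e by (auto simp: indicator_def)
      next
        case True
        then have A: "\<omega> \<in> ?A c" using sub by blast
        show ?thesis
        proof (cases "K * c < X 0 \<omega>")
          case KA: True
          then have "\<omega> \<in> ?A (K * c)" using \<omega> by simp
          then show ?thesis using True A Fd[of "\<lambda>s. X s \<omega> / c" "profile L c \<omega>"] e
            by (simp add: indicator_def)
        next
          case False
          then have "\<bar>F (\<lambda>s. X s \<omega> / c) - F (profile L c \<omega>)\<bar> \<le> e / 4"
            using profile_close[OF True L0 c, of K] KL by (intro \<delta>(2)) fastforce
          then show ?thesis using True A Mf by (simp add: indicator_def)
        qed
      qed
    qed
    also have "\<dots> = Mf * (prob (?A c) - prob (good L L' c)) + e / 4 * prob (?A c) + Mf * prob (?A (K * c))"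
    proof -
      have i: "integrable M (indicator B :: _ \<Rightarrow> real)" if "B \<in> events" for B
        using that by (intro integrable_real_indicator) (auto simp: emeasure_eq_measure)
      have m: "(\<integral>\<omega>. indicator B \<omega> \<partial>M) = prob B" if "B \<in> events" for B
        using that sets.sets_into_space[OF that] by (simp add: Int_absorb2)
      show ?thesis using i[OF gev] i[OF Aev] m[OF gev] m[OF Aev] by simp
    qed
    finally show ?thesis .
  qed
  have "((\<lambda>c. Mf * (prob (?A c) / ?r c - prob (good L L' c) / ?r c) + e / 4 * (prob (?A c) / ?r c) +
      Mf * (prob (?A (K * c)) / ?r c) + \<bar>?W c / ?r c - Q / fact k\<bar>) \<longlongrightarrow>
    Mf * (1 / fact k - exp (- q) / fact k) + e / 4 * (1 / fact k) + Mf * (1 / fact k * K powr - \<alpha>) +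
      \<bar>exp (- q) / fact k * Q - Q / fact k\<bar>) at_top"
    unfolding q_def using K L L0 Wlim[unfolded q_def]
    by (intro tendsto_intros prob_exceedance_asymptotics prob_good_asymptotics prob_scaled_exceedance_asymptotics) auto
  moreover have "Mf * (1 / fact k - exp (- q) / fact k) + e / 4 * (1 / fact k) + Mf * (1 / fact k * K powr - \<alpha>) +
      \<bar>exp (- q) / fact k * Q - Q / fact k\<bar> < e"
  proof -
    have fk: "0 < (1 / fact k :: real)" "1 / fact k \<le> (1::real)" by (auto simp: fact_ge_1)
    have d: "0 \<le> 1 / fact k - exp (- q) / (fact k :: real)" "1 / fact k - exp (- q) / (fact k :: real) \<le> q"
      using exp_minus_over_fact_ge[OF q(1)] q(1) by (auto intro!: divide_right_mono)
    have "Mf * (1 / fact k - exp (- q) / fact k) \<le> Mf * q" using d Mf by (intro mult_left_mono) auto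
    moreover have "\<bar>exp (- q) / fact k * Q - Q / fact k\<bar> = Q * (1 / fact k - exp (- q) / fact k)"
    proof -
      have "exp (- q) / fact k * Q - Q / fact k = - (Q * (1 / fact k - exp (- q) / fact k))"
        by (simp add: algebra_simps)
      then show ?thesis using Q(1) d(1) by (simp only: abs_minus_cancel abs_of_nonneg mult_nonneg_nonneg)
    qed
    moreover have "Q * (1 / fact k - exp (- q) / fact k) \<le> Mf * q"
      using d Q by (intro mult_mono) auto
    moreover have "e / 4 * (1 / fact k) \<le> e / 4" using fk e mult_left_le[of "1 / fact k" "e / 4"] by simp
    moreover have "Mf * (1 / fact k * K powr - \<alpha>) \<le> Mf * (1 * K powr - \<alpha>)"
      using fk Mf by (intro mult_left_mono mult_right_mono) auto
    ultimately show ?thesis using K(2) q(2) e by simp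
  qed
  ultimately have "\<forall>\<^sub>F c in at_top. Mf * (prob (?A c) / ?r c - prob (good L L' c) / ?r c) + e / 4 * (prob (?A c) / ?r c) +
      Mf * (prob (?A (K * c)) / ?r c) + \<bar>?W c / ?r c - Q / fact k\<bar> < e"
    by (rule order_tendstoD)
  with eventually_gt_at_top[of 1]
  show "\<forall>\<^sub>F c in at_top. dist (?V c / ?r c) (Q / fact k) < e"
  proof eventually_elim
    case (elim c)
    have r: "0 < ?r c" using elim by (intro tail_rate_pos \<alpha>) auto
    have "\<bar>?V c / ?r c - ?W c / ?r c\<bar> = \<bar>?V c - ?W c\<bar> / ?r c"
      using r by (simp add: diff_divide_distrib[symmetric])
    also have "\<dots> \<le> (Mf * (prob (?A c) - prob (good L L' c)) + e / 4 * prob (?A c) + Mf * prob (?A (K * c))) / ?r c"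
      using r elim by (intro divide_right_mono diff) auto
    also have "\<dots> = Mf * (prob (?A c) / ?r c - prob (good L L' c) / ?r c) + e / 4 * (prob (?A c) / ?r c) +
      Mf * (prob (?A (K * c)) / ?r c)"
      by (simp add: add_divide_distrib diff_divide_distrib right_diff_distrib)
    finally show ?case using elim unfolding dist_real_def by linarith
  qed
qed

end

section \<open>Weak convergence to the limit law\<close>

lemma continuous_restrict_functional:
  fixes f :: "(nat \<Rightarrow> real) \<Rightarrow> real"
  assumes "continuous_map (product_topology (\<lambda>_. euclideanreal) {0..t}) euclideanreal f"
  shows "continuous_on UNIV (\<lambda>y. f (restrict y {0..t}))"
proof -
  have "continuous_map (product_topology (\<lambda>_. euclideanreal) UNIV)
      (product_topology (\<lambda>_. euclideanreal) {0..t}) (\<lambda>y. restrict y {0..t})"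
    by (auto simp: continuous_map_componentwise intro: continuous_map_product_projection)
  from continuous_map_compose[OF this assms] show ?thesis
    by (simp add: euclidean_product_topology o_def)
qed

lemma dist_fun_le:
  fixes y y' :: "nat \<Rightarrow> real"
  assumes "\<And>s. \<bar>y s - y' s\<bar> \<le> d"
  shows "dist y y' \<le> 2 * d"
proof -
  have sg: "summable (\<lambda>n. (1 / 2) ^ n * d)" by (intro summable_mult2 summable_geometric) auto
  have "dist y y' \<le> (\<Sum>n. (1 / 2) ^ n * d)"
    unfolding dist_fun_def
  proof (intro suminf_le sg)
    show le: "(1 / 2) ^ n * min (dist (y (from_nat n)) (y' (from_nat n))) 1 \<le> (1 / 2) ^ n * d" for n
      using assms[of "from_nat n"] by (intro mult_left_mono) (auto simp: dist_real_def)
    show "summable (\<lambda>n. (1 / 2) ^ n * min (dist (y (from_nat n)) (y' (from_nat n))) 1)"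
      using le by (intro summable_comparison_test'[OF sg]) (auto simp: abs_mult)
  qed
  also have "\<dots> = 2 * d" by (subst suminf_mult2[symmetric]) (auto simp: suminf_geometric summable_geometric)
  finally show ?thesis .
qed

text \<open>
  Heine-Cantor on a compact product of intervals. The coordinates beyond \<open>t\<close> are set to \<open>0\<close>, which does not
  change the functional; the distance of two sequences is then controlled by their first coordinates.
\<close>

lemma uniformly_continuous_on_boxes:
  fixes f :: "(nat \<Rightarrow> real) \<Rightarrow> real"
  assumes cont: "continuous_on UNIV (\<lambda>y. f (restrict y {0..t}))" and "0 < e"
  shows "\<exists>\<delta>>0. \<forall>y y'. (\<forall>s\<le>t. 0 \<le> y s \<and> y s \<le> K \<and> 0 \<le> y' s \<and> y' s \<le> K \<and> \<bar>y s - y' s\<bar> \<le> \<delta>) \<longrightarrow>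
    \<bar>f (restrict y {0..t}) - f (restrict y' {0..t})\<bar> \<le> e"
proof (cases "0 \<le> K")
  case False
  then show ?thesis by (intro exI[of _ 1]) (auto dest: spec[of _ 0])
next
  case True
  let ?F = "\<lambda>y. f (restrict y {0..t})" and ?C = "Pi\<^sub>E UNIV (\<lambda>_. {0..K}) :: (nat \<Rightarrow> real) set"
  have "compactin (product_topology (\<lambda>_. euclideanreal) UNIV) ?C"
    by (subst compactin_PiE) auto
  then have "compact ?C" by (simp add: euclidean_product_topology)
  with cont have "uniformly_continuous_on ?C ?F"
    by (intro compact_uniformly_continuous continuous_on_subset[OF cont]) auto
  then obtain d where d: "0 < d" "\<And>y y'. y \<in> ?C \<Longrightarrow> y' \<in> ?C \<Longrightarrow> dist y' y < d \<Longrightarrow> dist (?F y') (?F y) < e"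
    using \<open>0 < e\<close> unfolding uniformly_continuous_on_def by metis
  show ?thesis
  proof (intro exI[of _ "d / 4"] conjI allI impI)
    show "0 < d / 4" using d by simp
    fix y y' :: "nat \<Rightarrow> real"
    assume *: "\<forall>s\<le>t. 0 \<le> y s \<and> y s \<le> K \<and> 0 \<le> y' s \<and> y' s \<le> K \<and> \<bar>y s - y' s\<bar> \<le> d / 4"
    define z where "z y s = (if s \<le> t then y s else 0)" for y :: "nat \<Rightarrow> real" and s
    have F: "?F (z y) = ?F y" for y
      by (intro arg_cong[where f = f]) (auto simp: z_def restrict_def fun_eq_iff)
    have "z y \<in> ?C" "z y' \<in> ?C" using * True by (auto simp: z_def)
    moreover have "dist (z y) (z y') \<le> 2 * (d / 4)"
      using * d(1) by (intro dist_fun_le) (auto simp: z_def)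
    ultimately have "dist (?F (z y)) (?F (z y')) < e" using d by (intro d(2)) auto
    then show "\<bar>?F y - ?F y'\<bar> \<le> e" by (simp add: F dist_real_def)
  qed
qed

lemma borel_measurable_continuous_on_product:
  fixes f :: "(nat \<Rightarrow> real) \<Rightarrow> real"
  assumes "continuous_on UNIV (\<lambda>y. f (restrict y {0..t}))"
  shows "f \<in> borel_measurable (\<Pi>\<^sub>M s\<in>{0..t}. borel)"
proof -
  have "(\<lambda>z. z) \<in> measurable (\<Pi>\<^sub>M s\<in>{0..t}. (borel :: real measure)) (borel :: (nat \<Rightarrow> real) measure)"
  proof (rule measurable_coordinatewise_then_product)
    fix s :: nat
    show "(\<lambda>z. z s) \<in> borel_measurable (\<Pi>\<^sub>M s\<in>{0..t}. (borel :: real measure))"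
    proof (cases "s \<in> {0..t}")
      case True then show ?thesis by (rule measurable_component_singleton)
    next
      case False
      have "z s = undefined" if "z \<in> space (\<Pi>\<^sub>M s\<in>{0..t}. (borel :: real measure))" for z
        using that False by (auto simp: space_PiM PiE_def extensional_def)
      then have "(\<lambda>z. z s) \<in> borel_measurable (\<Pi>\<^sub>M s\<in>{0..t}. (borel :: real measure)) \<longleftrightarrow>
          (\<lambda>z. undefined :: real) \<in> borel_measurable (\<Pi>\<^sub>M s\<in>{0..t}. (borel :: real measure))"
        by (rule measurable_cong)
      then show ?thesis by simp
    qed
  qed
  from measurable_compose[OF this borel_measurable_continuous_onI[OF assms]]
  have "(\<lambda>z. f (restrict z {0..t})) \<in> borel_measurable (\<Pi>\<^sub>M s\<in>{0..t}. borel)" .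
  moreover have "restrict z {0..t} = z" if "z \<in> space (\<Pi>\<^sub>M s\<in>{0..t}. (borel :: real measure))" for z
    using that by (auto simp: space_PiM PiE_def extensional_restrict)
  ultimately show ?thesis by (subst measurable_cong[of _ _ "\<lambda>z. f (restrict z {0..t})"]) auto
qed

lemma distr_indep_pair:
  assumes "prob_space N" and ind: "indep_pair N A Y B Z"
  shows "distr N (A \<Otimes>\<^sub>M B) (\<lambda>\<omega>. (Y \<omega>, Z \<omega>)) = distr N A Y \<Otimes>\<^sub>M distr N B Z"
proof -
  interpret N: prob_space N by fact
  have Y: "Y \<in> measurable N A" and Z: "Z \<in> measurable N B"
    and iset: "N.indep_set {Y -` U \<inter> space N | U. U \<in> sets A} {Z -` V \<inter> space N | V. V \<in> sets B}"
    using ind by (auto simp: indep_pair_def)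
  show ?thesis
  proof (rule pair_measure_eqI[symmetric])
    show "sigma_finite_measure (distr N A Y)" "sigma_finite_measure (distr N B Z)"
      by (intro prob_space_imp_sigma_finite N.prob_space_distr Y Z)+
    show "sets (distr N A Y \<Otimes>\<^sub>M distr N B Z) = sets (distr N (A \<Otimes>\<^sub>M B) (\<lambda>\<omega>. (Y \<omega>, Z \<omega>)))"
      by simp
    fix U V assume "U \<in> sets (distr N A Y)" "V \<in> sets (distr N B Z)"
    then have U: "U \<in> sets A" and V: "V \<in> sets B" by auto
    have "N.prob ((Y -` U \<inter> space N) \<inter> (Z -` V \<inter> space N)) = N.prob (Y -` U \<inter> space N) * N.prob (Z -` V \<inter> space N)"
      using U V by (intro N.indep_setD[OF iset]) auto
    moreover have "(\<lambda>\<omega>. (Y \<omega>, Z \<omega>)) -` (U \<times> V) \<inter> space N = (Y -` U \<inter> space N) \<inter> (Z -` V \<inter> space N)"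
      by auto
    ultimately show "emeasure (distr N A Y) U * emeasure (distr N B Z) V =
        emeasure (distr N (A \<Otimes>\<^sub>M B) (\<lambda>\<omega>. (Y \<omega>, Z \<omega>))) (U \<times> V)"
      using U V Y Z
      by (simp add: emeasure_distr measurable_Pair N.emeasure_eq_measure ennreal_mult')
  qed
qed

context regenerative_setup
begin

text \<open>
  The limit found for the model is the expectation under the law of \<open>P * \<Theta>\<close>: the Pareto variable is represented
  as \<open>exp V\<close>, and the \<open>k\<close> independent renewal sets as coordinates of a product space.
\<close>

lemma limit_expectation:
  fixes F :: "(nat \<Rightarrow> real) \<Rightarrow> real" and T :: "nat \<Rightarrow> 'b \<Rightarrow> nat set"
  assumes N: "prob_space N"
    and T_indep: "prob_space.indep_vars N (\<lambda>_. E_space) T {1..k}"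
    and T_law: "\<And>j. j \<in> {1..k} \<Longrightarrow> distr N E_space (T j) = renewal_law p"
    and \<Theta>: "\<Theta> = (\<lambda>s \<omega>. indicator (\<Inter>j\<in>{1..k}. T j \<omega>) s)"
    and P: "P \<in> borel_measurable N" "\<And>x. x \<ge> 1 \<Longrightarrow> \<P>(\<omega> in N. P \<omega> > x) = x powr (- \<alpha>)"
    and indep: "indep_pair N borel P (\<Pi>\<^sub>M s\<in>(UNIV :: nat set). borel) (\<lambda>\<omega> s. \<Theta> s \<omega>)"
    and k: "1 \<le> k"
    and F: "F \<in> borel_measurable borel" "\<And>y. \<bar>F y\<bar> \<le> Mf"
  shows "(\<integral>\<omega>. F (\<lambda>s. P \<omega> * \<Theta> s \<omega>) \<partial>N) =
    (\<integral>v. (\<integral>u. F (\<lambda>s. exp v * indicator (\<Inter>l\<in>{..<k}. u l) s) \<partial>(\<Pi>\<^sub>M l\<in>{..<k}. R)) \<partial>exp_law \<alpha>)"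
proof -
  interpret N: prob_space N by (rule N)
  let ?V = "\<Pi>\<^sub>M s\<in>(UNIV :: nat set). (borel :: real measure)"
  let ?R = "\<Pi>\<^sub>M l\<in>{..<k}. R"
  have V: "sets ?V = sets (borel :: (nat \<Rightarrow> real) measure)" by (rule sets_PiM_equal_borel)
  have Pm: "P \<in> measurable N borel" and \<Theta>m: "(\<lambda>\<omega> s. \<Theta> s \<omega>) \<in> measurable N ?V"
    using indep by (auto simp: indep_pair_def)
  have Plaw: "distr N borel P = distr (exp_law \<alpha>) borel exp"
  proof (rule pareto_tail_unique[where L = 1])
    show "prob_space (distr N borel P)" by (rule N.prob_space_distr[OF Pm])
    show "prob_space (distr (exp_law \<alpha>) borel exp)"
      by (intro prob_space.prob_space_distr prob_space_exp_law \<alpha>) simp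
    fix x :: real assume x: "1 \<le> x"
    have "P -` {x<..} \<inter> space N = {\<omega>\<in>space N. P \<omega> > x}" by auto
    then show "measure (distr N borel P) {x<..} = (x / 1) powr - \<alpha>"
      using P(2)[OF x] Pm by (simp add: measure_distr)
    show "measure (distr (exp_law \<alpha>) borel exp) {x<..} = (x / 1) powr - \<alpha>"
      using measure_exp_law_scaled_exp[OF \<alpha>, of 1 x] x by simp
  qed simp_all
  have Tm: "T j \<in> measurable N E_space" if "j \<in> {1..k}" for j
    using T_indep that by (auto simp: N.indep_vars_def)
  define ind where "ind u s = (indicator (\<Inter>l\<in>{..<k}. u l) s :: real)" for u :: "nat \<Rightarrow> nat set" and s :: nat
  have indm: "ind \<in> measurable ?R ?V"
  proof -
    have "(\<lambda>u. (1, u)) \<in> measurable ?R ((borel :: real measure) \<Otimes>\<^sub>M ?R)" by measurable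
    from measurable_compose[OF this measurable_common_profile]
    have "(\<lambda>u s. indicator (\<Inter>l\<in>{..<k}. u l) s :: real) \<in> borel_measurable ?R" by simp
    then show ?thesis by (simp add: ind_def[abs_def] measurable_cong_sets[OF refl V])
  qed
  have \<Theta>law: "distr N ?V (\<lambda>\<omega> s. \<Theta> s \<omega>) = distr ?R ?V ind"
  proof -
    have "distr N (\<Pi>\<^sub>M j\<in>{1..k}. E_space) (\<lambda>\<omega>. \<lambda>j\<in>{1..k}. T j \<omega>) = (\<Pi>\<^sub>M j\<in>{1..k}. distr N E_space (T j))"
      using k Tm T_indep by (subst N.indep_vars_iff_distr_eq_PiM'[symmetric]) auto
    also have "\<dots> = (\<Pi>\<^sub>M j\<in>{1..k}. R)" using T_law by (intro PiM_cong) auto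
    finally have T1: "distr N (\<Pi>\<^sub>M j\<in>{1..k}. E_space) (\<lambda>\<omega>. \<lambda>j\<in>{1..k}. T j \<omega>) = (\<Pi>\<^sub>M j\<in>{1..k}. R)" .
    have s1: "sets (\<Pi>\<^sub>M j\<in>{1..k}. E_space) = sets (\<Pi>\<^sub>M j\<in>{1..k}. R)" by (intro sets_PiM_cong) auto
    have re: "distr (\<Pi>\<^sub>M j\<in>{1..k}. R) ?R (\<lambda>u. \<lambda>l\<in>{..<k}. u (Suc l)) = ?R"
      by (rule distr_PiM_reindex[where M = "\<lambda>_. R" and f = Suc]) (auto intro: prob_space_R)
    have rm: "(\<lambda>u. \<lambda>l\<in>{..<k}. u (Suc l)) \<in> measurable (\<Pi>\<^sub>M j\<in>{1..k}. R) ?R"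
      by (intro measurable_restrict measurable_component_singleton) auto
    have rm': "(\<lambda>u. \<lambda>l\<in>{..<k}. u (Suc l)) \<in> measurable (\<Pi>\<^sub>M j\<in>{1..k}. E_space) ?R"
      using rm by (simp add: measurable_cong_sets[OF s1 refl])
    have Tm': "(\<lambda>\<omega>. \<lambda>j\<in>{1..k}. T j \<omega>) \<in> measurable N (\<Pi>\<^sub>M j\<in>{1..k}. E_space)"
      by (intro measurable_restrict Tm)
    have "distr ?R ?V ind = distr (distr (distr N (\<Pi>\<^sub>M j\<in>{1..k}. E_space) (\<lambda>\<omega>. \<lambda>j\<in>{1..k}. T j \<omega>)) ?R
        (\<lambda>u. \<lambda>l\<in>{..<k}. u (Suc l))) ?V ind"
      unfolding T1 re ..
    also have "\<dots> = distr N ?V (ind \<circ> ((\<lambda>u. \<lambda>l\<in>{..<k}. u (Suc l)) \<circ> (\<lambda>\<omega>. \<lambda>j\<in>{1..k}. T j \<omega>)))"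
      by (simp only: distr_distr[OF rm' Tm'] distr_distr[OF indm measurable_comp[OF Tm' rm']])
    also have "\<dots> = distr N ?V (\<lambda>\<omega> s. \<Theta> s \<omega>)"
    proof (intro distr_cong refl)
      fix \<omega>
      have "(\<Inter>l\<in>{..<k}. T (Suc l) \<omega>) = (\<Inter>j\<in>Suc ` {..<k}. T j \<omega>)" by auto
      also have "Suc ` {..<k} = {1..k}" by (auto simp: image_Suc_lessThan)
      finally have "(\<Inter>l\<in>{..<k}. T (Suc l) \<omega>) = (\<Inter>j\<in>{1..k}. T j \<omega>)" .
      then show "(ind \<circ> ((\<lambda>u. \<lambda>l\<in>{..<k}. u (Suc l)) \<circ> (\<lambda>\<omega>. \<lambda>j\<in>{1..k}. T j \<omega>))) \<omega> = (\<lambda>s. \<Theta> s \<omega>)"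
        by (auto simp: ind_def \<Theta> fun_eq_iff indicator_def)
    qed
    finally show ?thesis by simp
  qed
  define G where "G = (\<lambda>(x, \<theta>). F (\<lambda>s. x * \<theta> s))"
  have Gm: "G \<in> borel_measurable ((borel :: real measure) \<Otimes>\<^sub>M ?V)"
  proof -
    have "(\<lambda>z s. fst z * snd z s) \<in> borel_measurable ((borel :: real measure) \<Otimes>\<^sub>M ?V)"
      by (rule measurable_coordinatewise_then_product)
         (intro borel_measurable_times measurable_fst measurable_compose[OF measurable_snd measurable_component_singleton], auto)
    from measurable_compose[OF this F(1)] show ?thesis by (simp add: G_def case_prod_beta')
  qed
  have "(\<integral>\<omega>. F (\<lambda>s. P \<omega> * \<Theta> s \<omega>) \<partial>N) = (\<integral>\<omega>. G (P \<omega>, (\<lambda>s. \<Theta> s \<omega>)) \<partial>N)" by (simp add: G_def)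
  also have "\<dots> = (\<integral>z. G z \<partial>distr N (borel \<Otimes>\<^sub>M ?V) (\<lambda>\<omega>. (P \<omega>, (\<lambda>s. \<Theta> s \<omega>))))"
    using Pm \<Theta>m Gm by (intro integral_distr[symmetric]) auto
  also have "\<dots> = (\<integral>z. G z \<partial>(distr (exp_law \<alpha>) borel exp \<Otimes>\<^sub>M distr ?R ?V ind))"
    unfolding distr_indep_pair[OF N indep] Plaw \<Theta>law ..
  also have "\<dots> = (\<integral>x. (\<integral>\<theta>. G (x, \<theta>) \<partial>distr ?R ?V ind) \<partial>distr (exp_law \<alpha>) borel exp)"
  proof -
    interpret E: prob_space "distr (exp_law \<alpha>) borel (exp :: real \<Rightarrow> real)"
      by (intro prob_space.prob_space_distr prob_space_exp_law \<alpha>) simp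
    interpret RV: prob_space "distr ?R ?V ind"
      by (intro prob_space.prob_space_distr prob_space_PiM prob_space_R indm)
    interpret EV: pair_prob_space "distr (exp_law \<alpha>) borel (exp :: real \<Rightarrow> real)" "distr ?R ?V ind" ..
    have "integrable (distr (exp_law \<alpha>) borel exp \<Otimes>\<^sub>M distr ?R ?V ind) G"
      using Gm F(2) by (intro EV.integrable_const_bound[where B = Mf]) (auto simp: G_def cong: measurable_cong_sets)
    from EV.integral_fst'[OF this] show ?thesis by simp
  qed
  also have "\<dots> = (\<integral>v. (\<integral>\<theta>. G (exp v, \<theta>) \<partial>distr ?R ?V ind) \<partial>exp_law \<alpha>)"
  proof (rule integral_distr)
    interpret RV: prob_space "distr ?R ?V ind"
      by (intro prob_space.prob_space_distr prob_space_PiM prob_space_R indm)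
    have "case_prod (\<lambda>x \<theta>. G (x, \<theta>)) \<in> borel_measurable ((borel :: real measure) \<Otimes>\<^sub>M distr ?R ?V ind)"
      using Gm by (simp cong: measurable_cong_sets)
    then show "(\<lambda>x. \<integral>\<theta>. G (x, \<theta>) \<partial>distr ?R ?V ind) \<in> borel_measurable borel"
      by (rule RV.borel_measurable_lebesgue_integral)
  qed simp
  also have "\<dots> = (\<integral>v. (\<integral>u. G (exp v, ind u) \<partial>?R) \<partial>exp_law \<alpha>)"
    using indm measurable_Pair2[OF Gm] by (intro Bochner_Integration.integral_cong refl integral_distr) auto
  finally show ?thesis by (simp add: G_def ind_def)
qed

end

theorem theorem7p1:
  fixes \<alpha> \<beta> C\<^sub>F :: real
    and p :: "nat pmf"
    and k t :: nat
    and M :: "'a measure" and \<eta> :: "nat \<Rightarrow> 'a \<Rightarrow> real" and S :: "nat \<Rightarrow> 'a \<Rightarrow> nat set"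
    and N :: "'b measure" and T :: "nat \<Rightarrow> 'b \<Rightarrow> nat set" and P\<^sub>\<alpha> :: "'b \<Rightarrow> real"
    and \<Theta> :: "nat \<Rightarrow> 'b \<Rightarrow> real" and X :: "nat \<Rightarrow> 'a \<Rightarrow> real"
  assumes "\<alpha> > 0"
    and "0 < \<beta>" "\<beta> < 1" "C\<^sub>F > 0"
    and step_positive: "0 \<notin> set_pmf p"
    and tail: "step_tail p \<sim>[at_top] (\<lambda>x. C\<^sub>F * x powr (- \<beta>))"
    and local_bound:
      "bdd_above ((\<lambda>n. real n * (step_df p (real n) - step_df p (real n - 1)) / step_tail p (real n))
         ` {1::nat..})"
    and "k \<ge> 1"
    and ppp: "poisson_point_process M (regenerative_intensity \<alpha> p) (\<lambda>i \<omega>. (\<eta> i \<omega>, S i \<omega>))"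
    and X: "X = tuple_process k \<eta> S"
    and "prob_space N"
    and T_indep: "prob_space.indep_vars N (\<lambda>_. E_space) T {1..k}"
    and T_law: "\<And>j. j \<in> {1..k} \<Longrightarrow> distr N E_space (T j) = renewal_law p"
    and \<Theta>: "\<Theta> = (\<lambda>s \<omega>. indicator (\<Inter>j\<in>{1..k}. T j \<omega>) s)"
    and pareto_rv: "P\<^sub>\<alpha> \<in> borel_measurable N"
    and pareto: "\<And>x. x \<ge> 1 \<Longrightarrow> \<P>(\<omega> in N. P\<^sub>\<alpha> \<omega> > x) = x powr (- \<alpha>)"
    and pareto_indep:
      "indep_pair N borel P\<^sub>\<alpha> (\<Pi>\<^sub>M s\<in>(UNIV :: nat set). borel) (\<lambda>\<omega> s. \<Theta> s \<omega>)"
  shows "converges_weakly (product_topology (\<lambda>_. euclideanreal) {0..t})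
    (\<lambda>c::real. distr (uniform_measure M {\<omega> \<in> space M. X 0 \<omega> > c}) (\<Pi>\<^sub>M s\<in>{0..t}. borel)
       (\<lambda>\<omega>. \<lambda>s\<in>{0..t}. X s \<omega> / c))
    (distr N (\<Pi>\<^sub>M s\<in>{0..t}. borel) (\<lambda>\<omega>. \<lambda>s\<in>{0..t}. P\<^sub>\<alpha> \<omega> * \<Theta> s \<omega>))
    at_top"
proof -
  interpret tuple_model \<alpha> p M \<eta> S k t
    using \<open>\<alpha> > 0\<close> step_positive ppp \<open>k \<ge> 1\<close> by unfold_locales
  let ?V = "\<Pi>\<^sub>M s\<in>{0..t}. (borel :: real measure)"
  let ?A = "\<lambda>c. {\<omega> \<in> space M. X 0 \<omega> > c}"
  have Xm: "X s \<in> borel_measurable M" for s unfolding X by (rule measurable_X)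
  show ?thesis
    unfolding converges_weakly_def
  proof (intro allI impI, elim conjE)
    fix f :: "(nat \<Rightarrow> real) \<Rightarrow> real"
    assume cont: "continuous_map (product_topology (\<lambda>_. euclideanreal) {0..t}) euclideanreal f"
      and bdd: "bounded (f ` topspace (product_topology (\<lambda>_. euclideanreal) {0..t}))"
    define F where "F y = f (restrict y {0..t})" for y
    have Fc: "continuous_on UNIV F" unfolding F_def by (rule continuous_restrict_functional[OF cont])
    have fm: "f \<in> borel_measurable ?V"
      using Fc unfolding F_def by (rule borel_measurable_continuous_on_product)
    have Fm: "F \<in> borel_measurable borel" by (rule borel_measurable_continuous_onI[OF Fc])
    obtain b where b: "\<And>y. \<bar>F y\<bar> \<le> b"
    proof -
      obtain b where "\<And>z. z \<in> f ` topspace (product_topology (\<lambda>_. euclideanreal) {0..t}) \<Longrightarrow> norm z \<le> b"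
        using bdd unfolding bounded_iff by blast
      then show ?thesis using that[of b] by (auto simp: F_def)
    qed
    \<comment> \<open>The asymptotics is available for nonnegative functionals; the constant \<open>b\<close> is subtracted again after normalisation.\<close>
    define F' where "F' y = F y + b" for y
    have F'm: "F' \<in> borel_measurable borel" unfolding F'_def using Fm by simp
    have F': "0 \<le> F' y" "F' y \<le> 2 * b" "\<bar>F' y\<bar> \<le> 2 * b" for y using b[of y] by (auto simp: F'_def)
    define Q where "Q = (\<integral>v. (\<integral>u. F' (\<lambda>s. exp v * indicator (\<Inter>l\<in>{..<k}. u l) s) \<partial>(\<Pi>\<^sub>M l\<in>{..<k}. R)) \<partial>exp_law \<alpha>)"
    define V where "V c = (\<integral>\<omega>. indicator (?A c) \<omega> * F' (\<lambda>s. X s \<omega> / c) \<partial>M)" for c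
    have unif: "\<exists>\<delta>>0. \<forall>y y'. (\<forall>s\<le>t. 0 \<le> y s \<and> y s \<le> K \<and> 0 \<le> y' s \<and> y' s \<le> K \<and> \<bar>y s - y' s\<bar> \<le> \<delta>) \<longrightarrow>
        \<bar>F' y - F' y'\<bar> \<le> e" if "0 < e" for K e
      unfolding F'_def add_diff_cancel_right F_def
      by (rule uniformly_continuous_on_boxes[OF Fc[unfolded F_def[abs_def]] that])
    have VQ: "((\<lambda>c. V c / tail_rate \<alpha> k c) \<longlongrightarrow> Q / fact k) at_top"
      unfolding V_def Q_def X by (rule exceedance_functional_asymptotics[OF F'm F'(1,2) unif])
    have Plim: "((\<lambda>c. prob (?A c) / tail_rate \<alpha> k c) \<longlongrightarrow> 1 / fact k) at_top"
      unfolding X by (rule prob_exceedance_asymptotics)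
    have "((\<lambda>c. (V c / tail_rate \<alpha> k c) / (prob (?A c) / tail_rate \<alpha> k c) - b) \<longlongrightarrow> (Q / fact k) / (1 / fact k) - b) at_top"
      by (intro tendsto_intros VQ Plim) auto
    moreover have "(Q / fact k) / (1 / fact k) - b = (\<integral>x. f x \<partial>distr N ?V (\<lambda>\<omega>. \<lambda>s\<in>{0..t}. P\<^sub>\<alpha> \<omega> * \<Theta> s \<omega>))"
    proof -
      interpret N: prob_space N by fact
      have \<Theta>m: "(\<lambda>\<omega>. \<Theta> s \<omega>) \<in> borel_measurable N" for s
      proof -
        have "(\<lambda>\<omega> s. \<Theta> s \<omega>) \<in> measurable N (\<Pi>\<^sub>M s\<in>(UNIV :: nat set). borel)"
          using pareto_indep by (simp add: indep_pair_def)
        from measurable_compose[OF this measurable_component_singleton[of s]] show ?thesis by simp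
      qed
      have m: "(\<lambda>\<omega>. \<lambda>s\<in>{0..t}. P\<^sub>\<alpha> \<omega> * \<Theta> s \<omega>) \<in> measurable N ?V"
        using pareto_rv \<Theta>m by (intro measurable_restrict borel_measurable_times)
      have "Q = (\<integral>\<omega>. F' (\<lambda>s. P\<^sub>\<alpha> \<omega> * \<Theta> s \<omega>) \<partial>N)"
        unfolding Q_def using \<open>k \<ge> 1\<close>
        by (intro limit_expectation[OF \<open>prob_space N\<close> T_indep T_law \<Theta> pareto_rv pareto pareto_indep _ F'm F'(3), symmetric]) auto
      also have "\<dots> = (\<integral>\<omega>. F (\<lambda>s. P\<^sub>\<alpha> \<omega> * \<Theta> s \<omega>) \<partial>N) + b"
      proof -
        have "(\<lambda>\<omega>. F (\<lambda>s. P\<^sub>\<alpha> \<omega> * \<Theta> s \<omega>)) \<in> borel_measurable N"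
          unfolding F_def using measurable_compose[OF m fm] by simp
        then have "integrable N (\<lambda>\<omega>. F (\<lambda>s. P\<^sub>\<alpha> \<omega> * \<Theta> s \<omega>))"
          using b by (intro N.integrable_const_bound[where B = b] AE_I2) auto
        then show ?thesis by (simp add: F'_def N.prob_space)
      qed
      also have "(\<integral>\<omega>. F (\<lambda>s. P\<^sub>\<alpha> \<omega> * \<Theta> s \<omega>) \<partial>N) = (\<integral>x. f x \<partial>distr N ?V (\<lambda>\<omega>. \<lambda>s\<in>{0..t}. P\<^sub>\<alpha> \<omega> * \<Theta> s \<omega>))"
        unfolding F_def by (rule integral_distr[OF m fm, symmetric])
      finally show ?thesis by simp
    qed
    moreover have "\<forall>\<^sub>F c in at_top. (V c / tail_rate \<alpha> k c) / (prob (?A c) / tail_rate \<alpha> k c) - b =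
        (\<integral>x. f x \<partial>distr (uniform_measure M (?A c)) ?V (\<lambda>\<omega>. \<lambda>s\<in>{0..t}. X s \<omega> / c))"
    proof -
      have "\<forall>\<^sub>F c in at_top. 0 < prob (?A c) / tail_rate \<alpha> k c"
        using Plim by (rule order_tendstoD) simp
      with eventually_gt_at_top[of 1] show ?thesis
      proof eventually_elim
        case (elim c)
        have r: "0 < tail_rate \<alpha> k c" using elim by (intro tail_rate_pos \<open>\<alpha> > 0\<close>) auto
        have p0: "0 < prob (?A c)" using elim r by (simp add: zero_less_divide_iff)
        have A: "?A c \<in> events" using Xm by measurable
        have m: "(\<lambda>\<omega>. \<lambda>s\<in>{0..t}. X s \<omega> / c) \<in> measurable M ?V"
          using Xm by (intro measurable_restrict borel_measurable_divide) auto
        have m': "(\<lambda>\<omega>. \<lambda>s\<in>{0..t}. X s \<omega> / c) \<in> measurable (uniform_measure M (?A c)) ?V"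
          using m by (simp add: measurable_cong_sets[OF sets_uniform_measure refl])
        have FX: "(\<lambda>\<omega>. F (\<lambda>s. X s \<omega> / c)) \<in> borel_measurable M"
          unfolding F_def using measurable_compose[OF m fm] by simp
        have um: "uniform_measure M (?A c) = density M (\<lambda>\<omega>. ennreal (indicator (?A c) \<omega> / prob (?A c)))"
          unfolding uniform_measure_def emeasure_eq_measure using p0
          by (intro arg_cong[where f = "density M"] ext)
            (auto simp: indicator_def divide_ennreal ennreal_1[symmetric] simp del: ennreal_1)
        have "(\<integral>x. f x \<partial>distr (uniform_measure M (?A c)) ?V (\<lambda>\<omega>. \<lambda>s\<in>{0..t}. X s \<omega> / c)) =
            (\<integral>\<omega>. F (\<lambda>s. X s \<omega> / c) \<partial>uniform_measure M (?A c))"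
          unfolding F_def by (rule integral_distr[OF m' fm])
        also have "\<dots> = (\<integral>\<omega>. F (\<lambda>s. X s \<omega> / c) \<partial>density M (\<lambda>\<omega>. ennreal (indicator (?A c) \<omega> / prob (?A c))))"
          unfolding um ..
        also have "(\<integral>\<omega>. F (\<lambda>s. X s \<omega> / c) \<partial>density M (\<lambda>\<omega>. ennreal (indicator (?A c) \<omega> / prob (?A c)))) =
            (\<integral>\<omega>. indicator (?A c) \<omega> / prob (?A c) * F (\<lambda>s. X s \<omega> / c) \<partial>M)"
          using FX A p0 by (subst integral_real_density) auto
        also have "\<dots> = (\<integral>\<omega>. (indicator (?A c) \<omega> * F' (\<lambda>s. X s \<omega> / c)) / prob (?A c) - b / prob (?A c) * indicator (?A c) \<omega> \<partial>M)"
          by (intro Bochner_Integration.integral_cong refl) (simp add: F'_def indicator_def diff_divide_distrib[symmetric])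
        also have "\<dots> = V c / prob (?A c) - b / prob (?A c) * prob (?A c)"
        proof -
          have i1: "integrable M (\<lambda>\<omega>. indicator (?A c) \<omega> * F' (\<lambda>s. X s \<omega> / c))"
            using FX A F'(3) b[of undefined]
            by (intro integrable_const_bound[where B = "2 * b"] AE_I2) (auto simp: indicator_def F'_def)
          have i2: "integrable M (indicator (?A c) :: _ \<Rightarrow> real)"
            using A by (intro integrable_real_indicator) (auto simp: emeasure_eq_measure)
          have "(\<integral>\<omega>. indicator (?A c) \<omega> \<partial>M) = prob (?A c)"
            using sets.sets_into_space[OF A] by (simp add: Int_absorb2)
          then show ?thesis using i1 i2 by (simp add: V_def)
        qed
        also have "\<dots> = (V c / tail_rate \<alpha> k c) / (prob (?A c) / tail_rate \<alpha> k c) - b"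
          using p0 r by simp
        finally show ?case by (rule sym)
      qed
    qed
    ultimately show "((\<lambda>c. \<integral>x. f x \<partial>distr (uniform_measure M (?A c)) ?V (\<lambda>\<omega>. \<lambda>s\<in>{0..t}. X s \<omega> / c)) \<longlongrightarrow>
        (\<integral>x. f x \<partial>distr N ?V (\<lambda>\<omega>. \<lambda>s\<in>{0..t}. P\<^sub>\<alpha> \<omega> * \<Theta> s \<omega>))) at_top"
      by (auto intro: Lim_transform_eventually)
  qed
qed

end
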